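(* Let $G$ be a second countable compact group, let $A$ be a separable unital $C^*$-algebra, and let $\alpha\colon G\to\mathrm{Aut}(A)$ be a continuous action. Then $\alpha$ has the continuous Rokhlin property if and only if there exists a family $(\Psi_t)_{t\in[0,\infty)}$ of unital completely positive maps $\Psi_t\colon C(G)\otimes A\to A$ such that: (i) for every $x\in C(G)\otimes A$, the map $[0,\infty)\to A$, $t\mapsto\Psi_t(x)$, is norm-continuous; (ii) $\lim_{t\to\infty}\|\Psi_t(xy)-\Psi_t(x)\Psi_t(y)\|=0$ for all $x,y\in C(G)\otimes A$; (iii) $\lim_{t\to\infty}\sup_{g\in G}\|\Psi_t((\mathtt{Lt}_g\otimes\alpha_g)(x))-\alpha_g(\Psi_t(x))\|=0$ for all $x\in C(G)\otimes A$; (iv) $\lim_{t\to\infty}\Psi_t(1\otimes a)=a$ for all $a\in A$.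
   Context: $\mathtt{Lt}\colon G\to\mathrm{Aut}(C(G))$ denotes the action by left translation, $\mathtt{Lt}_g(f)(h)=f(g^{-1}h)$. Actions are point-norm continuous. Asymptotic morphisms. For $C^*$-algebras $C$ and $B$, an asymptotic morphism $\Phi\colon C\rightrightarrows B$ is a family $(\Phi_t)_{t\in[0,\infty)}$ of maps $C\to B$ such that $t\mapsto\Phi_t(c)$ is continuous for every $c\in C$, and, as $t\to\infty$, $\|\Phi_t(\lambda c+d)-\lambda\Phi_t(c)-\Phi_t(d)\|\to0$, $\|\Phi_t(cd)-\Phi_t(c)\Phi_t(d)\|\to0$ and $\|\Phi_t(c^* )-\Phi_t(c)^*\|\to0$ for all $\lambda\in\mathbb{C}$, $c,d\in C$. It is unital (respectively, completely positive) if there is $t_0$ such that $\Phi_t$ is unital (respectively, completely positive) for all $t\ge t_0$. It is asymptotically central if $\lim_{t\to\infty}\|\Phi_t(c)b-b\Phi_t(c)\|=0$ for all $c\in C$, $b\in B$. If $C,B$ carry actions $\gamma,\beta$ of a compact group $G$, it is equivariant if $\lim_{t\to\infty}\sup_{g\in G}\|\Phi_t(\gamma_g(c))-\beta_g(\Phi_t(c))\|=0$ for all $c\in C$. Continuous Rokhlin property. A continuous action $\alpha\colon G\to\mathrm{Aut}(A)$ of a second countable compact group on a separable unital $C^*$-algebra has the continuous Rokhlin property if there exists a unital, completely positive, equivariant and asymptotically central asymptotic morphism $\Phi\colon C(G)\rightrightarrows A$, where $C(G)$ carries $\mathtt{Lt}$. *)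

theory Defs
  imports "HOL-Analysis.Analysis"
begin

section \<open>C*-algebras\<close>

class scaleC =
  fixes scaleC :: "complex \<Rightarrow> 'a \<Rightarrow> 'a" (infixr "*\<^sub>C" 75)

class adjoint =
  fixes adj :: "'a \<Rightarrow> 'a"

class cstar_algebra = banach + real_normed_algebra + scaleC + adjoint +
  assumes scaleC_add_right: "c *\<^sub>C (x + y) = c *\<^sub>C x + c *\<^sub>C y"
    and scaleC_add_left: "(c + d) *\<^sub>C x = c *\<^sub>C x + d *\<^sub>C x"
    and scaleC_scaleC: "c *\<^sub>C d *\<^sub>C x = (c * d) *\<^sub>C x"
    and scaleR_scaleC: "r *\<^sub>R x = complex_of_real r *\<^sub>C x"
    and norm_scaleC: "norm (c *\<^sub>C x) = cmod c * norm x"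
    and mult_scaleC_left: "(c *\<^sub>C x) * y = c *\<^sub>C (x * y)"
    and mult_scaleC_right: "x * (c *\<^sub>C y) = c *\<^sub>C (x * y)"
    and adj_add: "adj (x + y) = adj x + adj y"
    and adj_scaleC: "adj (c *\<^sub>C x) = cnj c *\<^sub>C adj x"
    and adj_mult: "adj (x * y) = adj y * adj x"
    and adj_adj: "adj (adj x) = x"
    and cstar_identity: "norm (adj x * x) = (norm x)\<^sup>2"

text \<open>The unit comes from \<^class>\<open>monoid_mult\<close> rather than from \<^class>\<open>real_normed_algebra_1\<close>, so
  that the zero algebra counts as a unital C*-algebra.\<close>

class unital_cstar_algebra = cstar_algebra + monoid_mult

instantiation complex :: unital_cstar_algebra
begin

definition scaleC_complex :: "complex \<Rightarrow> complex \<Rightarrow> complex"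
  where "scaleC_complex c x = c * x"

definition adj_complex :: "complex \<Rightarrow> complex"
  where "adj_complex x = cnj x"

instance
  by standard
    (auto simp: scaleC_complex_def adj_complex_def algebra_simps scaleR_conv_of_real norm_mult
      power2_eq_square)

end

section \<open>The algebras \<open>C(G)\<close> and \<open>C(G) \<otimes> A = C(G, A)\<close>\<close>

text \<open>If \<open>G\<close> is compact, every continuous function on \<open>G\<close> is bounded, so the types
  \<open>'g \<Rightarrow>\<^sub>C complex\<close> and \<open>'g \<Rightarrow>\<^sub>C 'a\<close> are \<open>C(G)\<close> and \<open>C(G, A)\<close> with the supremum norm.\<close>

instance bcontfun :: (topological_space, complete_space) complete_space
proof
  fix f :: "nat \<Rightarrow> ('a, 'b) bcontfun"
  assume "Cauchy f"
  then obtain g where "uniform_limit UNIV f g sequentially"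
    using uniformly_convergent_eq_cauchy[of "\<lambda>_. True" f]
    unfolding Cauchy_def uniform_limit_sequentially_iff
    by (metis dist_fun_lt_imp_dist_val_lt)
  from uniform_limit_bcontfunE[OF this sequentially_bot]
  obtain l' where "g = apply_bcontfun l'" "(f \<longlonglongrightarrow> l')" by metis
  then show "convergent f"
    by (intro convergentI)
qed

instance bcontfun :: (topological_space, banach) banach ..

instantiation bcontfun :: (topological_space, real_normed_algebra) real_normed_algebra
begin

definition times_bcontfun :: "('a \<Rightarrow>\<^sub>C 'b) \<Rightarrow> ('a \<Rightarrow>\<^sub>C 'b) \<Rightarrow> 'a \<Rightarrow>\<^sub>C 'b"
  where "times_bcontfun f g = Bcontfun (\<lambda>h. f h * g h)"

lemma apply_times_bcontfun [simp]:
  fixes f g :: "'a \<Rightarrow>\<^sub>C 'b"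
  shows "(f * g) h = f h * g h"
proof -
  have "(\<lambda>h. f h * g h) \<in> bcontfun"
    by (rule bcontfun_normI[where b = "norm f * norm g"])
      (auto intro!: continuous_intros order_trans[OF norm_mult_ineq] mult_mono norm_bounded)
  then show ?thesis
    by (simp add: times_bcontfun_def Bcontfun_inverse)
qed

instance
proof
  fix x y :: "'a \<Rightarrow>\<^sub>C 'b"
  show "norm (x * y) \<le> norm x * norm y"
    by (rule norm_bound)
      (auto intro!: order_trans[OF norm_mult_ineq] mult_mono norm_bounded)
qed (auto intro!: bcontfun_eqI simp: algebra_simps)

end

lemma bounded_linear_scaleC: "bounded_linear (\<lambda>x::'a::cstar_algebra. c *\<^sub>C x)"
  by (rule bounded_linear_intro[where K = "cmod c"])
    (auto simp: scaleC_add_right scaleR_scaleC scaleC_scaleC norm_scaleC mult.commute)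

lemma bounded_linear_scaleC_left: "bounded_linear (\<lambda>c. c *\<^sub>C (x::'a::cstar_algebra))"
  by (rule bounded_linear_intro[where K = "norm x"])
    (auto simp: scaleC_add_left scaleR_scaleC scaleC_scaleC norm_scaleC scaleC_complex_def)

lemma norm_adj: "norm (adj x) = norm (x::'a::cstar_algebra)"
proof -
  have le: "norm y \<le> norm (adj y)" for y :: 'a
  proof (cases "norm y = 0")
    case False
    have "norm y * norm y \<le> norm (adj y) * norm y"
      using cstar_identity[of y] norm_mult_ineq[of "adj y" y] by (simp add: power2_eq_square)
    then show ?thesis
      using False by (simp add: mult_le_cancel_right)
  qed simp
  show ?thesis
    using le[of x] le[of "adj x"] by (simp add: adj_adj)
qed

lemma bounded_linear_adj: "bounded_linear (adj :: 'a::cstar_algebra \<Rightarrow> 'a)"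
  by (rule bounded_linear_intro[where K = 1])
    (auto simp: adj_add scaleR_scaleC adj_scaleC norm_adj)

instantiation bcontfun :: (topological_space, cstar_algebra) cstar_algebra
begin

definition scaleC_bcontfun :: "complex \<Rightarrow> ('a \<Rightarrow>\<^sub>C 'b) \<Rightarrow> 'a \<Rightarrow>\<^sub>C 'b"
  where "scaleC_bcontfun c f = Bcontfun (\<lambda>h. c *\<^sub>C f h)"

definition adj_bcontfun :: "('a \<Rightarrow>\<^sub>C 'b) \<Rightarrow> 'a \<Rightarrow>\<^sub>C 'b"
  where "adj_bcontfun f = Bcontfun (\<lambda>h. adj (f h))"

lemma apply_scaleC_bcontfun [simp]:
  fixes f :: "'a \<Rightarrow>\<^sub>C 'b"
  shows "(c *\<^sub>C f) h = c *\<^sub>C f h"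
proof -
  have "(\<lambda>h. c *\<^sub>C f h) \<in> bcontfun"
    by (rule bcontfun_normI[where b = "cmod c * norm f"])
      (auto intro!: bounded_linear.continuous_on[OF bounded_linear_scaleC] mult_left_mono
        norm_bounded simp: norm_scaleC)
  then show ?thesis
    by (simp add: scaleC_bcontfun_def Bcontfun_inverse)
qed

lemma apply_adj_bcontfun [simp]:
  fixes f :: "'a \<Rightarrow>\<^sub>C 'b"
  shows "(adj f) h = adj (f h)"
proof -
  have "(\<lambda>h. adj (f h)) \<in> bcontfun"
    by (rule bcontfun_normI[where b = "norm f"])
      (auto intro!: bounded_linear.continuous_on[OF bounded_linear_adj] norm_bounded
        simp: norm_adj)
  then show ?thesis
    by (simp add: adj_bcontfun_def Bcontfun_inverse)
qed

instance
proof
  fix x y :: "'a \<Rightarrow>\<^sub>C 'b" and c d :: complex and r :: real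
  show "norm (c *\<^sub>C x) = cmod c * norm x"
  proof (rule antisym)
    show "norm (c *\<^sub>C x) \<le> cmod c * norm x"
      by (rule norm_bound) (simp add: norm_scaleC mult_left_mono norm_bounded)
    show "cmod c * norm x \<le> norm (c *\<^sub>C x)"
    proof (cases "c = 0")
      case False
      have "norm x \<le> norm (c *\<^sub>C x) / cmod c"
      proof (rule norm_bound)
        fix h
        show "norm (x h) \<le> norm (c *\<^sub>C x) / cmod c"
          using norm_bounded[of "c *\<^sub>C x" h] False
          by (simp add: norm_scaleC field_simps)
      qed
      then show ?thesis
        using False by (simp add: field_simps)
    qed simp
  qed
  show "norm (adj x * x) = (norm x)\<^sup>2"
  proof (rule antisym)
    show "norm (adj x * x) \<le> (norm x)\<^sup>2"
      by (rule norm_bound) (simp add: cstar_identity power_mono norm_bounded)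
    have "norm x \<le> sqrt (norm (adj x * x))"
    proof (rule norm_bound)
      fix h
      show "norm (x h) \<le> sqrt (norm (adj x * x))"
        using norm_bounded[of "adj x * x" h]
        by (simp add: cstar_identity real_le_rsqrt)
    qed
    then show "(norm x)\<^sup>2 \<le> norm (adj x * x)"
      by (metis norm_ge_zero real_sqrt_pow2 power_mono)
  qed
qed (auto intro!: bcontfun_eqI simp: scaleC_add_right scaleC_add_left scaleC_scaleC
      scaleR_scaleC mult_scaleC_left mult_scaleC_right adj_add adj_scaleC adj_mult adj_adj)

end

instantiation bcontfun :: (topological_space, unital_cstar_algebra) unital_cstar_algebra
begin

definition one_bcontfun :: "'a \<Rightarrow>\<^sub>C 'b"
  where "one_bcontfun = const_bcontfun 1"

lemma apply_one_bcontfun [simp]: "(1 :: 'a \<Rightarrow>\<^sub>C 'b) h = 1"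
  by (simp add: one_bcontfun_def)

instance
  by standard (auto intro!: bcontfun_eqI)

end

definition elem_tensor ::
    "('g::topological_space \<Rightarrow>\<^sub>C complex) \<Rightarrow> 'a::cstar_algebra \<Rightarrow> ('g \<Rightarrow>\<^sub>C 'a)" (infixl "\<otimes>\<^sub>C" 70)
  where "f \<otimes>\<^sub>C a = Bcontfun (\<lambda>h. f h *\<^sub>C a)"

text \<open>The following facts show that \<open>C(G, A)\<close>, with the elementary tensors above, is the
  C*-tensor product \<open>C(G) \<otimes> A\<close>: the map from the algebraic tensor product is a well-defined
  injective *-homomorphism with dense range, and the C*-norm on the algebraic tensor product
  is unique because \<open>C(G)\<close> is nuclear.\<close>

lemma apply_elem_tensor [simp]:
  fixes f :: "'g::topological_space \<Rightarrow>\<^sub>C complex" and a :: "'a::cstar_algebra"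
  shows "(f \<otimes>\<^sub>C a) h = f h *\<^sub>C a"
proof -
  have "(\<lambda>h. f h *\<^sub>C a) \<in> bcontfun"
    by (rule bcontfun_normI[where b = "norm f * norm a"])
      (auto intro!: bounded_linear.continuous_on[OF bounded_linear_scaleC_left] mult_right_mono
        norm_bounded simp: norm_scaleC)
  then show ?thesis
    by (simp add: elem_tensor_def Bcontfun_inverse)
qed

lemma elem_tensor_bilinear:
  "(f + f') \<otimes>\<^sub>C a = f \<otimes>\<^sub>C a + f' \<otimes>\<^sub>C a"
  "f \<otimes>\<^sub>C (a + a') = f \<otimes>\<^sub>C a + f \<otimes>\<^sub>C a'"
  "(c *\<^sub>C f) \<otimes>\<^sub>C a = c *\<^sub>C (f \<otimes>\<^sub>C a)"
  "f \<otimes>\<^sub>C (c *\<^sub>C a) = c *\<^sub>C (f \<otimes>\<^sub>C a)"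
  by (auto intro!: bcontfun_eqI simp: scaleC_add_left scaleC_add_right scaleC_scaleC
      scaleC_complex_def mult.commute)

lemma elem_tensor_mult: "(f \<otimes>\<^sub>C a) * (f' \<otimes>\<^sub>C a') = (f * f') \<otimes>\<^sub>C (a * a')"
  by (auto intro!: bcontfun_eqI simp: mult_scaleC_left mult_scaleC_right scaleC_scaleC
      mult.commute)

lemma adj_elem_tensor: "adj (f \<otimes>\<^sub>C a) = adj f \<otimes>\<^sub>C adj a"
  by (auto intro!: bcontfun_eqI simp: adj_scaleC adj_complex_def)

lemma one_elem_tensor_one:
  "1 \<otimes>\<^sub>C 1 = (1 :: 'g::topological_space \<Rightarrow>\<^sub>C 'a::unital_cstar_algebra)"
proof (rule bcontfun_eqI)
  fix h :: 'g
  show "((1 :: 'g \<Rightarrow>\<^sub>C complex) \<otimes>\<^sub>C (1 :: 'a)) h = (1 :: 'g \<Rightarrow>\<^sub>C 'a) h"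
    using scaleR_scaleC[of 1 "1 :: 'a"] by simp
qed

lemma apply_sum_bcontfun: "(sum F I) h = (\<Sum>i\<in>I. (F i) h)"
  for F :: "'i \<Rightarrow> ('g::topological_space \<Rightarrow>\<^sub>C 'a::real_normed_vector)"
  by (induction I rule: infinite_finite_induct) auto

lemma elem_tensor_injective:
  fixes f :: "'i \<Rightarrow> ('g::topological_space \<Rightarrow>\<^sub>C complex)" and a :: "'i \<Rightarrow> 'a::cstar_algebra"
  assumes indep: "\<And>c. (\<Sum>i\<in>I. c i *\<^sub>C a i) = 0 \<Longrightarrow> \<forall>i\<in>I. c i = 0"
    and zero: "(\<Sum>i\<in>I. f i \<otimes>\<^sub>C a i) = 0"
    and "i \<in> I"
  shows "f i = 0"
proof (rule bcontfun_eqI)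
  fix h
  have "(\<Sum>i\<in>I. f i h *\<^sub>C a i) = (\<Sum>i\<in>I. f i \<otimes>\<^sub>C a i) h"
    by (simp add: apply_sum_bcontfun)
  then show "f i h = (0 :: 'g \<Rightarrow>\<^sub>C complex) h"
    using indep[of "\<lambda>i. f i h"] zero \<open>i \<in> I\<close> by simp
qed

lemma elem_tensor_dense:
  fixes x :: "'g::topological_space \<Rightarrow>\<^sub>C 'a::cstar_algebra"
  assumes compact: "compact (UNIV :: 'g set)" and "e > 0"
  obtains P :: "'g set" and f :: "'g \<Rightarrow> ('g \<Rightarrow>\<^sub>C complex)" where
    "finite P" "norm (x - (\<Sum>p\<in>P. f p \<otimes>\<^sub>C x p)) \<le> e"
proof -
  define w where "w p h = max 0 (e - norm (x h - x p))" for p h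
  define U where "U p = {h. norm (x h - x p) < e}" for p
  have "open (U p)" for p
    unfolding U_def by (intro open_Collect_less continuous_intros) auto
  moreover have "UNIV \<subseteq> (\<Union>p\<in>UNIV. U p)"
    using \<open>e > 0\<close> by (auto simp: U_def)
  ultimately obtain P where P: "finite P" "UNIV \<subseteq> (\<Union>p\<in>P. U p)"
    by (rule compactE_image[OF compact])
  define s where "s h = (\<Sum>p\<in>P. w p h)" for h
  have w_nonneg: "w p h \<ge> 0" for p h
    by (simp add: w_def)
  have s_pos: "s h > 0" for h
  proof -
    obtain p where "p \<in> P" "h \<in> U p"
      using P by blast
    then show ?thesis
      unfolding s_def using P(1) w_nonneg
      by (intro sum_pos2[of P p]) (auto simp: w_def U_def)
  qed
  have cont_w: "continuous_on UNIV (w p)" for p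
    unfolding w_def by (intro continuous_intros) auto
  have cont: "(\<lambda>h. complex_of_real (w p h / s h)) \<in> bcontfun" if "p \<in> P" for p
  proof (rule bcontfun_normI[where b = 1])
    have "continuous_on UNIV s"
      unfolding s_def by (intro continuous_intros cont_w)
    then show "continuous_on UNIV (\<lambda>h. complex_of_real (w p h / s h))"
      using s_pos by (intro continuous_intros cont_w) (auto simp: less_imp_neq[symmetric])
    fix h
    have "w p h \<le> s h"
      unfolding s_def using that P(1) w_nonneg by (intro member_le_sum) auto
    then show "norm (complex_of_real (w p h / s h)) \<le> 1"
      using s_pos[of h] w_nonneg[of p h] by (simp del: of_real_divide)
  qed
  define f where "f p = Bcontfun (\<lambda>h. complex_of_real (w p h / s h))" for p
  have f: "f p h = complex_of_real (w p h / s h)" if "p \<in> P" for p h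
    unfolding f_def using cont[OF that] by (simp add: Bcontfun_inverse)
  have "norm (x - (\<Sum>p\<in>P. f p \<otimes>\<^sub>C x p)) \<le> e"
  proof (rule norm_bound)
    fix h
    have "(\<Sum>p\<in>P. w p h / s h) = 1"
      using s_pos[of h] by (simp add: s_def flip: sum_divide_distrib)
    then have "x h = (\<Sum>p\<in>P. (w p h / s h) *\<^sub>R x h)"
      by (simp flip: scaleR_left.sum)
    moreover have "(\<Sum>p\<in>P. f p \<otimes>\<^sub>C x p) h = (\<Sum>p\<in>P. (w p h / s h) *\<^sub>R x p)"
      by (simp add: apply_sum_bcontfun f scaleR_scaleC)
    ultimately have "(x - (\<Sum>p\<in>P. f p \<otimes>\<^sub>C x p)) h = (\<Sum>p\<in>P. (w p h / s h) *\<^sub>R (x h - x p))"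
      by (simp add: scaleR_diff_right sum_subtractf)
    also have "norm \<dots> \<le> (\<Sum>p\<in>P. (w p h / s h) * e)"
    proof (rule sum_norm_le)
      fix p
      show "norm ((w p h / s h) *\<^sub>R (x h - x p)) \<le> (w p h / s h) * e"
      proof (cases "w p h = 0")
        case False
        then have "norm (x h - x p) \<le> e"
          by (auto simp: w_def max_def split: if_splits)
        then show ?thesis
          using w_nonneg[of p h] s_pos[of h]
          by (auto intro!: divide_right_mono mult_left_mono)
      qed simp
    qed
    also have "\<dots> = e"
      using \<open>(\<Sum>p\<in>P. w p h / s h) = 1\<close> by (metis mult_1 sum_distrib_right)
    finally show "norm ((x - (\<Sum>p\<in>P. f p \<otimes>\<^sub>C x p)) h) \<le> e" .
  qed
  then show ?thesis
    using P(1) that by blast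
qed

section \<open>Completely positive maps\<close>

definition clinear :: "('c::cstar_algebra \<Rightarrow> 'b::cstar_algebra) \<Rightarrow> bool"
  where "clinear \<phi> \<longleftrightarrow> (\<forall>x y. \<phi> (x + y) = \<phi> x + \<phi> y) \<and> (\<forall>c x. \<phi> (c *\<^sub>C x) = c *\<^sub>C \<phi> x)"

text \<open>Positivity in \<open>M\<^sub>n(B)\<close>: \<open>X = Y* Y\<close> for some \<open>Y\<close> in \<open>M\<^sub>n(B)\<close>. Only the entries with
  indices below \<open>n\<close> are relevant.\<close>

definition positive_matrix :: "nat \<Rightarrow> (nat \<Rightarrow> nat \<Rightarrow> 'b::cstar_algebra) \<Rightarrow> bool"
  where "positive_matrix n X \<longleftrightarrow>
    (\<exists>Y. \<forall>i<n. \<forall>j<n. X i j = (\<Sum>k<n. adj (Y k i) * Y k j))"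

definition completely_positive :: "('c::cstar_algebra \<Rightarrow> 'b::cstar_algebra) \<Rightarrow> bool"
  where "completely_positive \<phi> \<longleftrightarrow> clinear \<phi> \<and>
    (\<forall>n X. positive_matrix n X \<longrightarrow> positive_matrix n (\<lambda>i j. \<phi> (X i j)))"

section \<open>Group actions\<close>

text \<open>Groups are written additively, as \<^class>\<open>topological_group_add\<close> is the library's class of
  topological groups; it does not include commutativity. Thus \<open>g\<inverse>h\<close> becomes \<open>- g + h\<close>.\<close>

definition star_automorphism :: "('a::cstar_algebra \<Rightarrow> 'a) \<Rightarrow> bool"
  where "star_automorphism \<phi> \<longleftrightarrow> clinear \<phi> \<and> (\<forall>x y. \<phi> (x * y) = \<phi> x * \<phi> y) \<and>
    (\<forall>x. \<phi> (adj x) = adj (\<phi> x)) \<and> bij \<phi>"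

definition continuous_action :: "('g::topological_group_add \<Rightarrow> 'a::cstar_algebra \<Rightarrow> 'a) \<Rightarrow> bool"
  where "continuous_action \<alpha> \<longleftrightarrow> (\<forall>g. star_automorphism (\<alpha> g)) \<and> \<alpha> 0 = id \<and>
    (\<forall>g h. \<alpha> (g + h) = \<alpha> g \<circ> \<alpha> h) \<and> (\<forall>a. continuous_on UNIV (\<lambda>g. \<alpha> g a))"

definition Lt :: "'g::topological_group_add \<Rightarrow> ('g \<Rightarrow>\<^sub>C complex) \<Rightarrow> ('g \<Rightarrow>\<^sub>C complex)"
  where "Lt g f = Bcontfun (\<lambda>h. f (- g + h))"

text \<open>\<open>Lt\<^sub>g \<otimes> \<alpha>\<^sub>g\<close> on \<open>C(G) \<otimes> A = C(G, A)\<close>. The function given to \<^const>\<open>Bcontfun\<close> is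
  continuous and bounded for every action \<open>\<alpha>\<close>, since *-automorphisms are isometric.\<close>

definition Lt_tensor ::
    "('g::topological_group_add \<Rightarrow> 'a::cstar_algebra \<Rightarrow> 'a) \<Rightarrow> 'g \<Rightarrow> ('g \<Rightarrow>\<^sub>C 'a) \<Rightarrow> ('g \<Rightarrow>\<^sub>C 'a)"
  where "Lt_tensor \<alpha> g x = Bcontfun (\<lambda>h. \<alpha> g (x (- g + h)))"

lemma apply_Lt [simp]: "(Lt g f) h = f (- g + h)"
proof -
  have "(\<lambda>h. f (- g + h)) \<in> bcontfun"
  proof (rule bcontfun_normI[where b = "norm f"])
    have "continuous_on UNIV (\<lambda>h. - g + h)"
      by (intro continuous_on_add continuous_on_const continuous_on_id)
    then show "continuous_on UNIV (\<lambda>h. f (- g + h))"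
      by (rule continuous_on_compose2[OF continuous_on_apply_bcontfun]) auto
  qed (rule norm_bounded)
  then show ?thesis
    by (simp add: Lt_def Bcontfun_inverse)
qed

lemma Lt_tensor_elem_tensor:
  assumes "clinear (\<alpha> g)"
  shows "Lt_tensor \<alpha> g (f \<otimes>\<^sub>C a) = Lt g f \<otimes>\<^sub>C \<alpha> g a"
proof -
  have "(\<lambda>h. \<alpha> g ((f \<otimes>\<^sub>C a) (- g + h))) = apply_bcontfun (Lt g f \<otimes>\<^sub>C \<alpha> g a)"
    using assms by (simp add: clinear_def fun_eq_iff)
  then show ?thesis
    by (simp add: Lt_tensor_def apply_bcontfun_inverse)
qed

section \<open>Asymptotic morphisms and the continuous Rokhlin property\<close>

definition asymptotic_morphism :: "(real \<Rightarrow> 'c::cstar_algebra \<Rightarrow> 'b::cstar_algebra) \<Rightarrow> bool"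
  where "asymptotic_morphism \<Phi> \<longleftrightarrow>
    (\<forall>c. continuous_on {0..} (\<lambda>t. \<Phi> t c)) \<and>
    (\<forall>l c d. ((\<lambda>t. norm (\<Phi> t (l *\<^sub>C c + d) - l *\<^sub>C \<Phi> t c - \<Phi> t d)) \<longlongrightarrow> 0) at_top) \<and>
    (\<forall>c d. ((\<lambda>t. norm (\<Phi> t (c * d) - \<Phi> t c * \<Phi> t d)) \<longlongrightarrow> 0) at_top) \<and>
    (\<forall>c. ((\<lambda>t. norm (\<Phi> t (adj c) - adj (\<Phi> t c))) \<longlongrightarrow> 0) at_top)"

definition asymptotic_unital ::
    "(real \<Rightarrow> 'c::unital_cstar_algebra \<Rightarrow> 'b::unital_cstar_algebra) \<Rightarrow> bool"
  where "asymptotic_unital \<Phi> \<longleftrightarrow> (\<exists>t0\<ge>0. \<forall>t\<ge>t0. \<Phi> t 1 = 1)"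

definition asymptotic_completely_positive ::
    "(real \<Rightarrow> 'c::cstar_algebra \<Rightarrow> 'b::cstar_algebra) \<Rightarrow> bool"
  where "asymptotic_completely_positive \<Phi> \<longleftrightarrow> (\<exists>t0\<ge>0. \<forall>t\<ge>t0. completely_positive (\<Phi> t))"

definition asymptotic_central :: "(real \<Rightarrow> 'c::cstar_algebra \<Rightarrow> 'b::cstar_algebra) \<Rightarrow> bool"
  where "asymptotic_central \<Phi> \<longleftrightarrow> (\<forall>c b. ((\<lambda>t. norm (\<Phi> t c * b - b * \<Phi> t c)) \<longlongrightarrow> 0) at_top)"

text \<open>Suprema over \<open>G\<close> are taken in the extended reals, where no boundedness has to be known.\<close>

definition asymptotic_equivariant :: "('g \<Rightarrow> 'c \<Rightarrow> 'c) \<Rightarrow> ('g \<Rightarrow> 'b \<Rightarrow> 'b) \<Rightarrow>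
    (real \<Rightarrow> 'c::cstar_algebra \<Rightarrow> 'b::cstar_algebra) \<Rightarrow> bool"
  where "asymptotic_equivariant \<gamma> \<beta> \<Phi> \<longleftrightarrow>
    (\<forall>c. ((\<lambda>t. SUP g. ereal (norm (\<Phi> t (\<gamma> g c) - \<beta> g (\<Phi> t c)))) \<longlongrightarrow> 0) at_top)"

definition continuous_Rokhlin_property ::
    "('g::topological_group_add \<Rightarrow> 'a::unital_cstar_algebra \<Rightarrow> 'a) \<Rightarrow> bool"
  where "continuous_Rokhlin_property \<alpha> \<longleftrightarrow>
    (\<exists>\<Phi> :: real \<Rightarrow> ('g \<Rightarrow>\<^sub>C complex) \<Rightarrow> 'a.
      asymptotic_morphism \<Phi> \<and> asymptotic_unital \<Phi> \<and> asymptotic_completely_positive \<Phi> \<and>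
      asymptotic_equivariant Lt \<alpha> \<Phi> \<and> asymptotic_central \<Phi>)"

end

theory Submission
  imports Defs
begin

text \<open>If \<open>\<Psi>\<close> is given, \<open>f \<mapsto> \<Psi>\<^sub>t (f \<otimes> 1)\<close> is asymptotically central because \<open>1 \<otimes> a\<close> commutes with
  \<open>f \<otimes> 1\<close> and \<open>\<Psi>\<^sub>t (1 \<otimes> a) \<rightarrow> a\<close>. Conversely, given \<open>\<Phi>\<close>, one wants \<open>\<Psi>\<^sub>t (f \<otimes> a) \<approx> \<Phi>\<^sub>t (f) a\<close> with \<open>\<Psi>\<^sub>t\<close>
  exactly unital and completely positive. As \<open>A\<close> need not be nuclear, no lifting theorem applies;
  instead \<open>\<Psi>\<^sub>t (x)\<close> is, up to normalization, \<open>\<Sum>\<^sub>p \<Phi>\<^sub>t (f\<^sub>p) x(p) \<Phi>\<^sub>t (f\<^sub>p)\<close>, where the \<open>f\<^sub>p\<^sup>2\<close> form a partition of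
  unity on \<open>G\<close>. The partitions are refined as \<open>t \<rightarrow> \<infinity>\<close>, so slowly that asymptotic centrality and
  multiplicativity of \<open>\<Phi>\<close> control the error, and consecutive maps are interpolated linearly.

  Complete positivity is defined through factorizations \<open>Y* Y\<close> with \<open>Y\<close> square, so sums of
  completely positive maps require square roots of positive elements of \<open>M\<^sub>n(A)\<close>. They are obtained
  from the binomial series of \<open>sqrt (1 - z)\<close>, whose coefficients are absolutely summable.\<close>

section \<open>The square root series\<close>

text \<open>Everything asymptotic about Psi follows from one relation: Psi_t(c (x) a) - Phi_t(c) a
  tends to 0 for each c and a. The partition consists of squares because b* x(p) b is completely
  positive in x, whereas a factor Phi_t(f_p^2) on one side of x(p) need not even give a positive
  map. The obstacle is that errors are summed over the whole partition, so the n-th partition is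
  usable only after a time that depends on it. Separability of A leaves countably many commutators,
  which a diagonal choice of times handles; second countability of G makes a sequence of partitions
  enough. Neither the partitions nor the switching times respect the action. Equivariance uniform in
  g comes from compactness of the orbit of an elementary tensor, together with norm bounds that are
  uniform in t. Positivity is built from norms and power series, without spectra. The root of h
  commutes with everything that commutes with h, and this takes the place of functional
  calculus.\<close>

definition sqrt_coeff :: "nat \<Rightarrow> real"
  where "sqrt_coeff k = (1/2 gchoose k) * (- 1) ^ k"

lemma sqrt_coeff_0 [simp]: "sqrt_coeff 0 = 1"
  by (simp add: sqrt_coeff_def)

text \<open>The coefficientwise form of sqrt (1 - z) * sqrt (1 - z) = 1 - z: Vandermonde's identity
  for 1/2 + 1/2 = 1.\<close>

lemma sqrt_coeff_convolution:
  "(\<Sum>p\<le>m. sqrt_coeff p * sqrt_coeff (m - p)) = (if m = 0 then 1 else if m = 1 then - 1 else 0)"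
proof -
  have "(\<Sum>p\<le>m. sqrt_coeff p * sqrt_coeff (m - p))
      = (\<Sum>p=0..m. (1/2 gchoose p) * (1/2 gchoose (m - p))) * (- 1) ^ m"
    unfolding sum_distrib_right atLeast0AtMost
    by (rule sum.cong) (auto simp: sqrt_coeff_def simp flip: power_add)
  also have "(\<Sum>p=0..m. (1/2 gchoose p) * (1/2 gchoose (m - p))) = ((1::real) gchoose m)"
    using gbinomial_Vandermonde[of "1/2::real" "1/2" m] by simp
  also have "((1::real) gchoose m) = of_nat (1 choose m)"
    by (metis binomial_gbinomial of_nat_1)
  finally show ?thesis
    by (cases "m \<le> 1") (auto simp: le_Suc_eq)
qed

text \<open>Summing coefficients is multiplication by 1 / (1 - z), so the partial sums are the
  coefficients of (1 - z) to the power -1/2, which are nonnegative.\<close>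

lemma sqrt_coeff_partial_sum: "(\<Sum>k\<le>m. sqrt_coeff k) = (- 1) ^ m * (- 1/2 gchoose m)"
  unfolding sqrt_coeff_def using gbinomial_sum_lower_neg[of "1/2::real" m] by simp

lemma sqrt_coeff_partial_sum_nonneg: "0 \<le> (\<Sum>k\<le>m. sqrt_coeff k)"
proof -
  have "(- 1) ^ m * (- 1/2 gchoose m) = pochhammer (1/2::real) m / fact m"
    by (simp add: gbinomial_pochhammer flip: power_add)
  then show ?thesis
    by (simp add: sqrt_coeff_partial_sum pochhammer_nonneg)
qed

lemma sqrt_coeff_Suc_nonpos: "sqrt_coeff (Suc k) \<le> 0"
proof -
  have "sqrt_coeff (Suc k) = pochhammer (- 1/2) (Suc k) / fact (Suc k)"
    by (simp only: sqrt_coeff_def gbinomial_pochhammer) (simp flip: power_add)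
  also have "pochhammer (- 1/2 :: real) (Suc k) = - 1/2 * pochhammer (1/2) k"
    by (simp add: pochhammer_rec)
  finally show ?thesis
    by (simp add: pochhammer_nonneg divide_nonneg_nonneg)
qed

text \<open>All coefficients after the constant term 1 are nonpositive, so their absolute values add
  up to 1 minus a partial sum. This gives convergence on the closed unit ball, boundary included;
  the value 1 of the bound is what \<open>norm_one_minus_sqrt1m\<close> rests on.\<close>

lemma sum_abs_sqrt_coeff: "(\<Sum>k<n. \<bar>sqrt_coeff (Suc k)\<bar>) \<le> 1"
proof -
  have "(\<Sum>k<n. \<bar>sqrt_coeff (Suc k)\<bar>) = 1 - (\<Sum>k\<le>n. sqrt_coeff k)"
    by (induction n) (simp_all add: sqrt_coeff_Suc_nonpos)
  with sqrt_coeff_partial_sum_nonneg[of n] show ?thesis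
    by simp
qed

lemma summable_sqrt_coeff: "summable (\<lambda>k. \<bar>sqrt_coeff k\<bar>)"
  by (subst summable_Suc_iff[symmetric])
    (rule summableI_nonneg_bounded[OF _ sum_abs_sqrt_coeff], simp)

lemma summable_norm_sqrt_series:
  fixes P :: "nat \<Rightarrow> 'a::real_normed_vector"
  assumes "\<And>k. norm (P k) \<le> 1"
  shows "summable (\<lambda>k. norm (sqrt_coeff k *\<^sub>R P k))"
  by (rule summable_comparison_test'[OF summable_sqrt_coeff, of 0])
    (use assms in \<open>auto intro!: mult_left_le\<close>)

text \<open>Stated for bounded families rather than powers, because it is also applied to entries of
  powers of a matrix.\<close>

lemma sqrt_series_times:
  fixes P Q :: "nat \<Rightarrow> 'a::{banach, real_normed_algebra}"
  assumes "\<And>k. norm (P k) \<le> 1" "\<And>k. norm (Q k) \<le> 1"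
  shows "(\<lambda>m. \<Sum>p\<le>m. (sqrt_coeff p * sqrt_coeff (m - p)) *\<^sub>R (P p * Q (m - p))) sums
    ((\<Sum>k. sqrt_coeff k *\<^sub>R P k) * (\<Sum>k. sqrt_coeff k *\<^sub>R Q k))"
  using Cauchy_product_sums[OF summable_norm_sqrt_series[of P] summable_norm_sqrt_series[of Q]] assms
  by (simp add: mult.commute)

section \<open>Positive elements\<close>

lemma adj_zero [simp]: "adj 0 = (0::'a::cstar_algebra)"
  using bounded_linear_adj[where 'a='a] by (simp add: linear_simps(3))
lemma adj_minus: "adj (- x) = - adj (x::'a::cstar_algebra)"
  using bounded_linear_adj[where 'a='a] by (rule linear_simps)
lemma adj_diff: "adj (x - y) = adj x - adj (y::'a::cstar_algebra)"
  using bounded_linear_adj[where 'a='a] by (rule linear_simps)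
lemma adj_scaleR: "adj (r *\<^sub>R x) = r *\<^sub>R adj (x::'a::cstar_algebra)"
  using bounded_linear_adj[where 'a='a] by (rule linear_simps)
lemma adj_sum: "adj (sum f I) = (\<Sum>i\<in>I. adj (f i :: 'a::cstar_algebra))"
  using bounded_linear_adj[where 'a='a] bounded_linear.linear linear_sum by blast

lemma scaleC_diff_right: "c *\<^sub>C (x - y) = c *\<^sub>C x - c *\<^sub>C (y::'a::cstar_algebra)"
  using bounded_linear_scaleC[where 'a='a] by (rule linear_simps)

lemma scaleC_minus_left: "(- c) *\<^sub>C x = - (c *\<^sub>C (x::'a::cstar_algebra))"
  using bounded_linear_scaleC_left[of x] by (rule linear_simps)

lemma scaleC_ii_ii: "\<i> *\<^sub>C \<i> *\<^sub>C x = - (x::'a::cstar_algebra)"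
  using scaleR_scaleC[of "- 1" x] by (simp add: scaleC_scaleC)

lemma adj_one [simp]: "adj 1 = (1::'a::unital_cstar_algebra)"
  by (metis adj_adj adj_mult mult_1 mult_1_right)

lemma adj_power: "adj (x ^ n) = adj (x::'a::unital_cstar_algebra) ^ n"
  by (induction n) (simp_all add: adj_mult power_commutes)

text \<open>Only an inequality, since the unit of the zero algebra has norm 0.\<close>

lemma norm_one_le: "norm (1::'a::unital_cstar_algebra) \<le> 1"
  using cstar_identity[of "1::'a"] by (auto simp: power2_eq_square)

lemma norm_scaleR_one_le: "0 \<le> c \<Longrightarrow> norm (c *\<^sub>R (1::'a::unital_cstar_algebra)) \<le> c"
  using mult_left_mono[OF norm_one_le, of c] by simp

lemma norm_power_le_one:
  fixes z :: "'a::unital_cstar_algebra"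
  assumes "norm z \<le> 1" shows "norm (z ^ k) \<le> 1"
proof (induction k)
  case (Suc k)
  have "norm (z ^ Suc k) \<le> norm z * norm (z ^ k)" by (simp add: norm_mult_ineq)
  also have "\<dots> \<le> 1" using assms Suc by (simp add: mult_le_one)
  finally show ?case .
qed (simp add: norm_one_le)

section \<open>The series for sqrt (1 - z) in a unital algebra\<close>

definition sqrt1m :: "'a \<Rightarrow> 'a::unital_cstar_algebra"
  where "sqrt1m z = (\<Sum>k. sqrt_coeff k *\<^sub>R z ^ k)"

lemma sqrt1m_sums:
  assumes "norm z \<le> 1"
  shows "(\<lambda>k. sqrt_coeff k *\<^sub>R z ^ k) sums sqrt1m z"
  unfolding sqrt1m_def
  by (intro summable_sums summable_norm_cancel[OF summable_norm_sqrt_series] norm_power_le_one assms)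

lemma sqrt1m_square:
  assumes "norm z \<le> 1"
  shows "sqrt1m z * sqrt1m z = 1 - z"
proof -
  have "(\<lambda>m. \<Sum>p\<le>m. (sqrt_coeff p * sqrt_coeff (m - p)) *\<^sub>R (z ^ p * z ^ (m - p))) sums
      (sqrt1m z * sqrt1m z)"
    unfolding sqrt1m_def by (intro sqrt_series_times norm_power_le_one assms)
  also have "(\<lambda>m. \<Sum>p\<le>m. (sqrt_coeff p * sqrt_coeff (m - p)) *\<^sub>R (z ^ p * z ^ (m - p)))
      = (\<lambda>m. if m \<in> {0, 1} then (if m = 0 then 1 else - z) else 0)"
  proof
    fix m
    have "(\<Sum>p\<le>m. (sqrt_coeff p * sqrt_coeff (m - p)) *\<^sub>R (z ^ p * z ^ (m - p)))
        = (\<Sum>p\<le>m. sqrt_coeff p * sqrt_coeff (m - p)) *\<^sub>R z ^ m"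
      unfolding scaleR_left.sum by (rule sum.cong) (auto simp flip: power_add)
    also have "\<dots> = (if m \<in> {0, 1} then (if m = 0 then 1 else - z) else 0)"
      by (simp add: sqrt_coeff_convolution)
    finally show "(\<Sum>p\<le>m. (sqrt_coeff p * sqrt_coeff (m - p)) *\<^sub>R (z ^ p * z ^ (m - p)))
        = (if m \<in> {0, 1} then (if m = 0 then 1 else - z) else 0)" .
  qed
  finally have "(\<lambda>m. if m \<in> {0, 1::nat} then (if m = 0 then 1 else - z) else 0) sums
      (sqrt1m z * sqrt1m z)" .
  moreover have "(\<lambda>m. if m \<in> {0, 1::nat} then (if m = 0 then 1 else - z) else 0) sums
      (\<Sum>m\<in>{0, 1::nat}. if m = 0 then 1 else - z)"
    by (rule sums_If_finite_set) simp
  ultimately show ?thesis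
    using sums_unique2 by force
qed

lemma adj_sqrt1m:
  assumes "norm z \<le> 1" "adj z = z"
  shows "adj (sqrt1m z) = sqrt1m z"
proof -
  have "(\<lambda>k. adj (sqrt_coeff k *\<^sub>R z ^ k)) sums adj (sqrt1m z)"
    by (intro bounded_linear.sums[OF bounded_linear_adj] sqrt1m_sums assms)
  then show ?thesis
    using sqrt1m_sums[OF assms(1)] by (simp add: adj_scaleR adj_power assms sums_unique2)
qed

lemma sqrt1m_commute:
  assumes "norm z \<le> 1" "x * z = z * x"
  shows "x * sqrt1m z = sqrt1m z * x"
proof -
  have "x * z ^ k = z ^ k * x" for k
    by (induction k) (simp_all, metis assms(2) mult.assoc)
  moreover have "(\<lambda>k. x * (sqrt_coeff k *\<^sub>R z ^ k)) sums (x * sqrt1m z)"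
    "(\<lambda>k. (sqrt_coeff k *\<^sub>R z ^ k) * x) sums (sqrt1m z * x)"
    by (intro bounded_linear.sums[OF bounded_linear_mult_right]
      bounded_linear.sums[OF bounded_linear_mult_left] sqrt1m_sums assms)+
  ultimately show ?thesis
    by (simp add: sums_unique2)
qed

text \<open>Shows that the root is itself positive, with s = 1 in the definition of
  \<open>pos\<close>.\<close>

lemma norm_one_minus_sqrt1m:
  assumes "norm z \<le> 1"
  shows "norm (1 - sqrt1m z) \<le> 1"
proof -
  have sm: "summable (\<lambda>k. norm (sqrt_coeff (Suc k) *\<^sub>R z ^ Suc k))"
    by (subst summable_Suc_iff) (intro summable_norm_sqrt_series norm_power_le_one assms)
  have "(\<lambda>k. sqrt_coeff (Suc k) *\<^sub>R z ^ Suc k) sums (sqrt1m z - 1)"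
    using sqrt1m_sums[OF assms] by (subst sums_Suc_iff) simp
  then have "norm (sqrt1m z - 1) \<le> (\<Sum>k. norm (sqrt_coeff (Suc k) *\<^sub>R z ^ Suc k))"
    using summable_norm[OF sm] by (simp add: sums_iff)
  also have "\<dots> \<le> 1"
  proof (rule suminf_le_const[OF sm])
    fix n
    have "(\<Sum>k<n. norm (sqrt_coeff (Suc k) *\<^sub>R z ^ Suc k)) \<le> (\<Sum>k<n. \<bar>sqrt_coeff (Suc k)\<bar>)"
      using norm_power_le_one[OF assms] by (intro sum_mono) (auto intro!: mult_left_le simp del: power_Suc)
    also have "\<dots> \<le> 1" by (rule sum_abs_sqrt_coeff)
    finally show "(\<Sum>k<n. norm (sqrt_coeff (Suc k) *\<^sub>R z ^ Suc k)) \<le> 1" .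
  qed
  finally show ?thesis by (simp add: norm_minus_commute)
qed

text \<open>The coefficients are summable majorants on the whole closed unit ball. This yields
  continuity in t of the correction term \<open>defect_root\<close>.\<close>

lemma continuous_on_sqrt1m:
  fixes z :: "'b::topological_space \<Rightarrow> 'a::unital_cstar_algebra"
  assumes "continuous_on S z" "\<And>t. t \<in> S \<Longrightarrow> norm (z t) \<le> 1"
  shows "continuous_on S (\<lambda>t. sqrt1m (z t))"
proof -
  have "uniform_limit S (\<lambda>n t. \<Sum>k<n. sqrt_coeff k *\<^sub>R z t ^ k)
      (\<lambda>t. \<Sum>k. sqrt_coeff k *\<^sub>R z t ^ k) sequentially"
    by (rule Weierstrass_m_test[OF _ summable_sqrt_coeff])
      (use norm_power_le_one assms(2) in \<open>auto intro!: mult_left_le\<close>)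
  then show ?thesis
    unfolding sqrt1m_def
    by (rule uniform_limit_theorem[rotated])
      (auto intro!: always_eventually continuous_intros assms(1))
qed

text \<open>The Kelley--Vaught form of positivity, for which closure under addition is evident. That it means
  being of the form \<open>w* w\<close> is the content of \<open>pos_root\<close> and \<open>pos_adj_mult\<close>.\<close>

definition pos :: "'a::unital_cstar_algebra \<Rightarrow> bool"
  where "pos h \<longleftrightarrow> adj h = h \<and> (\<exists>s\<ge>0. norm (s *\<^sub>R 1 - h) \<le> s)"

lemma pos_adj: "pos h \<Longrightarrow> adj h = h"
  by (simp add: pos_def)

lemma pos_zero [simp]: "pos 0"
  by (auto simp: pos_def intro!: exI[of _ 0])

lemma pos_add:
  assumes "pos h" "pos k"
  shows "pos (h + k)"
proof -
  obtain s t where "s \<ge> 0" "norm (s *\<^sub>R 1 - h) \<le> s" "t \<ge> 0" "norm (t *\<^sub>R 1 - k) \<le> t"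
    using assms unfolding pos_def by auto
  then have "norm ((s + t) *\<^sub>R 1 - (h + k)) \<le> s + t"
    using norm_triangle_mono[of "s *\<^sub>R 1 - h" s "t *\<^sub>R 1 - k" t]
    by (simp add: algebra_simps)
  with assms \<open>s \<ge> 0\<close> \<open>t \<ge> 0\<close> show ?thesis
    by (auto simp: pos_def adj_add intro!: exI[of _ "s + t"])
qed

lemma pos_sum: "(\<And>i. i \<in> I \<Longrightarrow> pos (f i)) \<Longrightarrow> pos (sum f I)"
  by (induction I rule: infinite_finite_induct) (auto intro: pos_add)

lemma pos_scaleR:
  assumes "pos h" "c \<ge> 0"
  shows "pos (c *\<^sub>R h)"
proof -
  obtain s where "s \<ge> 0" "norm (s *\<^sub>R 1 - h) \<le> s"
    using assms unfolding pos_def by auto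
  then have "norm ((c * s) *\<^sub>R 1 - c *\<^sub>R h) \<le> c * s"
    using mult_left_mono[of _ s c] assms(2) by (simp flip: scaleR_scaleR scaleR_diff_right)
  with assms \<open>s \<ge> 0\<close> show ?thesis
    by (auto simp: pos_def adj_scaleR intro!: exI[of _ "c * s"])
qed

lemma pos_scaleR_one_minus:
  assumes "adj h = h" "norm h \<le> c"
  shows "pos (c *\<^sub>R 1 - h)"
  using assms order_trans[OF norm_ge_zero assms(2)]
  by (auto simp: pos_def adj_diff adj_scaleR intro!: exI[of _ c])

text \<open>Write h = s (1 - z) with z in the closed unit ball and take sqrt s times
  \<open>sqrt1m z\<close>. As a limit of polynomials in h, the root commutes with the commutant of
  h; the third conclusion is what allows two roots to be multiplied later.\<close>

lemma pos_root:
  assumes "pos h"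
  obtains q where "pos q" "q * q = h" "\<And>x. x * h = h * x \<Longrightarrow> x * q = q * x"
proof -
  obtain s where s: "s \<ge> 0" "norm (s *\<^sub>R 1 - h) \<le> s" and h: "adj h = h"
    using assms unfolding pos_def by auto
  show ?thesis
  proof (cases "s = 0")
    case True
    then show ?thesis using s that[of 0] by simp
  next
    case False
    define z where "z = 1 - (1/s) *\<^sub>R h"
    have sz: "s *\<^sub>R 1 - h = s *\<^sub>R z"
      using False by (simp add: z_def scaleR_diff_right)
    then have z: "norm z \<le> 1" "adj z = z"
      using s False h by (simp_all add: z_def adj_diff adj_scaleR)
    define q where "q = sqrt s *\<^sub>R sqrt1m z"
    have "pos (sqrt1m z)"
      using norm_one_minus_sqrt1m[OF z(1)] adj_sqrt1m[OF z]
      by (auto simp: pos_def intro!: exI[of _ 1])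
    then have "pos q"
      unfolding q_def using s by (intro pos_scaleR) auto
    moreover have "q * q = h"
      using s False by (simp add: q_def sqrt1m_square[OF z(1)]) (simp add: z_def)
    moreover have "x * q = q * x" if "x * h = h * x" for x
    proof -
      have "x * z = z * x"
        using that by (simp add: z_def algebra_simps)
      from sqrt1m_commute[OF z(1) this] show ?thesis
        by (simp add: q_def)
    qed
    ultimately show ?thesis by (rule that)
  qed
qed

lemma norm_square_self_adjoint:
  "adj x = (x::'a::cstar_algebra) \<Longrightarrow> norm (x * x) = (norm x)\<^sup>2"
  using cstar_identity[of x] by simp

text \<open>Here \<open>y + \<i> w\<close> is \<open>sqrt c\<close> times a unitary, with real part \<open>y\<close>.\<close>

lemma norm_le_of_square_sum:
  fixes y w :: "'a::unital_cstar_algebra"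
  assumes "adj y = y" "adj w = w" "y * w = w * y" "y * y + w * w = c *\<^sub>R 1" "c \<ge> 0"
  shows "(norm y)\<^sup>2 \<le> c"
proof -
  define u where "u = y + \<i> *\<^sub>C w"
  have au: "adj u = y - \<i> *\<^sub>C w"
    using assms by (simp add: u_def adj_add adj_scaleC scaleC_minus_left)
  have "adj u * u = y * y + w * w"
    unfolding au by (simp add: u_def algebra_simps mult_scaleC_left mult_scaleC_right
        scaleC_diff_right scaleC_ii_ii assms(3))
  then have "(norm u)\<^sup>2 \<le> c"
    using norm_scaleR_one_le[OF assms(5), where 'a='a] cstar_identity[of u] assms(4) by simp
  moreover have "norm y \<le> norm u"
  proof -
    have "2 *\<^sub>R y = u + adj u"
      unfolding au by (simp add: u_def scaleR_2)
    then have "2 * norm y \<le> norm u + norm (adj u)"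
      by (metis norm_triangle_ineq norm_scaleR abs_numeral)
    then show ?thesis by (simp add: norm_adj)
  qed
  ultimately show ?thesis
    by (meson norm_ge_zero order_trans power_mono)
qed

text \<open>With c the square of the norm of y, the element c - y * y is visibly positive and has a
  root w commuting with y. Then w * w + y * y = c bounds the norm of w * w = c - y * y by c, which
  is the defining inequality for y * y.\<close>

lemma pos_square:
  assumes "adj y = (y::'a::unital_cstar_algebra)"
  shows "pos (y * y)"
proof -
  define c where "c = (norm y)\<^sup>2"
  have "pos (c *\<^sub>R 1 - y * y)"
    using norm_mult_ineq[of y y] assms
    by (intro pos_scaleR_one_minus) (auto simp: adj_mult c_def power2_eq_square)
  then obtain w where w: "pos w" "w * w = c *\<^sub>R 1 - y * y"
    and "\<And>x. x * (c *\<^sub>R 1 - y * y) = (c *\<^sub>R 1 - y * y) * x \<Longrightarrow> x * w = w * x"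
    by (rule pos_root) blast
  from this(3)[of y] have "w * y = y * w"
    by (simp add: algebra_simps)
  moreover have "w * w + y * y = c *\<^sub>R 1" "c \<ge> 0"
    using w by (simp_all add: c_def)
  ultimately have "(norm w)\<^sup>2 \<le> c"
    using assms pos_adj[OF w(1)] by (intro norm_le_of_square_sum[of w y])
  then have "norm (c *\<^sub>R 1 - y * y) \<le> c"
    using w(2) norm_square_self_adjoint[OF pos_adj[OF w(1)]] by simp
  then show ?thesis
    using assms \<open>c \<ge> 0\<close> by (auto simp: pos_def adj_mult)
qed

text \<open>The roots q of h and w of c - h commute and satisfy q * q + w * w = c, so
  \<open>norm_le_of_square_sum\<close> bounds q.\<close>

lemma norm_le_of_pos:
  assumes "pos h" "pos (c *\<^sub>R 1 - h)" "c \<ge> 0"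
  shows "norm h \<le> c"
proof -
  obtain q where q: "pos q" "q * q = h" and q_comm: "\<And>x. x * h = h * x \<Longrightarrow> x * q = q * x"
    using pos_root[OF assms(1)] by blast
  obtain w where w: "pos w" "w * w = c *\<^sub>R 1 - h"
    and w_comm: "\<And>x. x * (c *\<^sub>R 1 - h) = (c *\<^sub>R 1 - h) * x \<Longrightarrow> x * w = w * x"
    using pos_root[OF assms(2)] by blast
  have "w * h = h * w"
    using w_comm[of h] by (simp add: algebra_simps)
  then have "(norm q)\<^sup>2 \<le> c"
    using q w pos_adj q_comm[of w] assms(3) by (intro norm_le_of_square_sum[of q w]) auto
  then show ?thesis
    using q(2) norm_square_self_adjoint[OF pos_adj[OF q(1)]] by simp
qed

lemma norm_le_norm_pos_add:
  assumes "pos x" "pos y"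
  shows "norm x \<le> norm (x + y)"
proof (rule norm_le_of_pos)
  have "pos (norm (x + y) *\<^sub>R 1 - (x + y) + y)"
    using assms by (intro pos_add pos_scaleR_one_minus assms) (simp_all add: adj_add pos_adj)
  then show "pos (norm (x + y) *\<^sub>R 1 - x)" by simp
qed (simp_all add: assms)

text \<open>Put \<open>m = v v*\<close>, \<open>k = v* v\<close> and \<open>\<nu> = \<parallel>v\<parallel>\<^sup>2\<close>. The elements \<open>m (\<nu> + m)\<^sup>2\<close> and \<open>k (\<nu> + k)\<^sup>2\<close> have
  the same norm; it is at most \<open>\<nu>\<^sup>3\<close> since \<open>k \<le> 0\<close> and at least \<open>2 \<nu>\<^sup>3\<close> since \<open>m \<ge> 0\<close>.\<close>

lemma adj_mult_neg_imp_zero: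
  fixes v :: "'a::unital_cstar_algebra"
  assumes "pos (- (adj v * v))"
  shows "v = 0"
proof -
  define k where "k = adj v * v"
  define m where "m = v * adj v"
  define \<nu> where "\<nu> = (norm v)\<^sup>2"
  have norm_km: "norm k = \<nu>" "norm m = \<nu>" and \<nu>: "\<nu> \<ge> 0"
    using cstar_identity[of v] cstar_identity[of "adj v"]
    by (simp_all add: k_def m_def \<nu>_def adj_adj norm_adj)
  have sa: "adj k = k" "adj m = m"
    by (simp_all add: k_def m_def adj_mult adj_adj)
  have "pos m"
  proof -
    \<comment> \<open>a is twice the real part of v and b is minus twice the imaginary part. Their
      squares add up to 2 (k + m), so m is half this sum plus the positive element - k.\<close>
    define a where "a = v + adj v"
    define b where "b = \<i> *\<^sub>C (v - adj v)"
    have "adj a = a" "adj b = b"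
      by (simp_all add: a_def b_def adj_add adj_scaleC adj_diff adj_adj scaleC_minus_left scaleC_diff_right)
    then have "pos ((1/2) *\<^sub>R (a * a + b * b) + (- k))"
      using assms by (intro pos_add pos_scaleR pos_square) (simp_all add: k_def)
    also have "a * a + b * b = 2 *\<^sub>R (k + m)"
      by (simp add: a_def b_def k_def m_def algebra_simps mult_scaleC_left mult_scaleC_right
          scaleC_diff_right scaleC_ii_ii scaleR_2)
    finally show ?thesis by simp
  qed
  then obtain q where q: "pos q" "q * q = m" by (rule pos_root)
  define M where "M = \<nu> *\<^sub>R 1 + m"
  define K where "K = \<nu> *\<^sub>R 1 + k"
  have "norm K \<le> \<nu>"
  proof (rule norm_le_of_pos)
    show "pos K"
      using pos_scaleR_one_minus[of "- k" \<nu>] by (simp add: K_def sa adj_minus norm_km)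
    show "pos (\<nu> *\<^sub>R 1 - K)"
      using assms by (simp add: K_def k_def)
  qed (rule \<nu>)
  \<comment> \<open>This intertwining relation turns M m M into K k K once v* M is exchanged with
    its adjoint, which leaves the norm of the product unchanged.\<close>
  have vM: "adj v * M = K * adj v" "adj M = M"
    by (simp_all add: M_def K_def m_def k_def algebra_simps adj_add adj_scaleR adj_mult adj_adj)
  have "norm (M * m * M) = norm (adj (adj v * M) * (adj v * M))"
    by (simp add: adj_mult adj_adj vM(2) m_def mult.assoc)
  also have "\<dots> = norm ((adj v * M) * adj (adj v * M))"
    by (metis cstar_identity norm_adj adj_adj)
  also have "(adj v * M) * adj (adj v * M) = K * (adj v * v) * adj K"
    unfolding vM(1) by (simp add: adj_mult adj_adj mult.assoc)
  also have "norm \<dots> \<le> norm K * norm k * norm K"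
    using norm_mult_ineq[of K k] norm_mult_ineq[of "K * k" "adj K"]
    by (simp add: k_def norm_adj) (meson mult_right_mono norm_ge_zero order_trans)
  also have "\<dots> \<le> \<nu> * \<nu> * \<nu>"
    using \<open>norm K \<le> \<nu>\<close> \<nu> by (intro mult_mono) (simp_all add: norm_km)
  finally have le: "norm (M * m * M) \<le> \<nu> * \<nu> * \<nu>" .
  \<comment> \<open>M m M is the sum of 2 \<nu> m^2, m^3 and \<nu>^2 m, all positive; m^3 is the
    square of m q. Omitting the last two cannot increase the norm.\<close>
  have "2 * \<nu> * (\<nu> * \<nu>) = norm ((2 * \<nu>) *\<^sub>R (m * m))"
    using \<nu> norm_square_self_adjoint[OF sa(2)] by (simp add: norm_km power2_eq_square)
  also have "\<dots> \<le> norm ((2 * \<nu>) *\<^sub>R (m * m) + ((m * q) * (m * q) + (\<nu> * \<nu>) *\<^sub>R m))"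
  proof (rule norm_le_norm_pos_add)
    have "m * q = q * m"
      using q(2) by (metis mult.assoc)
    then have "adj (m * q) = m * q"
      using sa q pos_adj by (metis adj_mult)
    then show "pos ((m * q) * (m * q) + (\<nu> * \<nu>) *\<^sub>R m)"
      using \<open>pos m\<close> by (intro pos_add pos_scaleR pos_square) simp_all
    show "pos ((2 * \<nu>) *\<^sub>R (m * m))"
      using \<nu> sa by (intro pos_scaleR pos_square) auto
  qed
  also have "(m * q) * (m * q) = m * m * m"
    using q(2) by (metis mult.assoc)
  also have "(2 * \<nu>) *\<^sub>R (m * m) + (m * m * m + (\<nu> * \<nu>) *\<^sub>R m) = M * m * M"
    by (simp add: M_def algebra_simps flip: scaleR_2)
  finally have "\<nu> * \<nu> * \<nu> \<le> 0"
    using le by (simp add: algebra_simps)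
  then show ?thesis
    using \<nu> by (auto simp: \<nu>_def mult_le_0_iff)
qed

text \<open>Let y be the absolute value of h = w* w, that is the root of h * h, and n = y - h, twice
  the negative part of h. Then n h = - y n, so for v = w n the element - v* v = y n n is a square,
  hence positive. By \<open>adj_mult_neg_imp_zero\<close> v vanishes, whence n = 0 and h =
  y.\<close>

lemma pos_adj_mult:
  fixes w :: "'a::unital_cstar_algebra"
  shows "pos (adj w * w)"
proof -
  define h where "h = adj w * w"
  have h: "adj h = h"
    by (simp add: h_def adj_mult adj_adj)
  obtain y where y: "pos y" "y * y = h * h" and y_comm: "\<And>x. x * (h * h) = (h * h) * x \<Longrightarrow> x * y = y * x"
    using pos_root[OF pos_square[OF h]] by blast
  obtain r where r: "pos r" "r * r = y" and r_comm: "\<And>x. x * y = y * x \<Longrightarrow> x * r = r * x"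
    using pos_root[OF y(1)] by blast
  have hy: "h * y = y * h"
    by (rule y_comm) (simp add: mult.assoc)
  define n where "n = y - h"
  have n: "adj n = n" "n * y = y * n"
    using h y pos_adj by (simp_all add: n_def adj_diff algebra_simps hy)
  have nr: "n * r = r * n"
    by (rule r_comm[OF n(2)])
  have nh: "n * h = - (y * n)"
    by (simp add: n_def algebra_simps y(2) hy)
  define v where "v = w * n"
  have "- (adj v * v) = - (n * h) * n"
    by (simp add: v_def adj_mult n h_def mult.assoc)
  also have "\<dots> = (r * n) * (r * n)"
    unfolding nh using r(2) nr by (simp) (metis mult.assoc)
  finally have v: "- (adj v * v) = (r * n) * (r * n)" .
  have rn: "adj (r * n) = r * n"
    using n r pos_adj nr by (metis adj_mult)
  have "pos (- (adj v * v))"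
    unfolding v by (rule pos_square[OF rn])
  then have "v = 0"
    by (rule adj_mult_neg_imp_zero)
  then have "r * n = 0"
    using v norm_square_self_adjoint[OF rn] by simp
  then have "y * n = 0"
    using r(2) by (metis mult.assoc mult_zero_right)
  then have "n * n = 0"
    using nh n by (simp add: n_def algebra_simps) 
  then have "n = 0"
    using norm_square_self_adjoint[OF n(1)] by simp
  then show ?thesis
    using y(1) by (simp add: n_def h_def)
qed

lemma pos_conj:
  assumes "pos h"
  shows "pos (adj c * h * c)"
proof -
  obtain q where "pos q" "q * q = h"
    by (rule pos_root[OF assms]) (rule that)
  then have "adj c * h * c = adj (q * c) * (q * c)"
    using pos_adj[of q] by (auto simp: adj_mult mult.assoc)
  then show ?thesis by (simp only: pos_adj_mult)
qed

text \<open>The commuting positive elements c + h and c - h have product c^2 - h^2. It is positive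
  because it equals q (c - h) q with q a root of c + h, so \<open>norm_le_of_pos\<close> bounds
  h^2.\<close>

lemma norm_le_of_pos_both:
  assumes "pos (c *\<^sub>R 1 - h)" "pos (c *\<^sub>R 1 + h)" "c \<ge> 0"
  shows "norm h \<le> c"
proof -
  have h: "adj h = h" using pos_adj[OF assms(2)] by (simp add: adj_add adj_scaleR)
  have "(c *\<^sub>R 1 + h) * (c *\<^sub>R 1 - h) = (c * c) *\<^sub>R 1 - h * h" by (simp add: algebra_simps)
  moreover have "pos ((c *\<^sub>R 1 + h) * (c *\<^sub>R 1 - h))"
  proof -
    obtain q where q: "pos q" "q * q = c *\<^sub>R 1 + h"
      "\<And>x. x * (c *\<^sub>R 1 + h) = (c *\<^sub>R 1 + h) * x \<Longrightarrow> x * q = q * x"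
      using pos_root[OF assms(2)] by blast
    have "h * q = q * h" by (rule q(3)) (simp add: algebra_simps)
    then have "(c *\<^sub>R 1 + h) * (c *\<^sub>R 1 - h) = adj q * (c *\<^sub>R 1 - h) * q"
      unfolding q(2)[symmetric] pos_adj[OF q(1)] by (simp add: algebra_simps)
    then show ?thesis using pos_conj[OF assms(1), of q] by simp
  qed
  ultimately have "pos ((c * c) *\<^sub>R 1 - h * h)" by simp
  then have "(norm h)\<^sup>2 \<le> c\<^sup>2"
    using norm_le_of_pos[OF pos_square[OF h]] norm_square_self_adjoint[OF h]
    by (simp add: power2_eq_square)
  then show ?thesis
    using assms(3) by (rule power2_le_imp_le)
qed

section \<open>Sums of positive matrices\<close>

lemma positive_matrixE:
  assumes "positive_matrix n X"
  obtains Y where "\<And>i j. i < n \<Longrightarrow> j < n \<Longrightarrow> X i j = (\<Sum>k<n. adj (Y k i) * Y k j)"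
proof -
  obtain Y where "\<forall>i<n. \<forall>j<n. X i j = (\<Sum>k<n. adj (Y k i) * Y k j)"
    using assms unfolding positive_matrix_def by (elim exE)
  then show thesis by (intro that) auto
qed

lemma pos_norm_bound:
  fixes y \<xi> :: "'a::unital_cstar_algebra"
  shows "pos ((norm y)\<^sup>2 *\<^sub>R (adj \<xi> * \<xi>) - adj (y * \<xi>) * (y * \<xi>))"
proof -
  have "pos (adj \<xi> * ((norm y)\<^sup>2 *\<^sub>R 1 - adj y * y) * \<xi>)"
    by (intro pos_conj pos_scaleR_one_minus) (simp_all add: adj_mult adj_adj cstar_identity)
  then show ?thesis
    by (simp add: algebra_simps adj_mult)
qed

text \<open>Boundedness of a row of elements as an operator on A^n. For the induction step, 2 S* S +
  2 v* v - (S + v)* (S + v) = (S - v)* (S - v) is positive; this is where the factor 2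
  arises.\<close>

lemma pos_sum_bound:
  fixes y :: "nat \<Rightarrow> 'a::unital_cstar_algebra"
  shows "\<exists>C\<ge>0. \<forall>\<xi>. pos (C *\<^sub>R (\<Sum>j<n. adj (\<xi> j) * \<xi> j)
    - adj (\<Sum>j<n. y j * \<xi> j) * (\<Sum>j<n. y j * \<xi> j))"
proof (induction n)
  case 0
  then show ?case by auto
next
  case (Suc n)
  then obtain C where C: "C \<ge> 0" "\<And>\<xi>. pos (C *\<^sub>R (\<Sum>j<n. adj (\<xi> j) * \<xi> j)
    - adj (\<Sum>j<n. y j * \<xi> j) * (\<Sum>j<n. y j * \<xi> j))" by blast
  define D where "D = (norm (y n))\<^sup>2"
  have "pos ((2 * C + 2 * D) *\<^sub>R (\<Sum>j<Suc n. adj (\<xi> j) * \<xi> j)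
    - adj (\<Sum>j<Suc n. y j * \<xi> j) * (\<Sum>j<Suc n. y j * \<xi> j))" for \<xi>
  proof -
    define N where "N = (\<Sum>j<n. adj (\<xi> j) * \<xi> j)"
    define S where "S = (\<Sum>j<n. y j * \<xi> j)"
    define v where "v = y n * \<xi> n"
    define q where "q = adj (\<xi> n) * \<xi> n"
    have "pos (2 *\<^sub>R (C *\<^sub>R N - adj S * S) + 2 *\<^sub>R (D *\<^sub>R q - adj v * v)
        + adj (S - v) * (S - v) + (2 * D) *\<^sub>R N + (2 * C) *\<^sub>R q)"
      using C pos_norm_bound[of "y n" "\<xi> n"]
      by (intro pos_add pos_scaleR pos_adj_mult)
        (auto simp: N_def S_def D_def v_def q_def intro!: pos_sum pos_adj_mult)
    also have "\<dots> = (2 * C + 2 * D) *\<^sub>R (N + q) - adj (S + v) * (S + v)"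
      by (simp add: algebra_simps adj_add adj_diff scaleR_2)
    finally show ?thesis
      by (simp add: N_def S_def v_def q_def)
  qed
  then show ?case
    using C(1) by (intro exI[of _ "2 * C + 2 * D"]) (simp add: D_def)
qed

text \<open>The operator \<open>T = 1 - X / s\<close> on the Hilbert module \<open>A\<^sup>n\<close> satisfies \<open>0 \<le> T \<le> 1\<close>, hence
  \<open>T - T\<^sup>2 = T (1 - T) T + (1 - T) T (1 - T) \<ge> 0\<close>. So \<open>T\<close> is contractive, the entries of its
  powers are bounded by 1, and the square root series of \<open>1 - T\<close> converges entrywise.\<close>

lemma positive_matrix_of_form:
  fixes X :: "nat \<Rightarrow> nat \<Rightarrow> 'a::unital_cstar_algebra"
  assumes sa: "\<And>i j. i < n \<Longrightarrow> j < n \<Longrightarrow> adj (X i j) = X j i"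
    and form: "\<And>\<xi>. pos (\<Sum>i<n. adj (\<xi> i) * (\<Sum>j<n. X i j * \<xi> j))"
    and bound: "\<And>\<xi>. pos (s *\<^sub>R (\<Sum>i<n. adj (\<xi> i) * \<xi> i) - (\<Sum>i<n. adj (\<xi> i) * (\<Sum>j<n. X i j * \<xi> j)))"
    and "s > 0"
  shows "positive_matrix n X"
proof -
  define D :: "nat \<Rightarrow> nat \<Rightarrow> 'a" where "D i j = (if i = j then 1 else 0)" for i j
  define T where "T i j = D i j - (1/s) *\<^sub>R X i j" for i j
  have D_left: "(\<Sum>j<n. D i j * \<xi> j) = \<xi> i" if "i < n" for i \<xi>
  proof -
    have "(\<Sum>j<n. D i j * \<xi> j) = (\<Sum>j<n. if i = j then \<xi> j else 0)"
      by (rule sum.cong) (auto simp: D_def)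
    then show ?thesis using that by simp
  qed
  have D_right: "(\<Sum>j<n. \<xi> j * D j i) = \<xi> i" if "i < n" for i \<xi>
  proof -
    have "(\<Sum>j<n. \<xi> j * D j i) = (\<Sum>j<n. if i = j then \<xi> j else 0)"
      by (rule sum.cong) (auto simp: D_def)
    then show ?thesis using that by simp
  qed
  \<comment> \<open>The A-valued inner product of the Hilbert module; \<open>L\<close> is the
    operator T on it and \<open>M\<close> is 1 - T.\<close>
  define ip where "ip \<eta> \<xi> = (\<Sum>i<n. adj (\<eta> i) * \<xi> i)" for \<eta> \<xi> :: "nat \<Rightarrow> 'a"
  define L where "L \<xi> = (\<lambda>i. \<Sum>j<n. T i j * \<xi> j)" for \<xi> :: "nat \<Rightarrow> 'a"
  define M where "M \<xi> = (\<lambda>i. \<xi> i - L \<xi> i)" for \<xi> :: "nat \<Rightarrow> 'a"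
  have T_sa: "adj (T i j) = T j i" if "i < n" "j < n" for i j
    using sa[OF that] by (simp add: T_def D_def adj_diff adj_scaleR)
  have L_sa: "ip \<eta> (L \<xi>) = ip (L \<eta>) \<xi>" for \<eta> \<xi>
  proof -
    have "ip \<eta> (L \<xi>) = (\<Sum>i<n. \<Sum>j<n. adj (\<eta> i) * T i j * \<xi> j)"
      by (simp add: ip_def L_def sum_distrib_left mult.assoc)
    also have "\<dots> = (\<Sum>j<n. \<Sum>i<n. adj (\<eta> i) * T i j * \<xi> j)"
      by (rule sum.swap)
    also have "\<dots> = (\<Sum>j<n. \<Sum>i<n. adj (T j i * \<eta> i) * \<xi> j)"
      by (intro sum.cong refl) (simp add: adj_mult T_sa)
    also have "\<dots> = ip (L \<eta>) \<xi>"
      by (simp add: ip_def L_def sum_distrib_right adj_sum)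
    finally show ?thesis .
  qed
  have ip_L: "ip \<xi> (L \<xi>) = ip \<xi> \<xi> - (1/s) *\<^sub>R (\<Sum>i<n. adj (\<xi> i) * (\<Sum>j<n. X i j * \<xi> j))" for \<xi>
  proof -
    have "adj (\<xi> i) * L \<xi> i = adj (\<xi> i) * \<xi> i - (1/s) *\<^sub>R (adj (\<xi> i) * (\<Sum>j<n. X i j * \<xi> j))" if "i < n" for i
    proof -
      have "L \<xi> i = \<xi> i - (1/s) *\<^sub>R (\<Sum>j<n. X i j * \<xi> j)"
        using D_left[OF that, of \<xi>]
        by (simp add: L_def T_def left_diff_distrib sum_subtractf scaleR_sum_right)
      then show ?thesis by (simp add: right_diff_distrib)
    qed
    then show ?thesis
      by (simp add: ip_def sum_subtractf scaleR_sum_right)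
  qed
  have L_pos: "pos (ip \<xi> (L \<xi>))" for \<xi>
  proof -
    have "ip \<xi> (L \<xi>) = (1/s) *\<^sub>R (s *\<^sub>R ip \<xi> \<xi> - (\<Sum>i<n. adj (\<xi> i) * (\<Sum>j<n. X i j * \<xi> j)))"
      using \<open>s > 0\<close> by (simp add: ip_L scaleR_diff_right)
    then show ?thesis
      using bound[of \<xi>] \<open>s > 0\<close> by (auto simp: ip_def intro!: pos_scaleR)
  qed
  have ip_M: "ip \<eta> (M \<xi>) = ip \<eta> \<xi> - ip \<eta> (L \<xi>)" "ip (M \<eta>) \<xi> = ip \<eta> \<xi> - ip (L \<eta>) \<xi>" for \<eta> \<xi>
    by (simp_all add: ip_def M_def algebra_simps adj_diff sum_subtractf)
  have L_M: "L (M \<xi>) = M (L \<xi>)" for \<xi>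
    by (simp add: L_def M_def algebra_simps sum_subtractf)
  have M_pos: "pos (ip \<xi> (M \<xi>))" for \<xi>
    using form[of \<xi>] \<open>s > 0\<close> by (simp add: ip_M ip_L pos_scaleR)
  have contract: "pos (ip \<xi> \<xi> - ip (L \<xi>) (L \<xi>))" for \<xi>
  proof -
    \<comment> \<open>1 - T^2 is the sum of 1 - T, T (1 - T) T and (1 - T) T (1 - T).\<close>
    have "pos (ip \<xi> (M \<xi>) + (ip (L \<xi>) (M (L \<xi>)) + ip (M \<xi>) (L (M \<xi>))))"
      by (intro pos_add M_pos L_pos)
    also have "\<dots> = ip \<xi> \<xi> - ip (L \<xi>) (L \<xi>)"
      by (simp add: L_M ip_M) (simp add: L_sa)
    finally show ?thesis .
  qed

  \<comment> \<open>The k-th power of T. Multiplying from the left makes each column of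
    \<open>P (Suc k)\<close> the image under L of a column of \<open>P k\<close>, so that
    contractivity applies.\<close>
  define P where "P k = ((\<lambda>Q i j. \<Sum>l<n. T i l * Q l j) ^^ k) D" for k
  have P_0: "P 0 = D" and P_Suc: "P (Suc k) i j = (\<Sum>l<n. T i l * P k l j)" for k i j
    by (simp_all add: P_def)
  have P_add: "P (p + q) i j = (\<Sum>l<n. P p i l * P q l j)" if "i < n" for p q i j
    using that
  proof (induction p arbitrary: i)
    case 0
    then show ?case by (simp add: P_0 D_left)
  next
    case (Suc p)
    have "P (Suc p + q) i j = (\<Sum>m<n. \<Sum>l<n. T i m * P p m l * P q l j)"
      using Suc by (simp add: P_Suc sum_distrib_left mult.assoc)
    also have "\<dots> = (\<Sum>l<n. \<Sum>m<n. T i m * P p m l * P q l j)"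
      by (rule sum.swap)
    finally show ?case by (simp add: P_Suc sum_distrib_right)
  qed
  have P_1: "P 1 i j = T i j" if "j < n" for i j
    using that by (simp add: P_Suc P_0 D_right)
  have P_sa: "adj (P k i j) = P k j i" if "i < n" "j < n" for k i j
    using that
  proof (induction k arbitrary: i j)
    case 0
    then show ?case by (simp add: P_0 D_def)
  next
    case (Suc k)
    have "adj (P (Suc k) i j) = (\<Sum>l<n. P k j l * P 1 l i)"
      using Suc by (simp add: P_Suc[of k] P_1 adj_sum adj_mult T_sa del: One_nat_def)
    then show ?case
      using P_add[OF Suc.prems(2), of k 1 i] by simp
  qed
  have P_column: "pos (1 - ip (\<lambda>i. P k i j) (\<lambda>i. P k i j))" if "j < n" for k j
  proof (induction k)
    case 0
    have "ip (\<lambda>i. P 0 i j) (\<lambda>i. P 0 i j) = (\<Sum>i<n. if i = j then 1 else 0)"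
      unfolding ip_def by (rule sum.cong) (auto simp: P_0 D_def)
    then show ?case using that by simp
  next
    case (Suc k)
    have "(\<lambda>i. P (Suc k) i j) = L (\<lambda>i. P k i j)"
      by (simp add: P_Suc L_def)
    then show ?case
      using pos_add[OF Suc contract[of "\<lambda>i. P k i j"]] by simp
  qed
  \<comment> \<open>A single entry contributes one positive summand to the inner square of its
    column, which is at most 1.\<close>
  have P_norm: "norm (P k i j) \<le> 1" if "i < n" "j < n" for k i j
  proof -
    let ?p = "P k i j"
    have "ip (\<lambda>i. P k i j) (\<lambda>i. P k i j) = adj ?p * ?p + (\<Sum>l\<in>{..<n} - {i}. adj (P k l j) * P k l j)"
      unfolding ip_def using that by (intro sum.remove) auto
    then have "pos (1 *\<^sub>R 1 - adj ?p * ?p)"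
      using pos_add[OF P_column[OF that(2), of k] pos_sum[of "{..<n} - {i}" "\<lambda>l. adj (P k l j) * P k l j"]]
      by (simp add: pos_adj_mult)
    then have "norm (adj ?p * ?p) \<le> 1"
      by (intro norm_le_of_pos pos_adj_mult) simp_all
    then show ?thesis
      by (simp add: cstar_identity power_le_one_iff)
  qed

  \<comment> \<open>The matrix sqrt (1 - T), formed entrywise without a norm on matrices; its square
    is a finite sum of Cauchy products.\<close>
  define Z where "Z i j = (\<Sum>k. sqrt_coeff k *\<^sub>R P k i j)" for i j
  have Z_sa: "adj (Z i j) = Z j i" if "i < n" "j < n" for i j
  proof -
    have "summable (\<lambda>k. sqrt_coeff k *\<^sub>R P k i j)"
      by (rule summable_norm_cancel[OF summable_norm_sqrt_series]) (rule P_norm[OF that])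
    then have "adj (Z i j) = (\<Sum>k. adj (sqrt_coeff k *\<^sub>R P k i j))"
      unfolding Z_def by (rule bounded_linear.suminf[OF bounded_linear_adj])
    then show ?thesis
      using that by (simp add: Z_def adj_scaleR P_sa)
  qed
  have Z_square: "(\<Sum>l<n. Z i l * Z l j) = D i j - T i j" if "i < n" "j < n" for i j
  proof -
    have "(\<lambda>m. \<Sum>l<n. \<Sum>p\<le>m. (sqrt_coeff p * sqrt_coeff (m - p)) *\<^sub>R (P p i l * P (m - p) l j)) sums
        (\<Sum>l<n. Z i l * Z l j)"
      unfolding Z_def using that P_norm by (intro sums_sum sqrt_series_times) auto
    also have "(\<lambda>m. \<Sum>l<n. \<Sum>p\<le>m. (sqrt_coeff p * sqrt_coeff (m - p)) *\<^sub>R (P p i l * P (m - p) l j))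
      = (\<lambda>m. if m \<in> {0, 1} then (if m = 0 then D i j else - T i j) else 0)"
    proof
      fix m
      have "(\<Sum>l<n. \<Sum>p\<le>m. (sqrt_coeff p * sqrt_coeff (m - p)) *\<^sub>R (P p i l * P (m - p) l j))
         = (\<Sum>p\<le>m. (sqrt_coeff p * sqrt_coeff (m - p)) *\<^sub>R (\<Sum>l<n. P p i l * P (m - p) l j))"
        by (subst sum.swap) (simp add: scaleR_sum_right)
      also have "\<dots> = (\<Sum>p\<le>m. sqrt_coeff p * sqrt_coeff (m - p)) *\<^sub>R P m i j"
        unfolding scaleR_left.sum using that by (intro sum.cong) (auto simp flip: P_add)
      also have "\<dots> = (if m \<in> {0, 1} then (if m = 0 then D i j else - T i j) else 0)"
        using P_1[OF that(2), of i] by (auto simp: sqrt_coeff_convolution P_0)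
      finally show "(\<Sum>l<n. \<Sum>p\<le>m. (sqrt_coeff p * sqrt_coeff (m - p)) *\<^sub>R (P p i l * P (m - p) l j))
        = (if m \<in> {0, 1} then (if m = 0 then D i j else - T i j) else 0)" .
    qed
    finally have "(\<lambda>m. if m \<in> {0, 1::nat} then (if m = 0 then D i j else - T i j) else 0) sums
      (\<Sum>l<n. Z i l * Z l j)" .
    moreover have "(\<lambda>m. if m \<in> {0, 1::nat} then (if m = 0 then D i j else - T i j) else 0) sums
      (\<Sum>m\<in>{0, 1::nat}. if m = 0 then D i j else - T i j)"
      by (rule sums_If_finite_set) simp
    ultimately show ?thesis
      using sums_unique2 by force
  qed
  have "X i j = (\<Sum>l<n. adj (sqrt s *\<^sub>R Z l i) * (sqrt s *\<^sub>R Z l j))" if "i < n" "j < n" for i j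
  proof -
    have "(\<Sum>l<n. adj (sqrt s *\<^sub>R Z l i) * (sqrt s *\<^sub>R Z l j)) = (\<Sum>l<n. s *\<^sub>R (Z i l * Z l j))"
      using that \<open>s > 0\<close> by (intro sum.cong) (auto simp: adj_scaleR Z_sa)
    also have "\<dots> = s *\<^sub>R (D i j - T i j)"
      by (simp add: Z_square[OF that] flip: scaleR_sum_right)
    also have "\<dots> = X i j"
      using \<open>s > 0\<close> by (simp add: T_def)
    finally show ?thesis by simp
  qed
  then show ?thesis
    unfolding positive_matrix_def by (intro exI[of _ "\<lambda>i j. sqrt s *\<^sub>R Z i j"]) blast
qed

lemma gram_form:
  fixes Y :: "nat \<Rightarrow> nat \<Rightarrow> 'a::cstar_algebra"
  shows "(\<Sum>i<n. adj (\<xi> i) * (\<Sum>j<n. (\<Sum>k<m. adj (Y k i) * Y k j) * \<xi> j))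
    = (\<Sum>k<m. adj (\<Sum>j<n. Y k j * \<xi> j) * (\<Sum>j<n. Y k j * \<xi> j))"
proof -
  have "(\<Sum>i<n. adj (\<xi> i) * (\<Sum>j<n. (\<Sum>k<m. adj (Y k i) * Y k j) * \<xi> j))
    = (\<Sum>i<n. \<Sum>j<n. \<Sum>k<m. adj (Y k i * \<xi> i) * (Y k j * \<xi> j))"
    by (simp add: sum_distrib_left sum_distrib_right adj_mult mult.assoc)
  also have "\<dots> = (\<Sum>i<n. \<Sum>k<m. \<Sum>j<n. adj (Y k i * \<xi> i) * (Y k j * \<xi> j))"
    by (intro sum.cong refl sum.swap)
  also have "\<dots> = (\<Sum>k<m. \<Sum>i<n. \<Sum>j<n. adj (Y k i * \<xi> i) * (Y k j * \<xi> j))"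
    by (rule sum.swap)
  also have "\<dots> = (\<Sum>k<m. adj (\<Sum>j<n. Y k j * \<xi> j) * (\<Sum>j<n. Y k j * \<xi> j))"
    by (simp add: adj_sum sum_distrib_left sum_distrib_right)
      (intro sum.cong refl sum.swap)
  finally show ?thesis .
qed

text \<open>Stacking the two factors gives a rectangular matrix with 2n rows, not a square one.
  Instead, self-adjointness, positivity of the quadratic form and a bound for it are extracted from
  each summand. All three are additive and suffice for a new factorization.\<close>

lemma positive_matrix_add:
  fixes X X' :: "nat \<Rightarrow> nat \<Rightarrow> 'a::unital_cstar_algebra"
  assumes "positive_matrix n X" "positive_matrix n X'"
  shows "positive_matrix n (\<lambda>i j. X i j + X' i j)"
proof -
  let ?form = "\<lambda>X \<xi>. \<Sum>i<n. adj (\<xi> i) * (\<Sum>j<n. X i j * \<xi> j)"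
  have facts: "(\<forall>i<n. \<forall>j<n. adj (X i j) = X j i) \<and> (\<forall>\<xi>. pos (?form X \<xi>)) \<and>
      (\<exists>C\<ge>0. \<forall>\<xi>. pos (C *\<^sub>R (\<Sum>i<n. adj (\<xi> i) * \<xi> i) - ?form X \<xi>))"
    if pm: "positive_matrix n X" for X :: "nat \<Rightarrow> nat \<Rightarrow> 'a"
  proof -
    obtain Y where Y: "\<And>i j. i < n \<Longrightarrow> j < n \<Longrightarrow> X i j = (\<Sum>k<n. adj (Y k i) * Y k j)"
      by (rule positive_matrixE[OF pm]) (rule that)
    have "adj (X i j) = X j i" if "i < n" "j < n" for i j
      using that by (simp add: Y adj_sum adj_mult adj_adj)
    moreover have form: "?form X \<xi> = (\<Sum>k<n. adj (\<Sum>j<n. Y k j * \<xi> j) * (\<Sum>j<n. Y k j * \<xi> j))" for \<xi>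
      using gram_form[where Y=Y and n=n and m=n and \<xi>=\<xi>] by (simp add: Y)
    moreover have "pos (?form X \<xi>)" for \<xi>
      unfolding form by (intro pos_sum pos_adj_mult)
    moreover
    have "\<forall>k. \<exists>C\<ge>0. \<forall>\<xi>. pos (C *\<^sub>R (\<Sum>j<n. adj (\<xi> j) * \<xi> j)
      - adj (\<Sum>j<n. Y k j * \<xi> j) * (\<Sum>j<n. Y k j * \<xi> j))"
      by (intro allI pos_sum_bound)
    from choice[OF this] obtain C where C: "\<And>k. C k \<ge> 0" "\<And>k \<xi>. pos (C k *\<^sub>R (\<Sum>j<n. adj (\<xi> j) * \<xi> j)
      - adj (\<Sum>j<n. Y k j * \<xi> j) * (\<Sum>j<n. Y k j * \<xi> j))"
      by blast
    have "pos ((\<Sum>k<n. C k) *\<^sub>R (\<Sum>i<n. adj (\<xi> i) * \<xi> i) - ?form X \<xi>)" for \<xi>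
      unfolding form scaleR_left.sum sum_subtractf[symmetric] by (intro pos_sum C)
    moreover have "(\<Sum>k<n. C k) \<ge> 0"
      by (intro sum_nonneg C)
    ultimately show ?thesis by blast
  qed
  obtain C C' where C: "C \<ge> 0" "\<And>\<xi>. pos (C *\<^sub>R (\<Sum>i<n. adj (\<xi> i) * \<xi> i) - ?form X \<xi>)"
    "C' \<ge> 0" "\<And>\<xi>. pos (C' *\<^sub>R (\<Sum>i<n. adj (\<xi> i) * \<xi> i) - ?form X' \<xi>)"
    using facts[OF assms(1)] facts[OF assms(2)] by blast
  have form: "?form (\<lambda>i j. X i j + X' i j) \<xi> = ?form X \<xi> + ?form X' \<xi>" for \<xi>
    by (simp add: algebra_simps sum.distrib)
  show ?thesis
  \<comment> \<open>The summand 1 makes s strictly positive even if both bounds are 0.\<close>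
  proof (rule positive_matrix_of_form[where s = "C + C' + 1"])
    fix \<xi> :: "nat \<Rightarrow> 'a"
    show "pos (?form (\<lambda>i j. X i j + X' i j) \<xi>)"
      unfolding form using facts[OF assms(1)] facts[OF assms(2)] by (intro pos_add) auto
    have "pos ((C *\<^sub>R (\<Sum>i<n. adj (\<xi> i) * \<xi> i) - ?form X \<xi>) + (C' *\<^sub>R (\<Sum>i<n. adj (\<xi> i) * \<xi> i) - ?form X' \<xi>)
      + (\<Sum>i<n. adj (\<xi> i) * \<xi> i))"
      by (intro pos_add C pos_sum pos_adj_mult)
    then show "pos ((C + C' + 1) *\<^sub>R (\<Sum>i<n. adj (\<xi> i) * \<xi> i) - ?form (\<lambda>i j. X i j + X' i j) \<xi>)"
      unfolding form by (simp add: scaleR_add_left algebra_simps)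
  next
    fix i j assume "i < n" "j < n"
    then show "adj (X i j + X' i j) = X j i + X' j i"
      using facts[OF assms(1)] facts[OF assms(2)] by (simp add: adj_add)
  qed (use C(1,3) in simp)
qed

section \<open>Completely positive maps\<close>

lemma completely_positive_zero:
  "completely_positive (\<lambda>x::'c::cstar_algebra. 0::'b::cstar_algebra)"
proof -
  have "c *\<^sub>C (0::'b) = 0" for c
    using bounded_linear_scaleC[of c, where 'a='b] by (rule linear_simps)
  then show ?thesis
    by (auto simp: completely_positive_def clinear_def positive_matrix_def intro!: exI[of _ "\<lambda>_ _. 0"])
qed

lemma completely_positive_add:
  fixes \<phi> \<psi> :: "'c::cstar_algebra \<Rightarrow> 'b::unital_cstar_algebra"
  assumes "completely_positive \<phi>" "completely_positive \<psi>"
  shows "completely_positive (\<lambda>x. \<phi> x + \<psi> x)"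
  using assms
  by (auto simp: completely_positive_def clinear_def scaleC_add_right intro!: positive_matrix_add)

lemma completely_positive_sum:
  fixes \<phi> :: "'i \<Rightarrow> 'c::cstar_algebra \<Rightarrow> 'b::unital_cstar_algebra"
  assumes "\<And>i. i \<in> I \<Longrightarrow> completely_positive (\<phi> i)"
  shows "completely_positive (\<lambda>x. \<Sum>i\<in>I. \<phi> i x)"
  using assms
  by (induction I rule: infinite_finite_induct)
    (auto intro: completely_positive_zero completely_positive_add)

lemma scaleC_scaleR: "c *\<^sub>C r *\<^sub>R x = r *\<^sub>R c *\<^sub>C (x::'a::cstar_algebra)"
  by (simp add: scaleR_scaleC scaleC_scaleC mult.commute)

lemma completely_positive_scaleR:
  fixes \<phi> :: "'c::cstar_algebra \<Rightarrow> 'b::cstar_algebra"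
  assumes "completely_positive \<phi>" "r \<ge> 0"
  shows "completely_positive (\<lambda>x. r *\<^sub>R \<phi> x)"
proof -
  have "positive_matrix n (\<lambda>i j. r *\<^sub>R X i j)" if pm: "positive_matrix n X" for n and X :: "nat \<Rightarrow> nat \<Rightarrow> 'b"
  proof -
    obtain Y where Y: "\<And>i j. i < n \<Longrightarrow> j < n \<Longrightarrow> X i j = (\<Sum>k<n. adj (Y k i) * Y k j)"
      by (rule positive_matrixE[OF pm]) (rule that)
    have "r *\<^sub>R X i j = (\<Sum>k<n. adj (sqrt r *\<^sub>R Y k i) * (sqrt r *\<^sub>R Y k j))" if "i < n" "j < n" for i j
      using that assms(2) by (simp add: Y adj_scaleR scaleR_sum_right)
    then show ?thesis
      unfolding positive_matrix_def by (intro exI[of _ "\<lambda>k i. sqrt r *\<^sub>R Y k i"]) blast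
  qed
  with assms show ?thesis
    by (simp add: completely_positive_def clinear_def scaleR_add_right scaleC_scaleR)
qed

lemma clinear_imp_linear: "clinear \<phi> \<Longrightarrow> linear \<phi>"
  by (auto simp: clinear_def scaleR_scaleC intro!: linearI)

text \<open>If X = Y* Y, then b* pi(X) b factors through the matrix with entries pi(Y k i) b, which
  has the same size. With pi the evaluation at a point of G, this provides the summands of
  \<open>partition_map\<close>.\<close>

lemma completely_positive_compression:
  fixes b :: "'b::cstar_algebra" and \<pi> :: "'c::cstar_algebra \<Rightarrow> 'b"
  assumes "clinear \<pi>" "\<And>x y. \<pi> (x * y) = \<pi> x * \<pi> y" "\<And>x. \<pi> (adj x) = adj (\<pi> x)"
  shows "completely_positive (\<lambda>x. adj b * \<pi> x * b)"
proof -
  note \<pi>_sum = linear_sum[OF clinear_imp_linear[OF assms(1)]]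
  have "positive_matrix n (\<lambda>i j. adj b * \<pi> (X i j) * b)" if pm: "positive_matrix n X" for n X
  proof -
    obtain Y where Y: "\<And>i j. i < n \<Longrightarrow> j < n \<Longrightarrow> X i j = (\<Sum>k<n. adj (Y k i) * Y k j)"
      by (rule positive_matrixE[OF pm]) (rule that)
    have "adj b * \<pi> (X i j) * b = (\<Sum>k<n. adj (\<pi> (Y k i) * b) * (\<pi> (Y k j) * b))" if "i < n" "j < n" for i j
      using that
      by (simp add: Y \<pi>_sum assms adj_mult sum_distrib_left sum_distrib_right mult.assoc)
    then show ?thesis
      unfolding positive_matrix_def by (intro exI[of _ "\<lambda>k i. \<pi> (Y k i) * b"]) blast
  qed
  with assms(1) show ?thesis
    by (simp add: completely_positive_def clinear_def algebra_simps mult_scaleC_left mult_scaleC_right)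
qed

lemma completely_positive_hom:
  fixes \<pi> :: "'c::cstar_algebra \<Rightarrow> 'b::unital_cstar_algebra"
  assumes "clinear \<pi>" "\<And>x y. \<pi> (x * y) = \<pi> x * \<pi> y" "\<And>x. \<pi> (adj x) = adj (\<pi> x)"
  shows "completely_positive \<pi>"
  using completely_positive_compression[of \<pi> 1] assms by simp

lemma completely_positive_compose:
  assumes "completely_positive \<phi>" "completely_positive \<psi>"
  shows "completely_positive (\<lambda>x. \<phi> (\<psi> x))"
  using assms by (auto simp: completely_positive_def clinear_def)

lemma completely_positive_pos:
  fixes \<phi> :: "'c::unital_cstar_algebra \<Rightarrow> 'b::unital_cstar_algebra"
  assumes "completely_positive \<phi>" "pos h"
  shows "pos (\<phi> h)"
proof -
  obtain q where "pos q" "q * q = h"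
    by (rule pos_root[OF assms(2)]) (rule that)
  then have "positive_matrix 1 (\<lambda>_ _. h)"
    unfolding positive_matrix_def by (intro exI[of _ "\<lambda>_ _. q"]) (simp add: pos_adj)
  then have "positive_matrix 1 (\<lambda>_ _. \<phi> h)"
    using assms(1) unfolding completely_positive_def by blast
  then show ?thesis
    by (auto simp: positive_matrix_def pos_adj_mult)
qed

lemma scaleC_minus_right: "c *\<^sub>C (- x) = - (c *\<^sub>C (x::'a::cstar_algebra))"
  using bounded_linear_scaleC[of c, where 'a='a] by (rule linear_simps)

lemma cartesian:
  fixes x :: "'a::cstar_algebra"
  obtains a b where "adj a = a" "adj b = b" "x = a + \<i> *\<^sub>C b" "norm a \<le> norm x" "norm b \<le> norm x"
proof
  let ?a = "(1/2) *\<^sub>R (x + adj x)" and ?b = "(1/2) *\<^sub>R (- \<i>) *\<^sub>C (x - adj x)"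
  show "adj ?a = ?a"
    by (simp only: adj_scaleR adj_add adj_adj add.commute)
  have "adj (- \<i> *\<^sub>C (x - adj x)) = - \<i> *\<^sub>C (x - adj x)"
    by (simp add: adj_scaleC adj_diff adj_adj scaleC_minus_left scaleC_diff_right)
  then show "adj ?b = ?b"
    by (simp only: adj_scaleR)
  show "x = ?a + \<i> *\<^sub>C ?b"
  proof -
    have "\<i> *\<^sub>C ?b = (1/2) *\<^sub>R (x - adj x)"
      by (simp only: scaleC_scaleR scaleC_minus_left scaleC_minus_right scaleC_ii_ii minus_minus)
    then have "?a + \<i> *\<^sub>C ?b = (1/2) *\<^sub>R (2 *\<^sub>R x)"
      by (simp only: scaleR_add_right[symmetric]) (simp add: scaleR_2)
    then show ?thesis by simp
  qed
  show "norm ?a \<le> norm x" "norm ?b \<le> norm x"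
    using norm_triangle_ineq[of x "adj x"] norm_triangle_ineq4[of x "adj x"]
    by (simp_all add: norm_scaleC norm_adj)
qed

section \<open>Unital completely positive maps and their norm estimates\<close>

definition ucp :: "('c::unital_cstar_algebra \<Rightarrow> 'b::unital_cstar_algebra) \<Rightarrow> bool"
  where "ucp \<phi> \<longleftrightarrow> completely_positive \<phi> \<and> \<phi> 1 = 1"

lemma ucp_completely_positive: "ucp \<phi> \<Longrightarrow> completely_positive \<phi>"
  by (simp add: ucp_def)

lemma ucp_one: "ucp \<phi> \<Longrightarrow> \<phi> 1 = 1"
  by (simp add: ucp_def)

lemma ucp_clinear: "ucp \<phi> \<Longrightarrow> clinear \<phi>"
  by (simp add: ucp_def completely_positive_def)

lemma ucp_scaleC: "ucp \<phi> \<Longrightarrow> \<phi> (c *\<^sub>C x) = c *\<^sub>C \<phi> x"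
  using ucp_clinear[of \<phi>] by (simp add: clinear_def)

lemmas ucp_linear = clinear_imp_linear[OF ucp_clinear]
lemmas ucp_add = linear_add[OF ucp_linear]
lemmas ucp_diff = linear_diff[OF ucp_linear]
lemmas ucp_scaleR = linear_scale[OF ucp_linear]
lemmas ucp_sum = linear_sum[OF ucp_linear]

lemma ucp_pos: "ucp \<phi> \<Longrightarrow> pos h \<Longrightarrow> pos (\<phi> h)"
  by (rule completely_positive_pos[OF ucp_completely_positive])

text \<open>Complete positivity as defined does not mention adjoints of values. They are reached
  through the positive element \<open>norm x *\<^sub>R 1 - x\<close>, whose image is
  self-adjoint.\<close>

lemma ucp_self_adjoint:
  assumes "ucp \<phi>" "adj x = x" shows "adj (\<phi> x) = \<phi> x"
proof -
  have "pos (\<phi> (norm x *\<^sub>R 1 - x))"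
    by (rule ucp_pos[OF assms(1) pos_scaleR_one_minus[OF assms(2) order_refl]])
  moreover have "\<phi> (norm x *\<^sub>R 1 - x) = norm x *\<^sub>R 1 - \<phi> x"
    by (simp add: ucp_diff ucp_scaleR ucp_one assms(1))
  ultimately have "adj (norm x *\<^sub>R 1 - \<phi> x) = norm x *\<^sub>R 1 - \<phi> x"
    using pos_adj by simp
  then show ?thesis
    by (simp add: adj_diff adj_scaleR)
qed

lemma ucp_norm_self_adjoint:
  assumes "ucp \<phi>" "adj x = x" shows "norm (\<phi> x) \<le> norm x"
proof (rule norm_le_of_pos_both)
  have *: "pos (\<phi> (norm x *\<^sub>R 1 - y))" if "adj y = y" "norm y = norm x" for y
    using that by (intro ucp_pos[OF assms(1) pos_scaleR_one_minus]) auto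
  show "pos (norm x *\<^sub>R 1 - \<phi> x)"
    using *[OF assms(2)] by (simp add: ucp_diff ucp_scaleR ucp_one assms(1))
  show "pos (norm x *\<^sub>R 1 + \<phi> x)"
    using *[of "- x"] assms(2) by (simp add: adj_minus ucp_add ucp_scaleR ucp_one assms(1))
qed simp

lemma ucp_adj:
  assumes "ucp \<phi>" shows "\<phi> (adj x) = adj (\<phi> x)"
proof -
  obtain a b where ab: "adj a = a" "adj b = b" "x = a + \<i> *\<^sub>C b"
    by (rule cartesian[of x])
  have "\<phi> x = \<phi> a + \<i> *\<^sub>C \<phi> b" "\<phi> (adj x) = \<phi> a + cnj \<i> *\<^sub>C \<phi> b"
    unfolding ab(3) adj_add adj_scaleC ab(1,2) ucp_add[OF assms] ucp_scaleC[OF assms] by (rule refl)+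
  then show ?thesis
    by (simp only: adj_add adj_scaleC ucp_self_adjoint[OF assms ab(1)] ucp_self_adjoint[OF assms ab(2)])
qed

text \<open>The factor 2 comes from estimating the real and imaginary parts separately. What counts
  later is that the bound is the same for all ucp maps, hence uniform in t and g.\<close>

lemma ucp_norm_le:
  assumes "ucp \<phi>" shows "norm (\<phi> x) \<le> 2 * norm x"
proof -
  obtain a b where ab: "adj a = a" "adj b = b" "x = a + \<i> *\<^sub>C b" "norm a \<le> norm x" "norm b \<le> norm x"
    by (rule cartesian[of x])
  have "norm (\<phi> x) \<le> norm (\<phi> a) + norm (\<i> *\<^sub>C \<phi> b)"
    unfolding ab(3) ucp_add[OF assms] ucp_scaleC[OF assms] by (rule norm_triangle_ineq)
  also have "\<dots> \<le> norm x + norm x"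
    using ucp_norm_self_adjoint[OF assms ab(1)] ucp_norm_self_adjoint[OF assms ab(2)] ab(4,5)
    by (simp add: norm_scaleC)
  finally show ?thesis by simp
qed

section \<open>Uniformly vanishing families\<close>

text \<open>The index type carries the uniformity: \<open>unit\<close> gives an ordinary limit, the
  group gives a limit uniform in g. Both kinds of error can then be added and multiplied by the same
  rules.\<close>

definition vanishing :: "(real \<Rightarrow> 'i \<Rightarrow> 'b::real_normed_vector) \<Rightarrow> bool"
  where "vanishing D \<longleftrightarrow> (\<forall>e>0. \<forall>\<^sub>F t in at_top. \<forall>i. norm (D t i) \<le> e)"

lemma vanishingD: "vanishing D \<Longrightarrow> e > 0 \<Longrightarrow> \<forall>\<^sub>F t in at_top. \<forall>i. norm (D t i) \<le> e"
  by (simp add: vanishing_def)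

lemma vanishing_unit_iff:
  "vanishing (\<lambda>t (_::unit). d t) \<longleftrightarrow> ((\<lambda>t. norm (d t)) \<longlongrightarrow> 0) at_top"
proof
  assume *: "vanishing (\<lambda>t (_::unit). d t)"
  show "((\<lambda>t. norm (d t)) \<longlongrightarrow> 0) at_top"
  proof (rule tendstoI)
    fix e :: real assume "e > 0"
    from vanishingD[OF *, of "e/2"] this
    show "\<forall>\<^sub>F t in at_top. dist (norm (d t)) 0 < e"
      by (auto elim!: eventually_mono)
  qed
next
  assume *: "((\<lambda>t. norm (d t)) \<longlongrightarrow> 0) at_top"
  show "vanishing (\<lambda>t (_::unit). d t)"
    unfolding vanishing_def
  proof (intro allI impI)
    fix e :: real assume "e > 0"
    with * have "\<forall>\<^sub>F t in at_top. norm (d t) < e" by (rule order_tendstoD)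
    then show "\<forall>\<^sub>F t in at_top. \<forall>_::unit. norm (d t) \<le> e" by (auto elim!: eventually_mono)
  qed
qed

lemma vanishing_SUP_iff:
  "vanishing D \<longleftrightarrow> ((\<lambda>t. SUP g. ereal (norm (D t g))) \<longlongrightarrow> 0) at_top"
proof
  assume *: "((\<lambda>t. SUP g. ereal (norm (D t g))) \<longlongrightarrow> 0) at_top"
  show "vanishing D"
    unfolding vanishing_def
  proof (intro allI impI)
    fix e :: real assume "e > 0"
    then have "\<forall>\<^sub>F t in at_top. (SUP g. ereal (norm (D t g))) < ereal e"
      using order_tendstoD(2)[OF *, of "ereal e"] by simp
    then show "\<forall>\<^sub>F t in at_top. \<forall>g. norm (D t g) \<le> e"
    proof (rule eventually_mono, intro allI)
      fix t g assume "(SUP g. ereal (norm (D t g))) < ereal e"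
      moreover have "ereal (norm (D t g)) \<le> (SUP g. ereal (norm (D t g)))"
        by (rule SUP_upper) simp
      ultimately have "ereal (norm (D t g)) < ereal e" by (rule le_less_trans[rotated])
      then show "norm (D t g) \<le> e" by simp
    qed
  qed
next
  assume *: "vanishing D"
  show "((\<lambda>t. SUP g. ereal (norm (D t g))) \<longlongrightarrow> 0) at_top"
  proof (rule order_tendstoI)
    fix a :: ereal assume "a < 0"
    \<comment> \<open>The index type is inhabited; over an empty set the supremum would be minus
      infinity.\<close>
    also have "0 \<le> (SUP g. ereal (norm (D t g)))" for t
      by (rule SUP_upper2[of undefined]) auto
    finally show "\<forall>\<^sub>F t in at_top. a < (SUP g. ereal (norm (D t g)))"
      by simp
  next
    fix a :: ereal assume "0 < a"
    then obtain e where e: "0 < e" "ereal e < a"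
      using ereal_dense2[of 0 a] by auto
    show "\<forall>\<^sub>F t in at_top. (SUP g. ereal (norm (D t g))) < a"
      using vanishingD[OF * e(1)]
    proof (rule eventually_mono)
      fix t assume "\<forall>g. norm (D t g) \<le> e"
      then have "(SUP g. ereal (norm (D t g))) \<le> ereal e"
        by (intro SUP_least) simp
      then show "(SUP g. ereal (norm (D t g))) < a"
        using e(2) by (rule le_less_trans)
    qed
  qed
qed

lemma vanishing_add:
  assumes "vanishing D" "vanishing E"
  shows "vanishing (\<lambda>t i. D t i + E t i)"
  unfolding vanishing_def
proof (intro allI impI)
  fix e :: real assume "e > 0"
  then have "e / 2 > 0" by simp
  from vanishingD[OF assms(1) this] vanishingD[OF assms(2) this]
  show "\<forall>\<^sub>F t in at_top. \<forall>i. norm (D t i + E t i) \<le> e"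
  proof eventually_elim
    case (elim t)
    show ?case
    proof
      fix i
      show "norm (D t i + E t i) \<le> e"
        using norm_triangle_mono[of "D t i" "e/2" "E t i" "e/2"] elim by simp
    qed
  qed
qed

lemma vanishing_bound:
  assumes "vanishing E" "\<forall>\<^sub>F t in at_top. \<forall>i. norm (D t i) \<le> K * norm (E t i)"
  shows "vanishing D"
  unfolding vanishing_def
proof (intro allI impI)
  fix e :: real assume "e > 0"
  then have "e / (\<bar>K\<bar> + 1) > 0" by simp
  from vanishingD[OF assms(1) this] assms(2)
  show "\<forall>\<^sub>F t in at_top. \<forall>i. norm (D t i) \<le> e"
  proof eventually_elim
    case (elim t)
    show ?case
    proof
      fix i
      have "norm (D t i) \<le> K * norm (E t i)" using elim by simp
      also have "\<dots> \<le> (\<bar>K\<bar> + 1) * (e / (\<bar>K\<bar> + 1))"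
        using elim by (intro mult_mono) auto
      finally show "norm (D t i) \<le> e" by simp
    qed
  qed
qed

lemma vanishing_approx:
  assumes "\<And>e. e > 0 \<Longrightarrow> \<exists>E. vanishing E \<and> (\<forall>\<^sub>F t in at_top. \<forall>i. norm (D t i - E t i) \<le> e)"
  shows "vanishing D"
  unfolding vanishing_def
proof (intro allI impI)
  fix e :: real assume "e > 0"
  then have e2: "e / 2 > 0" by simp
  obtain E where E: "vanishing E" "\<forall>\<^sub>F t in at_top. \<forall>i. norm (D t i - E t i) \<le> e/2"
    using assms[OF e2] by blast
  from vanishingD[OF E(1) e2] E(2)
  show "\<forall>\<^sub>F t in at_top. \<forall>i. norm (D t i) \<le> e"
  proof eventually_elim
    case (elim t)
    show ?case
    proof
      fix i
      show "norm (D t i) \<le> e"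
        using norm_triangle_mono[of "D t i - E t i" "e/2" "E t i" "e/2"] elim by simp
    qed
  qed
qed

section \<open>Elementary tensors and translations\<close>

lemma norm_elem_tensor_le: "norm (f \<otimes>\<^sub>C a) \<le> norm f * norm a"
  by (rule norm_bound) (simp add: norm_scaleC mult_right_mono norm_bounded)

lemma elem_tensor_zero [simp]: "0 \<otimes>\<^sub>C a = (0 :: 'g::topological_space \<Rightarrow>\<^sub>C 'a::cstar_algebra)"
proof (rule bcontfun_eqI)
  fix h :: 'g
  show "(0 \<otimes>\<^sub>C a) h = (0 :: 'g \<Rightarrow>\<^sub>C 'a) h"
    using scaleR_scaleC[of 0 a] by simp
qed

lemma elem_tensor_induct [case_names compact tensor add approx]:
  fixes x :: "'g::topological_space \<Rightarrow>\<^sub>C 'a::cstar_algebra"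
  assumes "compact (UNIV :: 'g set)"
    and tensor: "\<And>f a. Q (f \<otimes>\<^sub>C a)"
    and add: "\<And>x y. Q x \<Longrightarrow> Q y \<Longrightarrow> Q (x + y)"
    and approx: "\<And>x. (\<And>e. e > 0 \<Longrightarrow> \<exists>y. Q y \<and> norm (x - y) \<le> e) \<Longrightarrow> Q x"
  shows "Q x"
proof (rule approx)
  fix e :: real assume "e > 0"
  obtain P f where P: "finite P" "norm (x - (\<Sum>p\<in>P. f p \<otimes>\<^sub>C x p)) \<le> e"
    by (rule elem_tensor_dense[OF assms(1) \<open>e > 0\<close>])
  have "Q 0"
    using tensor[of 0 0] by simp
  then have "Q (\<Sum>p\<in>P. f p \<otimes>\<^sub>C x p)"
    by (induction P rule: infinite_finite_induct) (auto intro: tensor add)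
  with P show "\<exists>y. Q y \<and> norm (x - y) \<le> e" by blast
qed

text \<open>Reduces asymptotic statements on C(G, A) to elementary tensors. The bound K is uniform
  in t and i, so an approximation of x by sums of elementary tensors costs the same error at all
  times and indices.\<close>

lemma vanishing_elem_tensor:
  fixes D :: "real \<Rightarrow> 'i \<Rightarrow> ('g::topological_space \<Rightarrow>\<^sub>C 'a::cstar_algebra) \<Rightarrow> 'b::real_normed_vector"
  assumes "compact (UNIV :: 'g set)"
    and add: "\<And>t i x y. t \<ge> 0 \<Longrightarrow> D t i (x + y) = D t i x + D t i y"
    and bound: "\<And>t i x. t \<ge> 0 \<Longrightarrow> norm (D t i x) \<le> K * norm x"
    and tensor: "\<And>f a. vanishing (\<lambda>t i. D t i (f \<otimes>\<^sub>C a))"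
  shows "vanishing (\<lambda>t i. D t i x)"
proof (induction x rule: elem_tensor_induct)
  case compact
  show ?case by (rule assms(1))
next
  case (tensor f a)
  then show ?case by (rule assms)
next
  case (add x y)
  show ?case
  proof (rule vanishing_bound[OF vanishing_add[OF add], where K = 1])
    show "\<forall>\<^sub>F t in at_top. \<forall>i. norm (D t i (x + y)) \<le> 1 * norm (D t i x + D t i y)"
      using eventually_ge_at_top[of 0] by eventually_elim (simp add: assms(2))
  qed
next
  case (approx x)
  show ?case
  proof (rule vanishing_approx)
    fix e :: real assume "e > 0"
    then have "e / (\<bar>K\<bar> + 1) > 0" by simp
    from approx[OF this] obtain y where y: "vanishing (\<lambda>t i. D t i y)" "norm (x - y) \<le> e / (\<bar>K\<bar> + 1)"
      by blast
    have "norm (D t i x - D t i y) \<le> e" if "t \<ge> 0" for t i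
    proof -
      have "D t i x - D t i y = D t i (x - y)"
        using assms(2)[OF that, of i "x - y" y] by simp
      also have "norm \<dots> \<le> K * norm (x - y)" by (rule bound[OF that])
      also have "\<dots> \<le> (\<bar>K\<bar> + 1) * (e / (\<bar>K\<bar> + 1))"
        using y(2) by (intro mult_mono) auto
      finally show ?thesis by simp
    qed
    then have "\<forall>\<^sub>F t in at_top. \<forall>i. norm (D t i x - D t i y) \<le> e"
      by (intro eventually_mono[OF eventually_ge_at_top[of "0::real"]] allI)
    with y(1) show "\<exists>E. vanishing E \<and> (\<forall>\<^sub>F t in at_top. \<forall>i. norm (D t i x - E t i) \<le> e)"
      by blast
  qed
qed

text \<open>Supplies linearity and a norm bound for each \<alpha>_g from the general theory of ucp
  maps. The unit is preserved by surjectivity.\<close>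

lemma ucp_star_automorphism:
  fixes \<phi> :: "'a::unital_cstar_algebra \<Rightarrow> 'a"
  assumes "star_automorphism \<phi>"
  shows "ucp \<phi>"
  unfolding ucp_def
proof
  show "completely_positive \<phi>"
    using assms by (intro completely_positive_hom) (auto simp: star_automorphism_def)
  obtain u where "\<phi> u = 1"
    using assms by (metis star_automorphism_def bij_pointE)
  then show "\<phi> 1 = 1"
    using assms by (metis star_automorphism_def mult_1 mult_1_right)
qed

lemma ucp_continuous_action: "continuous_action \<alpha> \<Longrightarrow> ucp (\<alpha> g)"
  for \<alpha> :: "'g::topological_group_add \<Rightarrow> 'a::unital_cstar_algebra \<Rightarrow> 'a"
  by (simp add: continuous_action_def ucp_star_automorphism)

lemma norm_Lt_le: "norm (Lt g f) \<le> norm f"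
  by (rule norm_bound) (simp add: norm_bounded)

lemma apply_Lt_tensor:
  fixes \<alpha> :: "'g::topological_group_add \<Rightarrow> 'a::unital_cstar_algebra \<Rightarrow> 'a"
  assumes action: "continuous_action \<alpha>"
  shows "Lt_tensor \<alpha> g x h = \<alpha> g (x (- g + h))"
proof -
  note \<alpha> = ucp_continuous_action[OF action]
  have "bounded_linear (\<alpha> g)"
    using ucp_norm_le[OF \<alpha>]
    by (intro bounded_linear_intro[where K = 2]) (auto simp: ucp_add[OF \<alpha>] ucp_scaleR[OF \<alpha>] mult.commute)
  have "continuous_on UNIV (\<lambda>h. x (- g + h))"
    by (rule continuous_on_compose2[OF continuous_on_apply_bcontfun]) (auto intro!: continuous_intros)
  then have "continuous_on UNIV (\<lambda>h. \<alpha> g (x (- g + h)))"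
    by (rule bounded_linear.continuous_on[OF \<open>bounded_linear (\<alpha> g)\<close>])
  moreover have "norm (\<alpha> g (x h)) \<le> 2 * norm x" for h
    using ucp_norm_le[OF \<alpha>, of g "x h"] norm_bounded[of x h] by simp
  ultimately have "(\<lambda>h. \<alpha> g (x (- g + h))) \<in> bcontfun"
    by (rule bcontfun_normI)
  then show ?thesis
    by (simp add: Lt_tensor_def Bcontfun_inverse)
qed

lemma Lt_tensor_add:
  fixes \<alpha> :: "'g::topological_group_add \<Rightarrow> 'a::unital_cstar_algebra \<Rightarrow> 'a"
  assumes action: "continuous_action \<alpha>"
  shows "Lt_tensor \<alpha> g (x + y) = Lt_tensor \<alpha> g x + Lt_tensor \<alpha> g y"
  by (rule bcontfun_eqI) (simp add: apply_Lt_tensor[OF action] ucp_add[OF ucp_continuous_action[OF action]])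

lemma norm_Lt_tensor_le:
  fixes \<alpha> :: "'g::topological_group_add \<Rightarrow> 'a::unital_cstar_algebra \<Rightarrow> 'a"
  assumes action: "continuous_action \<alpha>"
  shows "norm (Lt_tensor \<alpha> g x) \<le> 2 * norm x"
proof (rule norm_bound)
  fix h
  show "norm (Lt_tensor \<alpha> g x h) \<le> 2 * norm x"
    using ucp_norm_le[OF ucp_continuous_action[OF action], of g "x (- g + h)"] norm_bounded[of x "- g + h"]
    by (simp add: apply_Lt_tensor[OF action])
qed


text \<open>\<open>f (- g + h)\<close> is jointly continuous in g and h; compactness in h makes its
  continuity in g uniform over h.\<close>

lemma Lt_near:
  fixes f :: "'g::topological_group_add \<Rightarrow>\<^sub>C complex"
  assumes "compact (UNIV :: 'g set)" "d > 0"
  obtains N where "open N" "g0 \<in> N" "\<And>g. g \<in> N \<Longrightarrow> norm (Lt g f - Lt g0 f) \<le> d"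
proof -
  define F where "F = (\<lambda>(g, h). f (- g + h))"
  have "continuous_on (UNIV \<times> UNIV) F"
    unfolding F_def case_prod_beta
    by (rule continuous_on_compose2[OF continuous_on_apply_bcontfun]) (auto intro!: continuous_intros)
  then obtain N where N: "g0 \<in> N" "open N" "\<forall>g\<in>N \<inter> UNIV. \<forall>h\<in>UNIV. dist (F (g, h)) (F (g0, h)) \<le> d"
    by (rule continuous_on_prod_compactE[OF _ assms(1) UNIV_I assms(2)])
  show ?thesis
  proof (rule that[OF N(2,1)])
    fix g assume "g \<in> N"
    with N(3) show "norm (Lt g f - Lt g0 f) \<le> d"
      by (intro norm_bound) (auto simp: F_def dist_norm)
  qed
qed

section \<open>Partitions of unity\<close>

text \<open>The sum of squares occurs twice: as an identity in C(G), to which \<Phi> is applied, and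
  pointwise with moduli, as weights of an average.\<close>

definition square_partition :: "'g set \<Rightarrow> ('g \<Rightarrow> ('g::topological_space \<Rightarrow>\<^sub>C complex)) \<Rightarrow> bool"
  where "square_partition P f \<longleftrightarrow> finite P \<and> (\<forall>p\<in>P. adj (f p) = f p \<and> norm (f p) \<le> 1) \<and>
    (\<Sum>p\<in>P. f p * f p) = 1 \<and> (\<forall>h. (\<Sum>p\<in>P. (cmod (f p h))\<^sup>2) = 1)"

text \<open>Urysohn functions equal to 1 at p and 0 off V p; finitely many of them have a positive
  sum by compactness, and one takes roots of the quotients. The functions are labelled by their
  centres p, which later serve as the points where x is evaluated.\<close>

lemma partition_of_unity_squares:
  fixes V :: "'g::t2_space \<Rightarrow> 'g set"
  assumes compact: "compact (UNIV :: 'g set)" and V: "\<And>p. open (V p)" "\<And>p. p \<in> V p"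
  obtains P f where "square_partition P f" "\<And>p h. p \<in> P \<Longrightarrow> apply_bcontfun (f p) h \<noteq> 0 \<Longrightarrow> h \<in> V p"
proof -
  have normal: "normal_space (euclidean :: 'g topology)"
  proof (rule compact_Hausdorff_or_regular_imp_normal_space)
    show "compact_space (euclidean :: 'g topology)"
      using compact by (simp add: compact_space_def compactin_euclidean_iff)
    show "Hausdorff_space (euclidean :: 'g topology) \<or> regular_space (euclidean :: 'g topology)"
      unfolding Hausdorff_space_def by (auto simp: disjnt_def) (metis hausdorff)
  qed
  have "\<exists>u::'g \<Rightarrow> real. continuous_on UNIV u \<and> (\<forall>h. h \<notin> V p \<longrightarrow> u h = 0) \<and> u p = 1" for p
  proof -
    have "closedin euclidean (- V p)" "closedin euclidean {p}" "disjnt (- V p) {p}"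
      using V by (auto simp: disjnt_def)
    then obtain u :: "'g \<Rightarrow> real" where "continuous_map euclidean euclideanreal u"
      "u ` (- V p) \<subseteq> {0}" "u ` {p} \<subseteq> {1}"
      by (rule Urysohn_lemma_alt[OF normal])
    then show ?thesis
      by (intro exI[of _ u]) auto
  qed
  then obtain u :: "'g \<Rightarrow> 'g \<Rightarrow> real" where u: "\<And>p. continuous_on UNIV (u p)"
    "\<And>p h. h \<notin> V p \<Longrightarrow> u p h = 0" "\<And>p. u p p = 1"
    by metis
  define w where "w p h = max 0 (u p h)" for p h
  have w_cont: "continuous_on UNIV (w p)" for p
    unfolding w_def by (intro continuous_intros u)
  have w_nonneg: "w p h \<ge> 0" for p h
    by (simp add: w_def)
  have "open {h. w p h > 0}" for p
    by (intro open_Collect_less continuous_intros w_cont)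
  moreover have "UNIV \<subseteq> (\<Union>p\<in>UNIV. {h. w p h > 0})"
    using u(3) by (auto simp: w_def less_max_iff_disj intro!: exI)
  ultimately obtain P where P: "finite P" "UNIV \<subseteq> (\<Union>p\<in>P. {h. w p h > 0})"
    by (rule compactE_image[OF compact])
  define s where "s h = (\<Sum>p\<in>P. w p h)" for h
  have s_pos: "s h > 0" for h
  proof -
    obtain p where "p \<in> P" "w p h > 0"
      using P by blast
    then show ?thesis
      unfolding s_def using P(1) w_nonneg by (intro sum_pos2[of P p]) auto
  qed
  define \<gamma> where "\<gamma> p h = sqrt (w p h / s h)" for p h
  have \<gamma>: "(\<gamma> p h)\<^sup>2 = w p h / s h" for p h
    using w_nonneg s_pos[of h] by (simp add: \<gamma>_def)
  have \<gamma>_le: "\<bar>\<gamma> p h\<bar> \<le> 1" if "p \<in> P" for p h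
  proof -
    have "w p h \<le> s h"
      unfolding s_def using that P(1) w_nonneg by (intro member_le_sum) auto
    then show ?thesis
      using s_pos[of h] w_nonneg[of p h] by (simp add: \<gamma>_def)
  qed
  define f where "f p = Bcontfun (\<lambda>h. complex_of_real (\<gamma> p h))" for p
  have f: "f p h = complex_of_real (\<gamma> p h)" if "p \<in> P" for p h
  proof -
    have "continuous_on UNIV s"
      unfolding s_def by (intro continuous_intros w_cont)
    then have "continuous_on UNIV (\<lambda>h. complex_of_real (\<gamma> p h))"
      unfolding \<gamma>_def using s_pos
      by (intro continuous_intros w_cont) (auto simp: less_imp_neq[symmetric])
    then have "(\<lambda>h. complex_of_real (\<gamma> p h)) \<in> bcontfun"
      using \<gamma>_le[OF that] by (intro bcontfun_normI[where b = 1]) auto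
    then show ?thesis
      by (simp add: f_def Bcontfun_inverse)
  qed
  have sum_\<gamma>: "(\<Sum>p\<in>P. (\<gamma> p h)\<^sup>2) = 1" for h
    using s_pos[of h] by (simp add: \<gamma> s_def flip: sum_divide_distrib)
  show ?thesis
  proof (rule that)
    have "adj (f p) = f p" if "p \<in> P" for p
      by (rule bcontfun_eqI) (simp add: f[OF that] adj_complex_def)
    moreover have "norm (f p) \<le> 1" if "p \<in> P" for p
      using \<gamma>_le[OF that] by (intro norm_bound) (simp add: f[OF that])
    moreover have "(\<Sum>p\<in>P. f p * f p) = 1"
    proof (rule bcontfun_eqI)
      fix h
      have "(\<Sum>p\<in>P. f p * f p) h = complex_of_real (\<Sum>p\<in>P. (\<gamma> p h)\<^sup>2)"
        by (simp add: apply_sum_bcontfun f power2_eq_square)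
      then show "(\<Sum>p\<in>P. f p * f p) h = (1 :: 'g \<Rightarrow>\<^sub>C complex) h"
        by (simp only: sum_\<gamma>) simp
    qed
    moreover have "(\<Sum>p\<in>P. (cmod (f p h))\<^sup>2) = 1" for h
      using sum_\<gamma>[of h] by (simp add: f)
    ultimately show "square_partition P f"
      using P(1) by (simp add: square_partition_def)
    show "h \<in> V p" if "p \<in> P" "f p h \<noteq> 0" for p h
      using that u(2)[of h p] by (cases "h \<in> V p") (auto simp: f \<gamma>_def w_def)
  qed
qed

definition partition_family :: "(nat \<Rightarrow> 'g set) \<Rightarrow> (nat \<Rightarrow> 'g \<Rightarrow> ('g::topological_space \<Rightarrow>\<^sub>C complex)) \<Rightarrow> bool"
  where "partition_family P f \<longleftrightarrow> (\<forall>n. square_partition (P n) (f n)) \<and>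
    (\<forall>x::'g \<Rightarrow>\<^sub>C complex. \<forall>e>0. \<forall>\<^sub>F n in sequentially.
      \<forall>p\<in>P n. \<forall>h. f n p h \<noteq> 0 \<longrightarrow> norm (x h - x p) \<le> e)"

text \<open>The \<open>n\<close>-th partition of unity is subordinate to the intersections of those among the first
  \<open>n\<close> basis sets that contain a given point. No metric on \<open>G\<close> is needed.\<close>

lemma partition_family_exists:
  assumes compact: "compact (UNIV :: 'g::{t2_space, second_countable_topology} set)"
  obtains P and f :: "nat \<Rightarrow> 'g::{t2_space, second_countable_topology} \<Rightarrow> ('g \<Rightarrow>\<^sub>C complex)" where "partition_family P f"
proof -
  obtain B :: "'g set set" where B: "countable B" "topological_basis B"
    using ex_countable_basis by blast
  obtain W0 where "W0 \<in> B"
    by (rule topological_basisE[OF B(2) open_UNIV UNIV_I])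
  then have "B \<noteq> {}" by blast
  define U where "U = from_nat_into B"
  have U: "open (U k)" for k
    using from_nat_into[OF \<open>B \<noteq> {}\<close>] topological_basis_open[OF B(2)] by (simp add: U_def)
  define V where "V n p = (\<Inter>k\<in>{k. k < n \<and> p \<in> U k}. U k)" for n p
  have V: "open (V n p)" "p \<in> V n p" for n p
    using U by (auto simp: V_def)
  have "\<forall>n. \<exists>P f. square_partition P f \<and> (\<forall>p\<in>P. \<forall>h. apply_bcontfun (f p) h \<noteq> 0 \<longrightarrow> h \<in> V n p)"
  proof
    fix n
    show "\<exists>P f. square_partition P f \<and> (\<forall>p\<in>P. \<forall>h. apply_bcontfun (f p) h \<noteq> 0 \<longrightarrow> h \<in> V n p)"
      by (rule partition_of_unity_squares[OF compact V[where n=n]]) blast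
  qed
  from choice[OF this] obtain P
    where "\<forall>n. \<exists>f. square_partition (P n) f \<and> (\<forall>p\<in>P n. \<forall>h. apply_bcontfun (f p) h \<noteq> 0 \<longrightarrow> h \<in> V n p)"
    by blast
  from choice[OF this] obtain f
    where f: "\<forall>n. square_partition (P n) (f n) \<and> (\<forall>p\<in>P n. \<forall>h. apply_bcontfun (f n p) h \<noteq> 0 \<longrightarrow> h \<in> V n p)"
    by blast
  have "\<forall>\<^sub>F n in sequentially. \<forall>p\<in>P n. \<forall>h. f n p h \<noteq> 0 \<longrightarrow> norm (x h - x p) \<le> e"
    if "e > 0" for e and x :: "'g \<Rightarrow>\<^sub>C complex"
  proof -
    define O' where "O' q = {h. norm (x h - x q) < e / 2}" for q
    have "open (O' q)" for q
      unfolding O'_def by (intro open_Collect_less continuous_intros) auto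
    then have "\<forall>q. \<exists>k. q \<in> U k \<and> U k \<subseteq> O' q"
    proof (intro allI)
      fix q
      have "q \<in> O' q" using that by (simp add: O'_def)
      with \<open>\<And>q. open (O' q)\<close>[of q] obtain W where "W \<in> B" "q \<in> W" "W \<subseteq> O' q"
        by (rule topological_basisE[OF B(2)])
      moreover obtain k where "from_nat_into B k = W"
        using from_nat_into_surj[OF B(1) \<open>W \<in> B\<close>] by blast
      ultimately show "\<exists>k. q \<in> U k \<and> U k \<subseteq> O' q"
        unfolding U_def by blast
    qed
    from choice[OF this] obtain k where k: "\<And>q. q \<in> U (k q)" "\<And>q. U (k q) \<subseteq> O' q" by blast
    obtain Q where Q: "finite Q" "UNIV \<subseteq> (\<Union>q\<in>Q. U (k q))"
    proof (rule compactE_image[OF compact, of UNIV "\<lambda>q. U (k q)"])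
      show "UNIV \<subseteq> (\<Union>q\<in>UNIV. U (k q))" using k(1) by blast
    qed (auto intro: U)
    \<comment> \<open>From n0 on, each U (k q) with q in Q takes part in the intersection V n p
      whenever it contains p. The support of f n p then lies in that U (k q), on which x varies by
      less than e / 2 about x q.\<close>
    obtain n0 where n0: "\<And>q. q \<in> Q \<Longrightarrow> k q < n0"
      using finite_nat_set_iff_bounded[of "k ` Q"] Q(1) by auto
    show ?thesis
      using eventually_ge_at_top[of n0]
    proof eventually_elim
      case (elim n)
      show ?case
      proof (intro ballI allI impI)
        fix p h assume "p \<in> P n" "f n p h \<noteq> 0"
        then have h: "h \<in> V n p" using f by blast
        obtain q where q: "q \<in> Q" "p \<in> U (k q)" using Q by blast
        then have "h \<in> U (k q)"
          using h n0[OF q(1)] elim by (auto simp: V_def)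
        then have "norm (x h - x q) < e / 2" "norm (x p - x q) < e / 2"
          using k(2)[of q] q(2) by (auto simp: O'_def)
        then show "norm (x h - x p) \<le> e"
          using norm_triangle_ineq4[of "x h - x q" "x p - x q"] by simp
      qed
    qed
  qed
  then have "partition_family P f"
    unfolding partition_family_def using f by simp
  then show ?thesis by (rule that)
qed

section \<open>The map associated with a partition of unity\<close>

context
  fixes \<Phi> :: "('g::{topological_space, zero} \<Rightarrow>\<^sub>C complex) \<Rightarrow> 'a::unital_cstar_algebra"
    and P :: "'g set" and f :: "'g \<Rightarrow> ('g \<Rightarrow>\<^sub>C complex)"
begin

definition gram_sum :: 'a
  where "gram_sum = (\<Sum>p\<in>P. \<Phi> (f p) * \<Phi> (f p))"

text \<open>1 plus this number bounds the norm of the Gram sum, so the rescaled sum lies in the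
  closed unit ball, where \<open>sqrt1m\<close> is available.\<close>

definition gram_defect :: real
  where "gram_defect = norm (gram_sum - 1)"

text \<open>The square root of the defect \<open>1 - S / (1 + \<parallel>S - 1\<parallel>)\<close>, where \<open>S\<close> is the Gram sum: adding the
  corresponding summand to the rescaled sum over the partition makes the map exactly unital, and
  it does so continuously in \<open>\<Phi>\<close>. Any point of \<open>G\<close> would serve instead of \<open>0\<close>.\<close>

definition defect_root :: 'a
  where "defect_root = sqrt1m ((1 / (1 + gram_defect)) *\<^sub>R gram_sum)"

definition partition_map :: "('g \<Rightarrow>\<^sub>C 'a) \<Rightarrow> 'a"
  where "partition_map x = (1 / (1 + gram_defect)) *\<^sub>R (\<Sum>p\<in>P. \<Phi> (f p) * x p * \<Phi> (f p))
    + defect_root * x 0 * defect_root"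

end

context
  fixes \<Phi> :: "('g::{topological_space, zero} \<Rightarrow>\<^sub>C complex) \<Rightarrow> 'a::unital_cstar_algebra"
    and P :: "'g set" and f :: "'g \<Rightarrow> ('g \<Rightarrow>\<^sub>C complex)"
  assumes \<Phi>: "ucp \<Phi>" and P: "square_partition P f"
begin

private abbreviation "S \<equiv> gram_sum \<Phi> P f"
private abbreviation "\<delta> \<equiv> gram_defect \<Phi> P f"
private abbreviation "r \<equiv> defect_root \<Phi> P f"

lemma defect_nonneg: "\<delta> \<ge> 0"
  by (simp add: gram_defect_def)

lemma adj_f: "p \<in> P \<Longrightarrow> adj (\<Phi> (f p)) = \<Phi> (f p)"
  using P by (simp add: square_partition_def ucp_self_adjoint[OF \<Phi>])

lemma adj_gram_sum: "adj S = S"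
  by (simp add: gram_sum_def adj_sum adj_mult adj_f)

lemma norm_gram_sum: "norm ((1 / (1 + \<delta>)) *\<^sub>R S) \<le> 1"
proof -
  have "norm S \<le> norm (S - 1) + norm (1 :: 'a)"
    using norm_triangle_ineq[of "S - 1" 1] by simp
  also have "\<dots> \<le> 1 + \<delta>"
    using norm_one_le[where 'a='a] by (simp add: gram_defect_def)
  finally show ?thesis
    using defect_nonneg by simp
qed

lemma defect_root_square: "r * r = 1 - (1 / (1 + \<delta>)) *\<^sub>R S"
  unfolding defect_root_def by (rule sqrt1m_square[OF norm_gram_sum])

lemma adj_defect_root: "adj r = r"
  unfolding defect_root_def by (rule adj_sqrt1m[OF norm_gram_sum]) (simp add: adj_scaleR adj_gram_sum)

lemma ucp_partition_map: "ucp (partition_map \<Phi> P f)"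
  unfolding ucp_def
proof
  have eval: "completely_positive (\<lambda>x :: 'g \<Rightarrow>\<^sub>C 'a. adj b * x h * b)" for b h
    by (rule completely_positive_compression) (auto simp: clinear_def)
  have "completely_positive (\<lambda>x :: 'g \<Rightarrow>\<^sub>C 'a. (1 / (1 + \<delta>)) *\<^sub>R (\<Sum>p\<in>P. adj (\<Phi> (f p)) * x p * \<Phi> (f p))
    + adj r * x 0 * r)"
    using defect_nonneg
    by (intro completely_positive_add completely_positive_scaleR completely_positive_sum eval) auto
  then show "completely_positive (partition_map \<Phi> P f)"
    by (simp add: partition_map_def[abs_def] adj_f adj_defect_root)
  show "partition_map \<Phi> P f 1 = 1"
    by (simp add: partition_map_def defect_root_square flip: gram_sum_def)
qed

text \<open>Four comparisons: R with Q removes the rescaling and the defect term, Q with Q1 moves a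
  past \<Phi> (f p), Q1 with Q2 uses multiplicativity, and Q2 with \<Phi> c * a uses the small
  oscillation of c. Here e bounds sums over the whole partition, so finer partitions need later
  times.\<close>

lemma partition_map_tensor_estimate:
  fixes c :: "'g \<Rightarrow>\<^sub>C complex"
  assumes e1: "(\<Sum>p\<in>P. norm (\<Phi> (f p) * \<Phi> (f p) - \<Phi> (f p * f p))) \<le> e"
    and e2: "(\<Sum>p\<in>P. norm (\<Phi> (f p) * a - a * \<Phi> (f p))) \<le> e"
    and osc: "\<And>p h. p \<in> P \<Longrightarrow> f p h \<noteq> 0 \<Longrightarrow> norm (c h - c p) \<le> \<omega>"
    and "\<omega> \<ge> 0"
  shows "norm (partition_map \<Phi> P f (c \<otimes>\<^sub>C a) - \<Phi> c * a)
    \<le> e * (7 * norm c * norm a + 2 * norm c) + 2 * \<omega> * norm a"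
proof -
  have P': "finite P" "\<And>p. p \<in> P \<Longrightarrow> norm (f p) \<le> 1" "(\<Sum>p\<in>P. f p * f p) = 1"
    "\<And>h. (\<Sum>p\<in>P. (cmod (f p h))\<^sup>2) = 1"
    using P by (auto simp: square_partition_def)
  have "e \<ge> 0"
    using e1 by (rule order_trans[rotated]) (simp add: sum_nonneg)
  have "S - 1 = (\<Sum>p\<in>P. \<Phi> (f p) * \<Phi> (f p) - \<Phi> (f p * f p))"
    using P'(3) ucp_one[OF \<Phi>] by (simp add: gram_sum_def sum_subtractf flip: ucp_sum[OF \<Phi>])
  then have \<delta>: "\<delta> \<le> e"
    unfolding gram_defect_def using e1 norm_sum[of "\<lambda>p. \<Phi> (f p) * \<Phi> (f p) - \<Phi> (f p * f p)" P] by simp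
  define Q where "Q = (\<Sum>p\<in>P. \<Phi> (f p) * (c p *\<^sub>C a) * \<Phi> (f p))"
  define Q1 where "Q1 = (\<Sum>p\<in>P. c p *\<^sub>C (\<Phi> (f p) * \<Phi> (f p) * a))"
  define Q2 where "Q2 = (\<Sum>p\<in>P. c p *\<^sub>C (\<Phi> (f p * f p) * a))"
  define R where "R = partition_map \<Phi> P f (c \<otimes>\<^sub>C a)"
  have r2: "norm (r * (c 0 *\<^sub>C a) * r) \<le> 2 * \<delta> / (1 + \<delta>) * (norm c * norm a)"
  proof -
    \<comment> \<open>Written this way, both terms on the right have norm at most \<delta>, so the
      square of the norm of r is of order \<delta>.\<close>
    have "(1 + \<delta>) *\<^sub>R (r * r) = \<delta> *\<^sub>R 1 - (S - 1)"
      using defect_nonneg by (simp add: defect_root_square scaleR_diff_right scaleR_add_left)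
    then have "norm ((1 + \<delta>) *\<^sub>R (r * r)) \<le> norm (\<delta> *\<^sub>R (1::'a)) + norm (S - 1)"
      by (simp only: norm_triangle_ineq4)
    also have "\<dots> \<le> \<delta> + \<delta>"
      by (intro add_mono norm_scaleR_one_le defect_nonneg) (simp add: gram_defect_def)
    finally have "(1 + \<delta>) * norm (r * r) \<le> 2 * \<delta>"
      using defect_nonneg by simp
    then have *: "(norm r)\<^sup>2 \<le> 2 * \<delta> / (1 + \<delta>)"
      using defect_nonneg norm_square_self_adjoint[OF adj_defect_root]
      by (simp add: field_simps)
    have "norm (r * (c 0 *\<^sub>C a) * r) \<le> norm (r * (c 0 *\<^sub>C a)) * norm r"
      by (rule norm_mult_ineq)
    also have "\<dots> \<le> (norm r * (norm c * norm a)) * norm r"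
      using norm_bounded[of c 0]
      by (intro mult_right_mono order_trans[OF norm_mult_ineq] mult_left_mono)
        (auto simp: norm_scaleC mult_right_mono)
    also have "\<dots> = (norm r)\<^sup>2 * (norm c * norm a)"
      by (simp add: power2_eq_square)
    also have "\<dots> \<le> 2 * \<delta> / (1 + \<delta>) * (norm c * norm a)"
      using * by (rule mult_right_mono) simp
    finally show ?thesis .
  qed
  have RQ: "norm (R - Q) \<le> 4 * e * (norm c * norm a)"
  proof -
    have "R = (1 / (1 + \<delta>)) *\<^sub>R Q + r * (c 0 *\<^sub>C a) * r"
      by (simp add: R_def partition_map_def Q_def)
    then have "(1 + \<delta>) *\<^sub>R R = Q + (1 + \<delta>) *\<^sub>R (r * (c 0 *\<^sub>C a) * r)"
      using defect_nonneg by (simp add: scaleR_add_right)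
    then have "R - Q = (1 + \<delta>) *\<^sub>R (r * (c 0 *\<^sub>C a) * r) - \<delta> *\<^sub>R R"
      by (simp add: scaleR_add_left algebra_simps)
    then have "norm (R - Q) \<le> (1 + \<delta>) * norm (r * (c 0 *\<^sub>C a) * r) + \<delta> * norm R"
      using norm_triangle_ineq4[of "(1 + \<delta>) *\<^sub>R (r * (c 0 *\<^sub>C a) * r)" "\<delta> *\<^sub>R R"] defect_nonneg
      by simp
    also have "\<dots> \<le> (1 + \<delta>) * (2 * \<delta> / (1 + \<delta>) * (norm c * norm a)) + \<delta> * (2 * (norm c * norm a))"
    proof (intro add_mono mult_left_mono r2)
      have "norm R \<le> 2 * norm (c \<otimes>\<^sub>C a)"
        unfolding R_def by (rule ucp_norm_le[OF ucp_partition_map])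
      then show "norm R \<le> 2 * (norm c * norm a)"
        using norm_elem_tensor_le[of c a] by simp
    qed (use defect_nonneg in auto)
    also have "\<dots> = 4 * \<delta> * (norm c * norm a)"
      using defect_nonneg by (simp add: field_simps)
    also have "\<dots> \<le> 4 * e * (norm c * norm a)"
      using \<delta> by (intro mult_right_mono) auto
    finally show ?thesis .
  qed
  have QQ1: "norm (Q - Q1) \<le> 2 * norm c * e"
  proof -
    have "norm (Q - Q1) \<le> (\<Sum>p\<in>P. 2 * norm c * norm (\<Phi> (f p) * a - a * \<Phi> (f p)))"
      unfolding Q_def Q1_def sum_subtractf[symmetric]
    proof (rule sum_norm_le)
      fix p assume p: "p \<in> P"
      have "\<Phi> (f p) * (c p *\<^sub>C a) * \<Phi> (f p) - c p *\<^sub>C (\<Phi> (f p) * \<Phi> (f p) * a)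
          = c p *\<^sub>C (\<Phi> (f p) * (a * \<Phi> (f p) - \<Phi> (f p) * a))"
        by (simp add: mult_scaleC_left mult_scaleC_right scaleC_diff_right right_diff_distrib mult.assoc)
      also have "norm \<dots> \<le> norm c * (2 * norm (\<Phi> (f p) * a - a * \<Phi> (f p)))"
        unfolding norm_scaleC
      proof (intro mult_mono norm_bounded)
        have "norm (\<Phi> (f p)) \<le> 2"
          using ucp_norm_le[OF \<Phi>, of "f p"] P'(2)[OF p] by simp
        then show "norm (\<Phi> (f p) * (a * \<Phi> (f p) - \<Phi> (f p) * a)) \<le> 2 * norm (\<Phi> (f p) * a - a * \<Phi> (f p))"
          using norm_mult_ineq[of "\<Phi> (f p)" "a * \<Phi> (f p) - \<Phi> (f p) * a"]
            mult_right_mono[of "norm (\<Phi> (f p))" 2 "norm (\<Phi> (f p) * a - a * \<Phi> (f p))"]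
          by (simp add: norm_minus_commute)
      qed auto
      finally show "norm (\<Phi> (f p) * (c p *\<^sub>C a) * \<Phi> (f p) - c p *\<^sub>C (\<Phi> (f p) * \<Phi> (f p) * a))
          \<le> 2 * norm c * norm (\<Phi> (f p) * a - a * \<Phi> (f p))" by simp
    qed
    also have "\<dots> \<le> 2 * norm c * e"
      unfolding sum_distrib_left[symmetric] using e2 by (intro mult_left_mono) auto
    finally show ?thesis .
  qed
  have Q1Q2: "norm (Q1 - Q2) \<le> norm c * norm a * e"
  proof -
    have "norm (Q1 - Q2) \<le> (\<Sum>p\<in>P. norm c * norm a * norm (\<Phi> (f p) * \<Phi> (f p) - \<Phi> (f p * f p)))"
      unfolding Q1_def Q2_def sum_subtractf[symmetric]
    proof (rule sum_norm_le)
      fix p assume p: "p \<in> P"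
      have "c p *\<^sub>C (\<Phi> (f p) * \<Phi> (f p) * a) - c p *\<^sub>C (\<Phi> (f p * f p) * a)
          = c p *\<^sub>C ((\<Phi> (f p) * \<Phi> (f p) - \<Phi> (f p * f p)) * a)"
        by (simp add: scaleC_diff_right left_diff_distrib)
      also have "norm \<dots> \<le> norm c * (norm (\<Phi> (f p) * \<Phi> (f p) - \<Phi> (f p * f p)) * norm a)"
        unfolding norm_scaleC by (intro mult_mono norm_bounded norm_mult_ineq) auto
      finally show "norm (c p *\<^sub>C (\<Phi> (f p) * \<Phi> (f p) * a) - c p *\<^sub>C (\<Phi> (f p * f p) * a))
          \<le> norm c * norm a * norm (\<Phi> (f p) * \<Phi> (f p) - \<Phi> (f p * f p))"
        by (simp add: mult.commute mult.left_commute)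
    qed
    also have "\<dots> \<le> norm c * norm a * e"
      unfolding sum_distrib_left[symmetric] using e1 by (intro mult_left_mono) auto
    finally show ?thesis .
  qed
  have Q2: "norm (Q2 - \<Phi> c * a) \<le> 2 * \<omega> * norm a"
  proof -
    \<comment> \<open>At h the sum is an average of the values c p with weights (f p h)^2, and only
      those p count for which \<open>osc\<close> compares c p with c h.\<close>
    have "norm ((\<Sum>p\<in>P. c p *\<^sub>C (f p * f p)) - c) \<le> \<omega>"
    proof (rule norm_bound)
      fix h
      have one: "(\<Sum>p\<in>P. f p h * f p h) = 1"
        using arg_cong[OF P'(3), of "\<lambda>x. apply_bcontfun x h"] by (simp add: apply_sum_bcontfun)
      have "((\<Sum>p\<in>P. c p *\<^sub>C (f p * f p)) - c) h = (\<Sum>p\<in>P. c p * (f p h * f p h)) - c h * (\<Sum>p\<in>P. f p h * f p h)"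
        unfolding one by (simp add: apply_sum_bcontfun scaleC_complex_def)
      also have "\<dots> = (\<Sum>p\<in>P. (c p - c h) * (f p h * f p h))"
        unfolding sum_distrib_left sum_subtractf[symmetric] left_diff_distrib ..
      also have "norm \<dots> \<le> (\<Sum>p\<in>P. \<omega> * (cmod (f p h))\<^sup>2)"
      proof (rule sum_norm_le)
        fix p assume "p \<in> P"
        then show "norm ((c p - c h) * (f p h * f p h)) \<le> \<omega> * (cmod (f p h))\<^sup>2"
          using osc[of p h]
          by (cases "f p h = 0")
            (auto simp: norm_mult power2_eq_square norm_minus_commute intro!: mult_right_mono)
      qed
      also have "\<dots> = \<omega>"
        by (simp add: P'(4) flip: sum_distrib_left)
      finally show "norm (((\<Sum>p\<in>P. c p *\<^sub>C (f p * f p)) - c) h) \<le> \<omega>" .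
    qed
    then have "norm (\<Phi> ((\<Sum>p\<in>P. c p *\<^sub>C (f p * f p)) - c)) \<le> 2 * \<omega>"
      using ucp_norm_le[OF \<Phi>, of "(\<Sum>p\<in>P. c p *\<^sub>C (f p * f p)) - c"] by simp
    moreover have "Q2 - \<Phi> c * a = \<Phi> ((\<Sum>p\<in>P. c p *\<^sub>C (f p * f p)) - c) * a"
      by (simp add: Q2_def ucp_diff[OF \<Phi>] ucp_sum[OF \<Phi>] ucp_scaleC[OF \<Phi>] left_diff_distrib sum_distrib_right mult_scaleC_left)
    ultimately show ?thesis
      using norm_mult_ineq[of "\<Phi> ((\<Sum>p\<in>P. c p *\<^sub>C (f p * f p)) - c)" a]
        mult_right_mono[OF _ norm_ge_zero[of a]] by fastforce
  qed
  have "R - \<Phi> c * a = (R - Q) + ((Q - Q1) + ((Q1 - Q2) + (Q2 - \<Phi> c * a)))"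
    by simp
  then have "norm (R - \<Phi> c * a) \<le> 4 * e * (norm c * norm a) + (2 * norm c * e + (norm c * norm a * e + 2 * \<omega> * norm a))"
    using norm_triangle_mono[OF RQ norm_triangle_mono[OF QQ1 norm_triangle_mono[OF Q1Q2 Q2]]] by simp
  also have "\<dots> \<le> e * (7 * norm c * norm a + 2 * norm c) + 2 * \<omega> * norm a"
    using \<open>e \<ge> 0\<close> by (simp add: algebra_simps)
  finally show ?thesis
    by (simp add: R_def)
qed

end

lemma continuous_on_partition_map:
  fixes \<Phi> :: "real \<Rightarrow> ('g::{topological_space, zero} \<Rightarrow>\<^sub>C complex) \<Rightarrow> 'a::unital_cstar_algebra"
  assumes "\<And>t. ucp (\<Phi> t)" "square_partition P f" "\<And>c. continuous_on UNIV (\<lambda>t. \<Phi> t c)"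
  shows "continuous_on UNIV (\<lambda>t. partition_map (\<Phi> t) P f x)"
proof -
  have S: "continuous_on UNIV (\<lambda>t. gram_sum (\<Phi> t) P f)"
    unfolding gram_sum_def by (intro continuous_intros assms)
  then have D: "continuous_on UNIV (\<lambda>t. 1 / (1 + gram_defect (\<Phi> t) P f))"
    unfolding gram_defect_def
    by (intro continuous_intros) (auto simp: add_nonneg_eq_0_iff)
  have "continuous_on UNIV (\<lambda>t. defect_root (\<Phi> t) P f)"
    unfolding defect_root_def
    by (intro continuous_on_sqrt1m continuous_on_scaleR D S norm_gram_sum assms)
  then show ?thesis
    unfolding partition_map_def by (intro continuous_intros D assms)
qed

section \<open>Interpolation in time\<close>

text \<open>For n > 0 it climbs from 0 to 1 on the interval from s n to s n + 1. The constant value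
  1 at n = 0 makes the weights add up to 1 also at times before s 0.\<close>

definition ramp :: "(nat \<Rightarrow> real) \<Rightarrow> nat \<Rightarrow> real \<Rightarrow> real"
  where "ramp s n t = (if n = 0 then 1 else max 0 (min 1 (t - s n)))"

text \<open>A partition of unity in time: the n-th map fades in when ramp n climbs and fades out
  when ramp n + 1 does. The difference form makes the sum telescope.\<close>

definition weight :: "(nat \<Rightarrow> real) \<Rightarrow> nat \<Rightarrow> real \<Rightarrow> real"
  where "weight s n t = ramp s n t - ramp s (Suc n) t"

lemma continuous_on_weight: "continuous_on A (weight s n)"
proof -
  have "continuous_on A (ramp s n)" for n
    by (cases "n = 0") (auto simp: ramp_def[abs_def] intro!: continuous_intros)
  then show ?thesis
    unfolding weight_def[abs_def] by (intro continuous_intros)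
qed

lemma weight_nonneg: "mono s \<Longrightarrow> weight s n t \<ge> 0"
  using monoD[of s n "Suc n"] by (auto simp: weight_def ramp_def)

lemma sum_weight: "(\<Sum>n<N. weight s n t) = 1 - ramp s N t"
  unfolding weight_def by (subst sum_lessThan_telescope') (simp add: ramp_def)

lemma ramp_zero: "N > 0 \<Longrightarrow> t \<le> s N \<Longrightarrow> ramp s N t = 0"
  by (simp add: ramp_def)

lemma weight_zero_early: "mono s \<Longrightarrow> n > 0 \<Longrightarrow> t \<le> s n \<Longrightarrow> weight s n t = 0"
  using monoD[of s n "Suc n"] by (auto simp: weight_def ramp_def)

lemma weight_zero_late: "mono s \<Longrightarrow> t \<ge> s (Suc n) + 1 \<Longrightarrow> weight s n t = 0"
  using monoD[of s n "Suc n"] by (auto simp: weight_def ramp_def)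

text \<open>Partial sums of \<bar>T m\<bar> + 1 are monotone, dominate T n and grow at least like n.
  The growth leaves only finitely many nonzero weights at any time.\<close>

lemma threshold_times:
  fixes E :: "nat \<Rightarrow> real \<Rightarrow> real"
  assumes "\<And>n. (E n \<longlongrightarrow> 0) at_top"
  obtains s where "mono s" "\<And>n. real n \<le> s n" "\<And>n t. t \<ge> s n \<Longrightarrow> E n t \<le> 1 / real (Suc n)"
proof -
  have "\<exists>T. \<forall>t\<ge>T. E n t \<le> 1 / real (Suc n)" for n
  proof -
    have "\<forall>\<^sub>F t in at_top. E n t < 1 / real (Suc n)"
      by (rule order_tendstoD(2)[OF assms]) simp
    then show ?thesis
      unfolding eventually_at_top_linorder by (meson less_imp_le)
  qed
  then obtain T where T: "\<And>n t. t \<ge> T n \<Longrightarrow> E n t \<le> 1 / real (Suc n)"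
    by metis
  define s where "s n = (\<Sum>m\<le>n. \<bar>T m\<bar> + 1)" for n
  show ?thesis
  proof (rule that[of s])
    show "mono s"
      unfolding mono_iff_le_Suc by (simp add: s_def)
    show "real n \<le> s n" for n
      using sum_mono[of "{..n}" "\<lambda>_. 1" "\<lambda>m. \<bar>T m\<bar> + 1"] by (simp add: s_def)
    show "E n t \<le> 1 / real (Suc n)" if "t \<ge> s n" for n t
    proof (rule T)
      have "\<bar>T n\<bar> + 1 \<le> s n"
        unfolding s_def by (rule member_le_sum) auto
      with that show "T n \<le> t" by simp
    qed
  qed
qed

text \<open>The values are convex combinations, so they stay within e of y once every map of nonzero
  weight does. After time s (Suc n0) + 1 the maps up to n0 have faded out, and no map has weight
  before its own time s n.\<close>

lemma interpolation:
  fixes R :: "nat \<Rightarrow> real \<Rightarrow> 'c::unital_cstar_algebra \<Rightarrow> 'a::unital_cstar_algebra"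
  assumes s: "mono s" "\<And>n. real n \<le> s n"
    and R: "\<And>n t. ucp (R n t)" "\<And>n x. continuous_on UNIV (\<lambda>t. R n t x)"
  obtains \<Psi> where "\<And>t. t \<ge> 0 \<Longrightarrow> ucp (\<Psi> t)" "\<And>x. continuous_on {0..} (\<lambda>t. \<Psi> t x)"
    "\<And>x n0 e t y. t \<ge> s (Suc n0) + 1 \<Longrightarrow> \<forall>n>n0. t \<ge> s n \<longrightarrow> norm (R n t x - y) \<le> e
      \<Longrightarrow> norm (\<Psi> t x - y) \<le> e"
proof -
  \<comment> \<open>For n at least N t one has t \<le> n \<le> s n, so the weight is 0. The
    successor keeps this cut-off away from index 0, whose ramp never vanishes.\<close>
  define N where "N t = Suc (nat \<lceil>t\<rceil>)" for t :: real
  define \<Psi> where "\<Psi> t x = (\<Sum>n<N t. weight s n t *\<^sub>R R n t x)" for t x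
  have N: "t \<le> s n" if "n \<ge> N t" for t n
    using that s(2)[of n] by (simp add: N_def) linarith
  have sum_one: "(\<Sum>n<N t. weight s n t) = 1" for t
    using N[of t "N t"] by (simp add: sum_weight ramp_zero N_def)
  have \<Psi>_eq: "\<Psi> t x = (\<Sum>n<M. weight s n t *\<^sub>R R n t x)" if "N t \<le> M" for t x M
    unfolding \<Psi>_def
  proof (rule sum.mono_neutral_left)
    show "\<forall>n\<in>{..<M} - {..<N t}. weight s n t *\<^sub>R R n t x = 0"
      using N by (auto simp: weight_zero_early[OF s(1)] N_def)
  qed (use that in auto)
  show ?thesis
  proof (rule that[of \<Psi>])
    fix t :: real
    show "ucp (\<Psi> t)"
      unfolding ucp_def
    proof
      show "completely_positive (\<Psi> t)"
        unfolding \<Psi>_def[abs_def]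
        by (intro completely_positive_sum completely_positive_scaleR weight_nonneg s ucp_completely_positive R)
      show "\<Psi> t 1 = 1"
        using sum_one[of t] by (simp add: \<Psi>_def ucp_one[OF R(1)] flip: scaleR_left.sum)
    qed
  next
    fix x
    have "continuous_on (\<Union>M. {..<real M}) (\<lambda>t. \<Psi> t x)"
    proof (rule continuous_on_open_UN)
      fix M
      \<comment> \<open>The number of summands depends on t, but below time M one fixed number of
        them suffices.\<close>
      have "continuous_on {..<real M} (\<lambda>t. \<Sum>n<Suc M. weight s n t *\<^sub>R R n t x)"
        by (intro continuous_intros continuous_on_weight continuous_on_subset[OF R(2)]) auto
      then show "continuous_on {..<real M} (\<lambda>t. \<Psi> t x)"
      proof (rule continuous_on_eq)
        fix t assume "t \<in> {..<real M}"
        then have "N t \<le> Suc M" by (simp add: N_def)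
        then show "(\<Sum>n<Suc M. weight s n t *\<^sub>R R n t x) = \<Psi> t x" by (simp only: \<Psi>_eq)
      qed
    qed auto
    then show "continuous_on {0..} (\<lambda>t. \<Psi> t x)"
      by (rule continuous_on_subset) (auto intro: reals_Archimedean2)
  next
    fix x n0 e t y
    assume t: "t \<ge> s (Suc n0) + 1" and e: "\<forall>n>n0. t \<ge> s n \<longrightarrow> norm (R n t x - y) \<le> e"
    have "\<Psi> t x - y = (\<Sum>n<N t. weight s n t *\<^sub>R R n t x) - (\<Sum>n<N t. weight s n t) *\<^sub>R y"
      by (simp add: \<Psi>_def sum_one)
    also have "\<dots> = (\<Sum>n<N t. weight s n t *\<^sub>R (R n t x - y))"
      by (simp add: scaleR_left.sum sum_subtractf scaleR_diff_right)
    also have "norm \<dots> \<le> (\<Sum>n<N t. weight s n t * e)"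
    proof (rule sum_norm_le)
      fix n
      show "norm (weight s n t *\<^sub>R (R n t x - y)) \<le> weight s n t * e"
      proof (cases "weight s n t = 0")
        case False
        have "n > n0"
        proof (rule ccontr)
          assume "\<not> n > n0"
          then have "s (Suc n) \<le> s (Suc n0)" by (intro monoD[OF s(1)]) simp
          then have "weight s n t = 0" using t by (intro weight_zero_late s) simp
          with False show False by simp
        qed
        moreover from this have "t \<ge> s n"
          using weight_zero_early[OF s(1), of n t] False by (cases "t \<le> s n") auto
        ultimately show ?thesis
          using e weight_nonneg[OF s(1), of n t] by (simp add: mult_left_mono)
      qed simp
    qed
    also have "\<dots> = e"
      by (simp add: sum_one flip: sum_distrib_right)
    finally show "norm (\<Psi> t x - y) \<le> e" .
  qed
qed

section \<open>From central morphisms of \<open>C(G)\<close> to maps on \<open>C(G, A)\<close>\<close>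

lemma vanishing_mult_left:
  fixes B E :: "real \<Rightarrow> 'i \<Rightarrow> 'a::real_normed_algebra"
  assumes "vanishing E" "\<And>t i. t \<ge> 0 \<Longrightarrow> norm (B t i) \<le> K"
  shows "vanishing (\<lambda>t i. B t i * E t i)"
proof (rule vanishing_bound[OF assms(1)])
  show "\<forall>\<^sub>F t in at_top. \<forall>i. norm (B t i * E t i) \<le> K * norm (E t i)"
    using eventually_ge_at_top[of "0::real"]
  proof eventually_elim
    case (elim t)
    show ?case
    proof
      fix i
      have "norm (B t i * E t i) \<le> norm (B t i) * norm (E t i)" by (rule norm_mult_ineq)
      also have "\<dots> \<le> K * norm (E t i)" by (intro mult_right_mono assms(2) elim norm_ge_zero)
      finally show "norm (B t i * E t i) \<le> K * norm (E t i)" .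
    qed
  qed
qed

lemma vanishing_mult_right:
  fixes B E :: "real \<Rightarrow> 'i \<Rightarrow> 'a::real_normed_algebra"
  assumes "vanishing E" "\<And>t i. t \<ge> 0 \<Longrightarrow> norm (B t i) \<le> K"
  shows "vanishing (\<lambda>t i. E t i * B t i)"
proof (rule vanishing_bound[OF assms(1), where K = K])
  show "\<forall>\<^sub>F t in at_top. \<forall>i. norm (E t i * B t i) \<le> K * norm (E t i)"
    using eventually_ge_at_top[of "0::real"]
  proof eventually_elim
    case (elim t)
    show ?case
    proof
      fix i
      have "norm (E t i * B t i) \<le> norm (E t i) * norm (B t i)" by (rule norm_mult_ineq)
      also have "\<dots> \<le> norm (E t i) * K" by (intro mult_left_mono assms(2) elim norm_ge_zero)
      finally show "norm (E t i * B t i) \<le> K * norm (E t i)" by (simp add: mult.commute)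
    qed
  qed
qed

lemma vanishing_const: "vanishing (\<lambda>t (_::unit). d t) \<Longrightarrow> vanishing (\<lambda>t (_::'i). d t)"
  by (simp add: vanishing_def)

lemma elem_tensor_diff_right: "f \<otimes>\<^sub>C (a - b) = f \<otimes>\<^sub>C a - f \<otimes>\<^sub>C b"
  by (rule bcontfun_eqI) (simp add: scaleC_diff_right)

lemma elem_tensor_diff_left: "(f - f') \<otimes>\<^sub>C a = f \<otimes>\<^sub>C a - f' \<otimes>\<^sub>C a"
  using elem_tensor_bilinear(1)[of "f - f'" f' a] by simp

lemma separable_dense_sequence:
  assumes "separable_space (euclidean :: 'a::metric_space topology)"
  obtains u :: "nat \<Rightarrow> 'a::metric_space" where "\<And>a e. e > 0 \<Longrightarrow> \<exists>k. dist (u k) a < e"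
proof -
  obtain U :: "'a set" where U: "countable U" "closure U = UNIV"
    using assms by (auto simp: separable_space_def)
  then have "U \<noteq> {}" by auto
  show ?thesis
  proof (rule that[of "from_nat_into U"])
    fix a :: 'a and e :: real assume "e > 0"
    then obtain y where "y \<in> U" "dist y a < e"
      using U(2) closure_approachable[of a U] by auto
    then show "\<exists>k. dist (from_nat_into U k) a < e"
      using from_nat_into_surj[OF U(1) \<open>y \<in> U\<close>] by auto
  qed
qed

lemma tensor_defect_bound:
  assumes "ucp \<Psi>" "ucp \<Phi>"
  shows "norm (\<Psi> (c \<otimes>\<^sub>C a) - \<Phi> c * a) \<le> 4 * norm c * norm a"
proof -
  have "norm (\<Psi> (c \<otimes>\<^sub>C a)) \<le> 2 * norm c * norm a"
    using ucp_norm_le[OF assms(1), of "c \<otimes>\<^sub>C a"] norm_elem_tensor_le[of c a] by simp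
  moreover have "norm (\<Phi> c * a) \<le> 2 * norm c * norm a"
    using norm_mult_ineq[of "\<Phi> c" a] mult_right_mono[OF ucp_norm_le[OF assms(2), of c], of "norm a"] by simp
  ultimately show ?thesis
    using norm_triangle_ineq4[of "\<Psi> (c \<otimes>\<^sub>C a)" "\<Phi> c * a"] by simp
qed

text \<open>The defect is bilinear in c and a and bounded independently of the two maps. Hence its
  convergence to 0 passes from a dense set of a to all a, and becomes uniform on compact
  orbits.\<close>

lemma tensor_defect_diff:
  assumes "ucp \<Psi>" "ucp \<Phi>"
  shows "norm ((\<Psi> (c \<otimes>\<^sub>C a) - \<Phi> c * a) - (\<Psi> (c' \<otimes>\<^sub>C a') - \<Phi> c' * a'))
    \<le> 4 * (norm (c - c') * norm a + norm c' * norm (a - a'))"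
proof -
  note diff = ucp_diff[OF assms(1)] ucp_diff[OF assms(2)]
  have "(\<Psi> (c \<otimes>\<^sub>C a) - \<Phi> c * a) - (\<Psi> (c' \<otimes>\<^sub>C a') - \<Phi> c' * a')
      = (\<Psi> ((c - c') \<otimes>\<^sub>C a) - \<Phi> (c - c') * a) + (\<Psi> (c' \<otimes>\<^sub>C (a - a')) - \<Phi> c' * (a - a'))"
    by (simp add: elem_tensor_diff_right elem_tensor_diff_left diff algebra_simps)
  then show ?thesis
    using norm_triangle_mono[OF tensor_defect_bound[OF assms, of "c - c'" a]
        tensor_defect_bound[OF assms, of c' "a - a'"]]
    by simp
qed

text \<open>A diagonal argument. At time s n, the defects of the n-th partition are tested only
  against u 0, ..., u n; each u k is thus covered from n = k on, and density gives all a. The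
  function c needs no such enumeration, as refinement controls its oscillation.\<close>

lemma tensor_extension:
  fixes \<Phi> :: "real \<Rightarrow> ('g::{zero, t2_space, second_countable_topology} \<Rightarrow>\<^sub>C complex) \<Rightarrow> 'a::unital_cstar_algebra"
  assumes compact: "compact (UNIV :: 'g set)"
    and separable: "separable_space (euclidean :: 'a topology)"
    and ucp: "\<And>t. ucp (\<Phi> t)"
    and cont: "\<And>c. continuous_on UNIV (\<lambda>t. \<Phi> t c)"
    and mult: "\<And>c d. ((\<lambda>t. norm (\<Phi> t (c * d) - \<Phi> t c * \<Phi> t d)) \<longlongrightarrow> 0) at_top"
    and central: "\<And>c b. ((\<lambda>t. norm (\<Phi> t c * b - b * \<Phi> t c)) \<longlongrightarrow> 0) at_top"
  obtains \<Psi> where "\<And>t. t \<ge> 0 \<Longrightarrow> ucp (\<Psi> t)" "\<And>x. continuous_on {0..} (\<lambda>t. \<Psi> t x)"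
    "\<And>c a. vanishing (\<lambda>t (_::unit). \<Psi> t (c \<otimes>\<^sub>C a) - \<Phi> t c * a)"
proof -
  obtain u :: "nat \<Rightarrow> 'a" where u: "\<And>a e. e > 0 \<Longrightarrow> \<exists>k. dist (u k) a < e"
    using separable_dense_sequence[OF separable] by blast
  obtain P and f :: "nat \<Rightarrow> 'g \<Rightarrow> ('g \<Rightarrow>\<^sub>C complex)" where Pf: "partition_family P f"
    by (rule partition_family_exists[OF compact])
  then have P: "square_partition (P n) (f n)" for n
    by (simp add: partition_family_def)
  define E1 where "E1 n t = (\<Sum>p\<in>P n. norm (\<Phi> t (f n p) * \<Phi> t (f n p) - \<Phi> t (f n p * f n p)))" for n t
  define E2 where "E2 n k t = (\<Sum>p\<in>P n. norm (\<Phi> t (f n p) * u k - u k * \<Phi> t (f n p)))" for n k t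
  have E1: "E1 n t \<ge> 0" and E2: "E2 n k t \<ge> 0" for n k t
    by (simp_all add: E1_def E2_def sum_nonneg)
  have lim: "((\<lambda>t. E1 n t + (\<Sum>k\<le>n. E2 n k t)) \<longlongrightarrow> 0) at_top" for n
    unfolding E1_def E2_def
    by (subst norm_minus_commute) (intro tendsto_add_zero tendsto_null_sum mult central)
  obtain s where s: "mono s" "\<And>n. real n \<le> s n"
    and small: "\<And>n t. t \<ge> s n \<Longrightarrow> E1 n t + (\<Sum>k\<le>n. E2 n k t) \<le> 1 / real (Suc n)"
    by (rule threshold_times[of "\<lambda>n t. E1 n t + (\<Sum>k\<le>n. E2 n k t)", OF lim]) (rule that)
  define R where "R n t = partition_map (\<Phi> t) (P n) (f n)" for n t
  have R: "ucp (R n t)" "continuous_on UNIV (\<lambda>t. R n t x)" for n t x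
    unfolding R_def by (rule ucp_partition_map[OF ucp P] continuous_on_partition_map[OF ucp P cont])+
  obtain \<Psi> where \<Psi>: "\<And>t. t \<ge> 0 \<Longrightarrow> ucp (\<Psi> t)" "\<And>x. continuous_on {0..} (\<lambda>t. \<Psi> t x)"
    and close: "\<And>x n0 e t y. t \<ge> s (Suc n0) + 1 \<Longrightarrow> \<forall>n>n0. t \<ge> s n \<longrightarrow> norm (R n t x - y) \<le> e
      \<Longrightarrow> norm (\<Psi> t x - y) \<le> e"
    by (rule interpolation[OF s R]) (rule that)
  have dense: "vanishing (\<lambda>t (_::unit). \<Psi> t (c \<otimes>\<^sub>C u k) - \<Phi> t c * u k)" for c k
    unfolding vanishing_def
  proof (intro allI impI)
    fix e :: real assume "e > 0"
    define K where "K = 7 * norm c * norm (u k) + 2 * norm c"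
    \<comment> \<open>Makes the oscillation term at most e / 2; the summand 1 guards against u k =
      0.\<close>
    define \<omega> where "\<omega> = e / (4 * (norm (u k) + 1))"
    have \<omega>: "\<omega> > 0" "2 * \<omega> * norm (u k) \<le> e / 2"
      using \<open>e > 0\<close> by (simp_all add: \<omega>_def field_simps add_pos_nonneg)
    have "\<forall>\<^sub>F n in sequentially. \<forall>p\<in>P n. \<forall>h. f n p h \<noteq> 0 \<longrightarrow> norm (c h - c p) \<le> \<omega>"
      using Pf \<omega>(1) by (simp add: partition_family_def)
    then obtain n1 where n1: "\<forall>n\<ge>n1. \<forall>p\<in>P n. \<forall>h. f n p h \<noteq> 0 \<longrightarrow> norm (c h - c p) \<le> \<omega>"
      unfolding eventually_sequentially by (elim exE)
    obtain n2 where n2: "real n2 > 2 * K / e"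
      using reals_Archimedean2 by blast
    \<comment> \<open>Beyond n0 the commutator with u k is among those controlled, the oscillation
      of c is at most \<omega>, and K / (n + 1) is at most e / 2.\<close>
    define n0 where "n0 = max k (max n1 n2)"
    have "norm (\<Psi> t (c \<otimes>\<^sub>C u k) - \<Phi> t c * u k) \<le> e" if t: "t \<ge> s (Suc n0) + 1" for t
    proof (rule close[OF t], intro allI impI)
      fix n assume n: "n > n0" "t \<ge> s n"
      let ?e = "1 / real (Suc n)"
      have sum: "E1 n t + (\<Sum>k\<le>n. E2 n k t) \<le> ?e" by (rule small[OF n(2)])
      have "E2 n k t \<le> (\<Sum>k\<le>n. E2 n k t)"
        using n(1) E2 by (intro member_le_sum) (auto simp: n0_def)
      with sum E1[of n t] have "E2 n k t \<le> ?e" by simp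
      moreover have "E1 n t \<le> ?e"
        using sum sum_nonneg[of "{..n}" "\<lambda>k. E2 n k t"] E2 by simp
      moreover have "n \<ge> n1"
        using n(1) by (simp add: n0_def)
      with n1 have "norm (c h - c p) \<le> \<omega>" if "p \<in> P n" "f n p h \<noteq> 0" for p h
        using that by blast
      ultimately have "norm (R n t (c \<otimes>\<^sub>C u k) - \<Phi> t c * u k) \<le> ?e * K + 2 * \<omega> * norm (u k)"
        unfolding R_def K_def
        using \<omega>(1)
        by (intro partition_map_tensor_estimate[OF ucp P]) (simp_all only: E1_def E2_def less_imp_le)
      also have "?e * K \<le> e / 2"
      proof -
        have "2 * K / e \<le> real (Suc n)" using n2 n(1) by (simp add: n0_def)
        then show ?thesis using \<open>e > 0\<close> by (simp add: field_simps)
      qed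
      finally show "norm (R n t (c \<otimes>\<^sub>C u k) - \<Phi> t c * u k) \<le> e"
        using \<omega>(2) by simp
    qed
    then show "\<forall>\<^sub>F t in at_top. \<forall>_::unit. norm (\<Psi> t (c \<otimes>\<^sub>C u k) - \<Phi> t c * u k) \<le> e"
      by (intro eventually_mono[OF eventually_ge_at_top[of "s (Suc n0) + 1"]] allI)
  qed
  have "vanishing (\<lambda>t (_::unit). \<Psi> t (c \<otimes>\<^sub>C a) - \<Phi> t c * a)" for c a
  proof (rule vanishing_approx)
    fix e :: real assume "e > 0"
    then have "e / (4 * (norm c + 1)) > 0" by (simp add: add_nonneg_pos)
    then obtain k where k: "dist (u k) a < e / (4 * (norm c + 1))" using u by blast
    have "norm ((\<Psi> t (c \<otimes>\<^sub>C a) - \<Phi> t c * a) - (\<Psi> t (c \<otimes>\<^sub>C u k) - \<Phi> t c * u k)) \<le> e" if "t \<ge> 0" for t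
    proof -
      have "norm ((\<Psi> t (c \<otimes>\<^sub>C a) - \<Phi> t c * a) - (\<Psi> t (c \<otimes>\<^sub>C u k) - \<Phi> t c * u k)) \<le> 4 * (norm c * norm (a - u k))"
        using tensor_defect_diff[OF \<Psi>(1)[OF that] ucp, of c a t c "u k"] by simp
      also have "\<dots> \<le> 4 * ((norm c + 1) * (e / (4 * (norm c + 1))))"
        using k by (intro mult_left_mono mult_mono) (auto simp: dist_norm norm_minus_commute)
      also have "\<dots> = e"
      proof -
        have "4 * (x * (e / (4 * x))) = e" if "x \<noteq> 0" for x :: real
          using that by simp
        moreover have "norm c + 1 \<noteq> 0"
          using norm_ge_zero[of c] by linarith
        ultimately show ?thesis .
      qed
      finally show ?thesis .
    qed
    then have "\<forall>\<^sub>F t in at_top. \<forall>_::unit. norm ((\<Psi> t (c \<otimes>\<^sub>C a) - \<Phi> t c * a) - (\<Psi> t (c \<otimes>\<^sub>C u k) - \<Phi> t c * u k)) \<le> e"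
      by (intro eventually_mono[OF eventually_ge_at_top[of "0::real"]] allI)
    with dense[of c k] show "\<exists>E. vanishing E \<and> (\<forall>\<^sub>F t in at_top. \<forall>i::unit. norm ((\<Psi> t (c \<otimes>\<^sub>C a) - \<Phi> t c * a) - E t i) \<le> e)"
      by (intro exI[of _ "\<lambda>t _. \<Psi> t (c \<otimes>\<^sub>C u k) - \<Phi> t c * u k"] conjI)
  qed
  from that[OF \<Psi> this] show ?thesis .
qed

section \<open>Asymptotic behaviour of the extension\<close>

context
  fixes \<Phi> :: "real \<Rightarrow> ('g::topological_space \<Rightarrow>\<^sub>C complex) \<Rightarrow> 'a::unital_cstar_algebra"
    and \<Psi> :: "real \<Rightarrow> ('g \<Rightarrow>\<^sub>C 'a) \<Rightarrow> 'a"
  assumes compact: "compact (UNIV :: 'g set)"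
    and \<Phi>: "\<And>t. t \<ge> 0 \<Longrightarrow> ucp (\<Phi> t)" and \<Psi>: "\<And>t. t \<ge> 0 \<Longrightarrow> ucp (\<Psi> t)"
    and tensor: "\<And>c a. vanishing (\<lambda>t (_::unit). \<Psi> t (c \<otimes>\<^sub>C a) - \<Phi> t c * a)"
begin

text \<open>On elementary tensors, pass from \<Phi>(c c') a a' to \<Phi>(c) \<Phi>(c') a a' by
  multiplicativity and to \<Phi>(c) a \<Phi>(c') a' by centrality; the tensor relation links both
  ends to \<Psi>. Density then extends this in x and afterwards in y, as the defect is additive in
  each variable.\<close>

lemma extension_multiplicative:
  assumes mult: "\<And>c d. ((\<lambda>t. norm (\<Phi> t (c * d) - \<Phi> t c * \<Phi> t d)) \<longlongrightarrow> 0) at_top"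
    and central: "\<And>c b. ((\<lambda>t. norm (\<Phi> t c * b - b * \<Phi> t c)) \<longlongrightarrow> 0) at_top"
  shows "((\<lambda>t. norm (\<Psi> t (x * y) - \<Psi> t x * \<Psi> t y)) \<longlongrightarrow> 0) at_top"
proof -
  \<comment> \<open>6 = 2 + 2 * 2, from the bound 2 for each application of \<Psi>.\<close>
  have bound: "norm (\<Psi> t (x * y) - \<Psi> t x * \<Psi> t y) \<le> 6 * norm x * norm y" if "t \<ge> 0" for t x y
  proof -
    note norm_le = ucp_norm_le[OF \<Psi>[OF that]]
    have "norm (\<Psi> t (x * y)) \<le> 2 * (norm x * norm y)"
      using norm_le[of "x * y"] norm_mult_ineq[of x y] by simp
    moreover have "norm (\<Psi> t x * \<Psi> t y) \<le> (2 * norm x) * (2 * norm y)"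
      using norm_mult_ineq[of "\<Psi> t x" "\<Psi> t y"] mult_mono[OF norm_le[of x] norm_le[of y]] by simp
    ultimately show ?thesis
      using norm_triangle_ineq4[of "\<Psi> t (x * y)" "\<Psi> t x * \<Psi> t y"] by simp
  qed
  have add: "\<Psi> t (x + y) = \<Psi> t x + \<Psi> t y" if "t \<ge> 0" for t x y
    by (rule ucp_add[OF \<Psi>[OF that]])
  have \<Phi>_bound: "norm (\<Phi> t c) \<le> 2 * norm c" and \<Psi>_bound: "norm (\<Psi> t x) \<le> 2 * norm x"
    if "t \<ge> 0" for t c x
    using ucp_norm_le[OF \<Phi>[OF that]] ucp_norm_le[OF \<Psi>[OF that]] by auto
  have \<Phi>_bound': "norm (\<Phi> t c * a) \<le> 2 * norm c * norm a" if "t \<ge> 0" for t c a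
    using norm_mult_ineq[of "\<Phi> t c" a] mult_right_mono[OF \<Phi>_bound[OF that, of c], of "norm a"] by simp
  have elementary: "vanishing (\<lambda>t (_::unit). \<Psi> t ((c \<otimes>\<^sub>C a) * (c' \<otimes>\<^sub>C a')) - \<Psi> t (c \<otimes>\<^sub>C a) * \<Psi> t (c' \<otimes>\<^sub>C a'))"
    for c a c' a'
  proof -
    have m: "vanishing (\<lambda>t (_::unit). \<Phi> t (c * c') - \<Phi> t c * \<Phi> t c')"
      using mult by (simp add: vanishing_unit_iff)
    have z: "vanishing (\<lambda>t (_::unit). \<Phi> t c' * a - a * \<Phi> t c')"
      using central by (simp add: vanishing_unit_iff)
    have x: "vanishing (\<lambda>t (_::unit). \<Phi> t c * a - \<Psi> t (c \<otimes>\<^sub>C a))"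
      "vanishing (\<lambda>t (_::unit). \<Phi> t c' * a' - \<Psi> t (c' \<otimes>\<^sub>C a'))"
      using tensor by (simp_all add: vanishing_unit_iff norm_minus_commute)
    have 1: "vanishing (\<lambda>t (_::unit). \<Psi> t ((c * c') \<otimes>\<^sub>C (a * a')) - \<Phi> t (c * c') * (a * a'))"
      by (rule tensor)
    have 2: "vanishing (\<lambda>t (_::unit). (\<Phi> t (c * c') - \<Phi> t c * \<Phi> t c') * (a * a'))"
      by (rule vanishing_mult_right[OF m, of _ "norm (a * a')"]) simp
    have 3: "vanishing (\<lambda>t (_::unit). \<Phi> t c * ((\<Phi> t c' * a - a * \<Phi> t c') * a'))"
      by (rule vanishing_mult_left[OF vanishing_mult_right[OF z, of _ "norm a'"] \<Phi>_bound]) simp_all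
    have 4: "vanishing (\<lambda>t (_::unit). (\<Phi> t c * a - \<Psi> t (c \<otimes>\<^sub>C a)) * (\<Phi> t c' * a'))"
      by (rule vanishing_mult_right[OF x(1) \<Phi>_bound'])
    have 5: "vanishing (\<lambda>t (_::unit). \<Psi> t (c \<otimes>\<^sub>C a) * (\<Phi> t c' * a' - \<Psi> t (c' \<otimes>\<^sub>C a')))"
      by (rule vanishing_mult_left[OF x(2) \<Psi>_bound])
    show ?thesis
      using vanishing_add[OF 1 vanishing_add[OF 2 vanishing_add[OF 3 vanishing_add[OF 4 5]]]]
      by (simp add: elem_tensor_mult algebra_simps)
  qed
  have half: "vanishing (\<lambda>t (_::unit). \<Psi> t (x * (c' \<otimes>\<^sub>C a')) - \<Psi> t x * \<Psi> t (c' \<otimes>\<^sub>C a'))" for x c' a'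
  proof (rule vanishing_elem_tensor[OF compact, where K = "6 * norm (c' \<otimes>\<^sub>C a')" and x = x
      and D = "\<lambda>t _ x. \<Psi> t (x * (c' \<otimes>\<^sub>C a')) - \<Psi> t x * \<Psi> t (c' \<otimes>\<^sub>C a')"])
    fix t :: real and x assume "t \<ge> 0"
    then show "norm (\<Psi> t (x * (c' \<otimes>\<^sub>C a')) - \<Psi> t x * \<Psi> t (c' \<otimes>\<^sub>C a')) \<le> 6 * norm (c' \<otimes>\<^sub>C a') * norm x"
      using bound[of t x "c' \<otimes>\<^sub>C a'"] by (simp add: mult_ac)
  qed (auto simp: add distrib_right elementary)
  have "vanishing (\<lambda>t (_::unit). \<Psi> t (x * y) - \<Psi> t x * \<Psi> t y)"
    by (rule vanishing_elem_tensor[OF compact, where K = "6 * norm x" and x = y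
      and D = "\<lambda>t _ y. \<Psi> t (x * y) - \<Psi> t x * \<Psi> t y"])
      (auto simp: add distrib_left bound half)
  then show ?thesis
    by (simp add: vanishing_unit_iff)
qed

lemma extension_section: "((\<lambda>t. \<Psi> t (1 \<otimes>\<^sub>C a)) \<longlongrightarrow> a) at_top"
proof -
  have "((\<lambda>t. norm (\<Psi> t (1 \<otimes>\<^sub>C a) - \<Phi> t 1 * a)) \<longlongrightarrow> 0) at_top"
    using tensor by (simp add: vanishing_unit_iff)
  moreover have "\<forall>\<^sub>F t in at_top. norm (\<Psi> t (1 \<otimes>\<^sub>C a) - \<Phi> t 1 * a) = norm (\<Psi> t (1 \<otimes>\<^sub>C a) - a)"
    using eventually_ge_at_top[of "0::real"] by eventually_elim (simp add: ucp_one[OF \<Phi>])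
  ultimately have "((\<lambda>t. norm (\<Psi> t (1 \<otimes>\<^sub>C a) - a)) \<longlongrightarrow> 0) at_top"
    by (rule Lim_transform_eventually)
  then show ?thesis
    by (simp add: tendsto_norm_zero_iff Lim_null[symmetric])
qed

end

text \<open>The tensor relation holds at each point of the orbit of c (x) a. Since the orbit maps
  are continuous, finitely many points approximate the compact orbit, and uniform boundedness of the
  defect makes the relation uniform in g (\<open>orbit\<close>). Equivariance of \<Phi> does the
  rest.\<close>

lemma extension_equivariant:
  fixes \<Phi> :: "real \<Rightarrow> ('g::topological_group_add \<Rightarrow>\<^sub>C complex) \<Rightarrow> 'a::unital_cstar_algebra"
    and \<Psi> :: "real \<Rightarrow> ('g \<Rightarrow>\<^sub>C 'a) \<Rightarrow> 'a"
  assumes compact: "compact (UNIV :: 'g set)" and action: "continuous_action \<alpha>"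
    and \<Phi>: "\<And>t. t \<ge> 0 \<Longrightarrow> ucp (\<Phi> t)" and \<Psi>: "\<And>t. t \<ge> 0 \<Longrightarrow> ucp (\<Psi> t)"
    and tensor: "\<And>c a. vanishing (\<lambda>t (_::unit). \<Psi> t (c \<otimes>\<^sub>C a) - \<Phi> t c * a)"
    and equivariant: "\<And>c. vanishing (\<lambda>t g. \<Phi> t (Lt g c) - \<alpha> g (\<Phi> t c))"
  shows "vanishing (\<lambda>t g. \<Psi> t (Lt_tensor \<alpha> g x) - \<alpha> g (\<Psi> t x))"
proof -
  note \<alpha> = ucp_continuous_action[OF action]
  have \<alpha>_mult: "\<alpha> g (a * b) = \<alpha> g a * \<alpha> g b" for g a b
    using action by (simp add: continuous_action_def star_automorphism_def)
  have add: "\<Psi> t (x + y) = \<Psi> t x + \<Psi> t y" if "t \<ge> 0" for t x y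
    by (rule ucp_add[OF \<Psi>[OF that]])
  have orbit: "vanishing (\<lambda>t g. \<Psi> t (Lt g c \<otimes>\<^sub>C \<alpha> g a) - \<Phi> t (Lt g c) * \<alpha> g a)" for c a
    unfolding vanishing_def
  proof (intro allI impI)
    fix e :: real assume "e > 0"
    \<comment> \<open>4 and the two norms come from \<open>tensor_defect_diff\<close>, the inner 2
      from the norm bound for \<alpha>_g; the summand 1 makes K positive.\<close>
    define K where "K = 4 * (2 * norm a + norm c) + 1"
    have "K > 0" by (simp add: K_def add_nonneg_pos)
    define d where "d = e / (2 * K)"
    have "d > 0" using \<open>e > 0\<close> \<open>K > 0\<close> by (simp add: d_def)
    let ?D = "\<lambda>t g. \<Psi> t (Lt g c \<otimes>\<^sub>C \<alpha> g a) - \<Phi> t (Lt g c) * \<alpha> g a"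
    have "\<exists>N. open N \<and> g0 \<in> N \<and> (\<forall>g\<in>N. norm (Lt g c - Lt g0 c) \<le> d \<and> norm (\<alpha> g a - \<alpha> g0 a) \<le> d)" for g0
    proof -
      obtain N1 where N1: "open N1" "g0 \<in> N1" "\<And>g. g \<in> N1 \<Longrightarrow> norm (Lt g c - Lt g0 c) \<le> d"
        using Lt_near[OF compact \<open>d > 0\<close>] by blast
      have "continuous_on UNIV (\<lambda>g. \<alpha> g a)"
        using action by (simp add: continuous_action_def)
      then have "open {g. norm (\<alpha> g a - \<alpha> g0 a) < d}"
        by (intro open_Collect_less continuous_intros)
      then show ?thesis
        using N1 \<open>d > 0\<close>
        by (intro exI[of _ "N1 \<inter> {g. norm (\<alpha> g a - \<alpha> g0 a) < d}"]) auto
    qed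
    then obtain N where N: "\<And>g0. open (N g0)" "\<And>g0. g0 \<in> N g0"
      "\<And>g0 g. g \<in> N g0 \<Longrightarrow> norm (Lt g c - Lt g0 c) \<le> d \<and> norm (\<alpha> g a - \<alpha> g0 a) \<le> d"
      by metis
    obtain F where F: "finite F" "UNIV \<subseteq> (\<Union>g0\<in>F. N g0)"
    proof (rule compactE_image[OF compact, of UNIV N])
      show "UNIV \<subseteq> (\<Union>g0\<in>UNIV. N g0)" using N(2) by blast
    qed (auto intro: N)
    have "\<forall>\<^sub>F t in at_top. \<forall>g0\<in>F. norm (?D t g0) \<le> e / 2"
    proof (intro eventually_ball_finite F ballI)
      fix g0
      show "\<forall>\<^sub>F t in at_top. norm (?D t g0) \<le> e / 2"
        using vanishingD[OF tensor[of "Lt g0 c" "\<alpha> g0 a"], of "e / 2"] \<open>e > 0\<close> by simp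
    qed
    then show "\<forall>\<^sub>F t in at_top. \<forall>g. norm (?D t g) \<le> e"
      using eventually_ge_at_top[of "0::real"]
    proof eventually_elim
      case (elim t)
      show ?case
      proof
        fix g
        obtain g0 where g0: "g0 \<in> F" "g \<in> N g0" using F(2) by blast
        have "norm (?D t g - ?D t g0) \<le> 4 * (norm (Lt g c - Lt g0 c) * norm (\<alpha> g a) + norm (Lt g0 c) * norm (\<alpha> g a - \<alpha> g0 a))"
          by (rule tensor_defect_diff[OF \<Psi>[OF elim(2)] \<Phi>[OF elim(2)]])
        also have "\<dots> \<le> 4 * (d * (2 * norm a) + norm c * d)"
          using N(3)[OF g0(2)] \<open>d > 0\<close> ucp_norm_le[OF \<alpha>, of g a] norm_Lt_le[of g0 c]
          by (intro mult_left_mono add_mono mult_mono) auto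
        also have "\<dots> \<le> d * K"
          using \<open>d > 0\<close> by (simp add: K_def algebra_simps)
        also have "\<dots> = e / 2"
          using \<open>K > 0\<close> by (simp add: d_def)
        finally have "norm (?D t g - ?D t g0) \<le> e / 2" .
        moreover have "norm (?D t g0) \<le> e / 2" using elim(1) g0(1) by blast
        ultimately show "norm (?D t g) \<le> e"
          using norm_triangle_mono[of "?D t g - ?D t g0" "e / 2" "?D t g0" "e / 2"] by simp
      qed
    qed
  qed
  show ?thesis
  \<comment> \<open>8 = 4 + 4, since in each term two maps with norm bound 2 are composed.\<close>
  proof (rule vanishing_elem_tensor[OF compact, where K = 8 and x = x
      and D = "\<lambda>t g x. \<Psi> t (Lt_tensor \<alpha> g x) - \<alpha> g (\<Psi> t x)"])
    fix t :: real and g x y assume "t \<ge> 0"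
    then show "\<Psi> t (Lt_tensor \<alpha> g (x + y)) - \<alpha> g (\<Psi> t (x + y))
        = (\<Psi> t (Lt_tensor \<alpha> g x) - \<alpha> g (\<Psi> t x)) + (\<Psi> t (Lt_tensor \<alpha> g y) - \<alpha> g (\<Psi> t y))"
      by (simp add: add ucp_add[OF \<alpha>] Lt_tensor_add[OF action])
  next
    fix t :: real and g x assume "t \<ge> 0"
    then have \<Psi>t: "ucp (\<Psi> t)" by (rule \<Psi>)
    have "norm (\<Psi> t (Lt_tensor \<alpha> g x)) \<le> 4 * norm x"
      using ucp_norm_le[OF \<Psi>t, of "Lt_tensor \<alpha> g x"] norm_Lt_tensor_le[OF action, of g x] by simp
    moreover have "norm (\<alpha> g (\<Psi> t x)) \<le> 4 * norm x"
      using ucp_norm_le[OF \<alpha>, of g "\<Psi> t x"] ucp_norm_le[OF \<Psi>t, of x] by simp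
    ultimately show "norm (\<Psi> t (Lt_tensor \<alpha> g x) - \<alpha> g (\<Psi> t x)) \<le> 8 * norm x"
      using norm_triangle_ineq4[of "\<Psi> t (Lt_tensor \<alpha> g x)" "\<alpha> g (\<Psi> t x)"] by simp
  next
    fix c :: "'g \<Rightarrow>\<^sub>C complex" and a :: 'a
    \<comment> \<open>Telescoping: \<open>orbit\<close> leads to \<Phi>(Lt_g c) \<alpha>_g(a), this
      step to \<alpha>_g(\<Phi>(c)) \<alpha>_g(a), and the next one to \<alpha>_g(\<Psi>(c (x)
      a)).\<close>
    have 2: "vanishing (\<lambda>t g. (\<Phi> t (Lt g c) - \<alpha> g (\<Phi> t c)) * \<alpha> g a)"
      by (rule vanishing_mult_right[OF equivariant ucp_norm_le[OF \<alpha>]])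
    have 3: "vanishing (\<lambda>t g. \<alpha> g (\<Phi> t c * a - \<Psi> t (c \<otimes>\<^sub>C a)))"
    proof (rule vanishing_bound[OF vanishing_const[OF tensor[of c a]]])
      show "\<forall>\<^sub>F t in at_top. \<forall>g. norm (\<alpha> g (\<Phi> t c * a - \<Psi> t (c \<otimes>\<^sub>C a))) \<le> 2 * norm (\<Psi> t (c \<otimes>\<^sub>C a) - \<Phi> t c * a)"
        using ucp_norm_le[OF \<alpha>] by (simp add: norm_minus_commute)
    qed
    have "Lt_tensor \<alpha> g (c \<otimes>\<^sub>C a) = Lt g c \<otimes>\<^sub>C \<alpha> g a" for g
      by (rule Lt_tensor_elem_tensor[OF ucp_clinear[OF \<alpha>]])
    then show "vanishing (\<lambda>t g. \<Psi> t (Lt_tensor \<alpha> g (c \<otimes>\<^sub>C a)) - \<alpha> g (\<Psi> t (c \<otimes>\<^sub>C a)))"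
      using vanishing_add[OF orbit[of c a] vanishing_add[OF 2 3]]
      by (simp add: ucp_diff[OF \<alpha>] \<alpha>_mult algebra_simps)
  qed
qed

section \<open>Reduction to maps that are unital and completely positive at all times\<close>

text \<open>The Rokhlin property gives unital completely positive maps only from some time on,
  whereas \<Psi> has to consist of such maps at all times.\<close>

lemma continuous_Rokhlin_propertyE:
  fixes \<alpha> :: "'g::topological_group_add \<Rightarrow> 'a::unital_cstar_algebra \<Rightarrow> 'a"
  assumes "continuous_Rokhlin_property \<alpha>"
  obtains \<Phi> :: "real \<Rightarrow> ('g \<Rightarrow>\<^sub>C complex) \<Rightarrow> 'a" where "\<And>t. ucp (\<Phi> t)" "\<And>c. continuous_on UNIV (\<lambda>t. \<Phi> t c)"
    "\<And>c d. ((\<lambda>t. norm (\<Phi> t (c * d) - \<Phi> t c * \<Phi> t d)) \<longlongrightarrow> 0) at_top"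
    "\<And>c b. ((\<lambda>t. norm (\<Phi> t c * b - b * \<Phi> t c)) \<longlongrightarrow> 0) at_top"
    "\<And>c. vanishing (\<lambda>t g. \<Phi> t (Lt g c) - \<alpha> g (\<Phi> t c))"
proof -
  obtain \<Phi> :: "real \<Rightarrow> ('g \<Rightarrow>\<^sub>C complex) \<Rightarrow> 'a" where \<Phi>: "asymptotic_morphism \<Phi>" "asymptotic_unital \<Phi>"
    "asymptotic_completely_positive \<Phi>" "asymptotic_equivariant Lt \<alpha> \<Phi>" "asymptotic_central \<Phi>"
    using assms unfolding continuous_Rokhlin_property_def by blast
  obtain t1 t2 where t1: "t1 \<ge> 0" "\<And>t. t \<ge> t1 \<Longrightarrow> \<Phi> t 1 = 1"
    and t2: "t2 \<ge> 0" "\<And>t. t \<ge> t2 \<Longrightarrow> completely_positive (\<Phi> t)"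
    using \<Phi>(2,3) unfolding asymptotic_unital_def asymptotic_completely_positive_def by blast
  define \<tau> where "\<tau> t = max t (max t1 t2)" for t
  have \<tau>: "filterlim \<tau> at_top at_top"
    by (rule filterlim_at_top_mono[OF filterlim_ident]) (simp add: \<tau>_def)
  show ?thesis
  proof (rule that[of "\<lambda>t. \<Phi> (\<tau> t)"])
    show "ucp (\<Phi> (\<tau> t))" for t
      unfolding ucp_def by (auto intro!: t1 t2 simp: \<tau>_def)
    show "continuous_on UNIV (\<lambda>t. \<Phi> (\<tau> t) c)" for c
    proof (rule continuous_on_compose2[of "{0..}" "\<lambda>t. \<Phi> t c"])
      show "continuous_on {0..} (\<lambda>t. \<Phi> t c)"
        using \<Phi>(1) by (simp add: asymptotic_morphism_def)
      show "continuous_on UNIV \<tau>"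
        unfolding \<tau>_def[abs_def] by (intro continuous_intros)
    qed (use t1(1) in \<open>auto simp: \<tau>_def\<close>)
    show "((\<lambda>t. norm (\<Phi> (\<tau> t) (c * d) - \<Phi> (\<tau> t) c * \<Phi> (\<tau> t) d)) \<longlongrightarrow> 0) at_top" for c d
      using \<Phi>(1) unfolding asymptotic_morphism_def
      by (intro filterlim_compose[OF _ \<tau>, where g = "\<lambda>t. norm (\<Phi> t (c * d) - \<Phi> t c * \<Phi> t d)"]) blast
    show "((\<lambda>t. norm (\<Phi> (\<tau> t) c * b - b * \<Phi> (\<tau> t) c)) \<longlongrightarrow> 0) at_top" for c b
      using \<Phi>(5) unfolding asymptotic_central_def
      by (intro filterlim_compose[OF _ \<tau>, where g = "\<lambda>t. norm (\<Phi> t c * b - b * \<Phi> t c)"]) blast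
    show "vanishing (\<lambda>t g. \<Phi> (\<tau> t) (Lt g c) - \<alpha> g (\<Phi> (\<tau> t) c))" for c
      using \<Phi>(4) unfolding asymptotic_equivariant_def vanishing_SUP_iff
      by (intro filterlim_compose[OF _ \<tau>, where g = "\<lambda>t. SUP g. ereal (norm (\<Phi> t (Lt g c) - \<alpha> g (\<Phi> t c)))"]) blast
  qed
qed

section \<open>The restriction to \<open>C(G)\<close>\<close>

lemma continuous_Rokhlin_propertyI:
  fixes \<alpha> :: "'g::topological_group_add \<Rightarrow> 'a::unital_cstar_algebra \<Rightarrow> 'a"
    and \<Psi> :: "real \<Rightarrow> ('g \<Rightarrow>\<^sub>C 'a) \<Rightarrow> 'a"
  assumes action: "continuous_action \<alpha>"
    and \<Psi>: "\<And>t. t \<ge> 0 \<Longrightarrow> ucp (\<Psi> t)"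
    and cont: "\<And>x. continuous_on {0..} (\<lambda>t. \<Psi> t x)"
    and mult: "\<And>x y. ((\<lambda>t. norm (\<Psi> t (x * y) - \<Psi> t x * \<Psi> t y)) \<longlongrightarrow> 0) at_top"
    and equivariant: "\<And>x. ((\<lambda>t. SUP g. ereal (norm (\<Psi> t (Lt_tensor \<alpha> g x) - \<alpha> g (\<Psi> t x)))) \<longlongrightarrow> 0) at_top"
    and sect: "\<And>a. ((\<lambda>t. \<Psi> t (1 \<otimes>\<^sub>C a)) \<longlongrightarrow> a) at_top"
  shows "continuous_Rokhlin_property \<alpha>"
proof -
  let ?\<iota> = "\<lambda>f :: 'g \<Rightarrow>\<^sub>C complex. f \<otimes>\<^sub>C (1::'a)"
  define \<Phi> where "\<Phi> t f = \<Psi> t (?\<iota> f)" for t f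
  have \<iota>_mult: "?\<iota> (f * f') = ?\<iota> f * ?\<iota> f'" for f f'
    by (simp add: elem_tensor_mult)
  have \<iota>_cp: "completely_positive ?\<iota>"
    by (intro completely_positive_hom \<iota>_mult)
      (auto simp: clinear_def elem_tensor_bilinear adj_elem_tensor)
  have ucp: "ucp (\<Phi> t)" if "t \<ge> 0" for t
    unfolding ucp_def
  proof
    show "completely_positive (\<Phi> t)"
      unfolding \<Phi>_def[abs_def]
      by (rule completely_positive_compose[OF ucp_completely_positive[OF \<Psi>[OF that]] \<iota>_cp])
    show "\<Phi> t 1 = 1"
      using ucp_one[OF \<Psi>[OF that]] by (simp add: \<Phi>_def one_elem_tensor_one)
  qed
  have ev: "\<forall>\<^sub>F t::real in at_top. t \<ge> 0"
    by (rule eventually_ge_at_top)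
  have "asymptotic_morphism \<Phi>"
    unfolding asymptotic_morphism_def
  proof (intro conjI allI)
    show "continuous_on {0..} (\<lambda>t. \<Phi> t c)" for c
      unfolding \<Phi>_def by (rule cont)
    show "((\<lambda>t. norm (\<Phi> t (l *\<^sub>C c + d) - l *\<^sub>C \<Phi> t c - \<Phi> t d)) \<longlongrightarrow> 0) at_top" for l c d
    proof (rule tendsto_eventually)
      show "\<forall>\<^sub>F t in at_top. norm (\<Phi> t (l *\<^sub>C c + d) - l *\<^sub>C \<Phi> t c - \<Phi> t d) = 0"
        using ev
      proof eventually_elim
        case (elim t)
        show ?case by (simp add: ucp_add[OF ucp[OF elim]] ucp_scaleC[OF ucp[OF elim]])
      qed
    qed
    show "((\<lambda>t. norm (\<Phi> t (c * d) - \<Phi> t c * \<Phi> t d)) \<longlongrightarrow> 0) at_top" for c d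
      unfolding \<Phi>_def \<iota>_mult by (rule mult)
    show "((\<lambda>t. norm (\<Phi> t (adj c) - adj (\<Phi> t c))) \<longlongrightarrow> 0) at_top" for c
    proof (rule tendsto_eventually)
      show "\<forall>\<^sub>F t in at_top. norm (\<Phi> t (adj c) - adj (\<Phi> t c)) = 0"
        using ev by eventually_elim (simp add: ucp_adj[OF ucp])
    qed
  qed
  moreover have "asymptotic_unital \<Phi>"
    unfolding asymptotic_unital_def using ucp_one[OF ucp] by (intro exI[of _ 0]) auto
  moreover have "asymptotic_completely_positive \<Phi>"
    unfolding asymptotic_completely_positive_def
    using ucp_completely_positive[OF ucp] by (intro exI[of _ 0]) auto
  moreover have "asymptotic_equivariant Lt \<alpha> \<Phi>"
  proof -
    note \<alpha> = ucp_continuous_action[OF action]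
    have "Lt_tensor \<alpha> g (?\<iota> c) = ?\<iota> (Lt g c)" for g c
      by (simp add: Lt_tensor_elem_tensor[OF ucp_clinear[OF \<alpha>]] ucp_one[OF \<alpha>])
    then show ?thesis
      using equivariant[of "?\<iota> _"] by (simp add: asymptotic_equivariant_def \<Phi>_def)
  qed
  moreover have "asymptotic_central \<Phi>"
    unfolding asymptotic_central_def
  proof (intro allI)
    fix c and b :: 'a
    let ?b = "\<lambda>t. \<Psi> t (1 \<otimes>\<^sub>C b)" and ?cb = "\<lambda>t. \<Psi> t (c \<otimes>\<^sub>C b)"
    have bound: "norm (\<Phi> t c) \<le> 2 * norm c" if "t \<ge> 0" for t
      using ucp_norm_le[OF ucp[OF that]] .
    have b: "vanishing (\<lambda>t (_::unit). b - ?b t)" "vanishing (\<lambda>t (_::unit). ?b t - b)"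
      using tendsto_norm_zero[OF LIM_zero[OF sect[of b]]]
      by (simp_all add: vanishing_unit_iff norm_minus_commute)
    have m1: "vanishing (\<lambda>t (_::unit). \<Phi> t c * ?b t - ?cb t)"
      using mult[of "?\<iota> c" "1 \<otimes>\<^sub>C b"]
      by (simp add: vanishing_unit_iff elem_tensor_mult \<Phi>_def norm_minus_commute)
    have m2: "vanishing (\<lambda>t (_::unit). ?cb t - ?b t * \<Phi> t c)"
      using mult[of "1 \<otimes>\<^sub>C b" "?\<iota> c"]
      by (simp add: vanishing_unit_iff elem_tensor_mult \<Phi>_def)
    \<comment> \<open>With b replaced by \<Psi>(1 (x) b), its products with \<Phi>(c) from either
      side are both close to \<Psi>(c (x) b); the four terms telescope to the commutator.\<close>
    have "vanishing (\<lambda>t (_::unit). \<Phi> t c * (b - ?b t) + ((\<Phi> t c * ?b t - ?cb t)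
        + ((?cb t - ?b t * \<Phi> t c) + (?b t - b) * \<Phi> t c)))"
      by (intro vanishing_add m1 m2 vanishing_mult_left[OF b(1) bound] vanishing_mult_right[OF b(2) bound])
    then have "vanishing (\<lambda>t (_::unit). \<Phi> t c * b - b * \<Phi> t c)"
      by (simp add: algebra_simps)
    then show "((\<lambda>t. norm (\<Phi> t c * b - b * \<Phi> t c)) \<longlongrightarrow> 0) at_top"
      by (simp add: vanishing_unit_iff)
  qed
  ultimately show ?thesis
    unfolding continuous_Rokhlin_property_def by blast
qed

theorem theoremA:
  fixes \<alpha> :: "'g::{topological_group_add, t2_space, second_countable_topology}
      \<Rightarrow> 'a::unital_cstar_algebra \<Rightarrow> 'a"
  assumes "compact (UNIV :: 'g set)"
    and "separable_space (euclidean :: 'a topology)"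
    and "continuous_action \<alpha>"
  shows "continuous_Rokhlin_property \<alpha> \<longleftrightarrow>
    (\<exists>\<Psi> :: real \<Rightarrow> ('g \<Rightarrow>\<^sub>C 'a) \<Rightarrow> 'a.
      (\<forall>t\<ge>0. completely_positive (\<Psi> t) \<and> \<Psi> t 1 = 1) \<and>
      (\<forall>x. continuous_on {0..} (\<lambda>t. \<Psi> t x)) \<and>
      (\<forall>x y. ((\<lambda>t. norm (\<Psi> t (x * y) - \<Psi> t x * \<Psi> t y)) \<longlongrightarrow> 0) at_top) \<and>
      (\<forall>x. ((\<lambda>t. SUP g. ereal (norm (\<Psi> t (Lt_tensor \<alpha> g x) - \<alpha> g (\<Psi> t x)))) \<longlongrightarrow> 0) at_top) \<and>
      (\<forall>a. ((\<lambda>t. \<Psi> t (1 \<otimes>\<^sub>C a)) \<longlongrightarrow> a) at_top))"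
proof
  assume "continuous_Rokhlin_property \<alpha>"
  then obtain \<Phi> :: "real \<Rightarrow> ('g \<Rightarrow>\<^sub>C complex) \<Rightarrow> 'a" where \<Phi>: "\<And>t. ucp (\<Phi> t)"
    "\<And>c. continuous_on UNIV (\<lambda>t. \<Phi> t c)"
    and mult: "\<And>c d. ((\<lambda>t. norm (\<Phi> t (c * d) - \<Phi> t c * \<Phi> t d)) \<longlongrightarrow> 0) at_top"
    and central: "\<And>c b. ((\<lambda>t. norm (\<Phi> t c * b - b * \<Phi> t c)) \<longlongrightarrow> 0) at_top"
    and equivariant: "\<And>c. vanishing (\<lambda>t g. \<Phi> t (Lt g c) - \<alpha> g (\<Phi> t c))"
    by (rule continuous_Rokhlin_propertyE) blast
  obtain \<Psi> where \<Psi>: "\<And>t. t \<ge> 0 \<Longrightarrow> ucp (\<Psi> t)" "\<And>x. continuous_on {0..} (\<lambda>t. \<Psi> t x)"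
    and tensor: "\<And>c a. vanishing (\<lambda>t (_::unit). \<Psi> t (c \<otimes>\<^sub>C a) - \<Phi> t c * a)"
    by (rule tensor_extension[OF assms(1,2) \<Phi> mult central]) blast
  show "\<exists>\<Psi> :: real \<Rightarrow> ('g \<Rightarrow>\<^sub>C 'a) \<Rightarrow> 'a.
      (\<forall>t\<ge>0. completely_positive (\<Psi> t) \<and> \<Psi> t 1 = 1) \<and>
      (\<forall>x. continuous_on {0..} (\<lambda>t. \<Psi> t x)) \<and>
      (\<forall>x y. ((\<lambda>t. norm (\<Psi> t (x * y) - \<Psi> t x * \<Psi> t y)) \<longlongrightarrow> 0) at_top) \<and>
      (\<forall>x. ((\<lambda>t. SUP g. ereal (norm (\<Psi> t (Lt_tensor \<alpha> g x) - \<alpha> g (\<Psi> t x)))) \<longlongrightarrow> 0) at_top) \<and>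
      (\<forall>a. ((\<lambda>t. \<Psi> t (1 \<otimes>\<^sub>C a)) \<longlongrightarrow> a) at_top)"
  proof (intro exI[of _ \<Psi>] conjI allI impI)
    fix x y a
    show "continuous_on {0..} (\<lambda>t. \<Psi> t x)"
      by (rule \<Psi>)
    show "((\<lambda>t. norm (\<Psi> t (x * y) - \<Psi> t x * \<Psi> t y)) \<longlongrightarrow> 0) at_top"
      by (rule extension_multiplicative[OF assms(1) \<Phi>(1) \<Psi>(1) tensor mult central])
    show "((\<lambda>t. SUP g. ereal (norm (\<Psi> t (Lt_tensor \<alpha> g x) - \<alpha> g (\<Psi> t x)))) \<longlongrightarrow> 0) at_top"
      using extension_equivariant[OF assms(1,3) \<Phi>(1) \<Psi>(1) tensor equivariant]
      by (simp add: vanishing_SUP_iff)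
    show "((\<lambda>t. \<Psi> t (1 \<otimes>\<^sub>C a)) \<longlongrightarrow> a) at_top"
      by (rule extension_section[OF assms(1) \<Phi>(1) \<Psi>(1) tensor])
  qed (auto intro: ucp_completely_positive ucp_one \<Psi>)
next
  assume "\<exists>\<Psi> :: real \<Rightarrow> ('g \<Rightarrow>\<^sub>C 'a) \<Rightarrow> 'a.
      (\<forall>t\<ge>0. completely_positive (\<Psi> t) \<and> \<Psi> t 1 = 1) \<and>
      (\<forall>x. continuous_on {0..} (\<lambda>t. \<Psi> t x)) \<and>
      (\<forall>x y. ((\<lambda>t. norm (\<Psi> t (x * y) - \<Psi> t x * \<Psi> t y)) \<longlongrightarrow> 0) at_top) \<and>
      (\<forall>x. ((\<lambda>t. SUP g. ereal (norm (\<Psi> t (Lt_tensor \<alpha> g x) - \<alpha> g (\<Psi> t x)))) \<longlongrightarrow> 0) at_top) \<and>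
      (\<forall>a. ((\<lambda>t. \<Psi> t (1 \<otimes>\<^sub>C a)) \<longlongrightarrow> a) at_top)"
  then obtain \<Psi> :: "real \<Rightarrow> ('g \<Rightarrow>\<^sub>C 'a) \<Rightarrow> 'a" where
    "\<And>t. t \<ge> 0 \<Longrightarrow> ucp (\<Psi> t)"
    "\<And>x. continuous_on {0..} (\<lambda>t. \<Psi> t x)"
    "\<And>x y. ((\<lambda>t. norm (\<Psi> t (x * y) - \<Psi> t x * \<Psi> t y)) \<longlongrightarrow> 0) at_top"
    "\<And>x. ((\<lambda>t. SUP g. ereal (norm (\<Psi> t (Lt_tensor \<alpha> g x) - \<alpha> g (\<Psi> t x)))) \<longlongrightarrow> 0) at_top"
    "\<And>a. ((\<lambda>t. \<Psi> t (1 \<otimes>\<^sub>C a)) \<longlongrightarrow> a) at_top"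
    unfolding ucp_def by blast
  then show "continuous_Rokhlin_property \<alpha>"
    by (rule continuous_Rokhlin_propertyI[OF assms(3)])
qed

end
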